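(* Let $n\geqslant 2$, let $\mathbb{M}^n$ and $\mathbb{M}_*^n$ be $n$-dimensional Riemannian manifolds with $\mathbb{M}^n$ compact, let $D\subset\mathbb{M}^n$ be a domain, let $b\in\partial D$, and let $Q:\mathbb{M}^n\to[0,\infty]$ be a measurable function with $Q(x)=0$ for all $x\notin D$. Let $f:D\to\mathbb{M}_*^n$ be an open discrete (continuous) mapping which is a ring $Q$-mapping at the point $b$, and put $D'=f(D)$. Suppose that $D$ is locally connected at $b$, that $C(f,\partial D)\subset\partial D'$, and that $\partial D'$ is strongly accessible at at least one point $y\in C(f,b)$. Suppose further that $Q$ has finite mean oscillation at the point $b$. Then $C(f,b)=\{y\}$.
   Context: Riemannian manifolds are smooth ($C^\infty$), Hausdorff, second countable, without boundary, not necessarily connected; $d$ is the geodesic distance on $\mathbb{M}^n$ (points in different components are regarded as being at infinite distance) and $v$ is the Riemannian volume measure. A domain is a nonempty open connected set. $B(x_0,r)=\{x\in\mathbb{M}^n: d(x,x_0)<r\}$, $A(r_1,r_2,x_0)=\{x\in\mathbb{M}^n: r_1<d(x,x_0)<r_2\}$. Mappings are continuous; $f$ is open if images of open sets are open, and discrete if every fibre $f^{-1}(z)$ consists of isolated points. A continuum is a compact connected set. Normal neighbourhood: an open neighbourhood $U$ of $x_0$ carrying Riemannian normal coordinates centred at $x_0$, so that geodesic spheres centred at $x_0$ and lying in $U$ correspond to Euclidean spheres of the same radius. Modulus: for a family $\Gamma$ of curves in an $n$-dimensional Riemannian manifold $N$ with volume measure $v_N$, a Borel function $\rho:N\to[0,\infty]$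 is admissible for $\Gamma$ ($\rho\in\mathrm{adm}\,\Gamma$) if $\int_\gamma\rho\,ds\geqslant1$ (arc length integral) for every locally rectifiable $\gamma\in\Gamma$; $M(\Gamma)=\inf_{\rho\in\mathrm{adm}\,\Gamma}\int_N\rho^n\,dv_N$, with $M(\Gamma)=\infty$ if $\mathrm{adm}\,\Gamma=\varnothing$. For a mapping $f$, $f(\Gamma)=\{f\circ\gamma:\gamma\in\Gamma\}$. $\Gamma(E,F,G)$ is the family of all curves joining $E$ and $F$ in $G$, i.e. continuous $\gamma:[s,t]\to N$ with $\gamma(s)\in E$, $\gamma(t)\in F$ and $\gamma(\tau)\in G$ for $s<\tau<t$. Ring $Q$-mapping at $b\in\partial D$: there is $r_0>0$, with $\overline{B(b,r_0)}$ contained in a normal neighbourhood of $b$, such that for all $0<r_1<r_2<r_0$ and all continua $E_1\subset\overline{B(b,r_1)}\cap D$, $E_2\subset(\mathbb{M}^n\setminus B(b,r_2))\cap D$, the inequality $$M\big(f(\Gamma(E_1,E_2,D))\big)\leqslant\int_{A(r_1,r_2,b)}Q(x)\,\eta^n(d(x,b))\,dv(x)$$ holds for every measurable $\eta:(r_1,r_2)\to[0,\infty]$ with $\int_{r_1}^{r_2}\eta(r)\,dr\geqslant1$. Cluster sets: for $x\in\partial D$, $C(f,x)=\{z\in\mathbb{M}_*^n:\ \exists\,x_k\in D,\ x_k\to x,\ f(x_k)\to z\}$, and $C(f,\partial D)=\bigcup_{x\in\partial D}C(f,x)$. $D$ is locally connected at $b\in\partial D$ if every neighbourhood $U$ of $b$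 contains a neighbourhood $V$ of $b$ such that $V\cap D$ is connected. $\partial D'$ is strongly accessible at $y\in\partial D'$ if for every neighbourhood $U$ of $y$ there exist a compact set $E\subset D'$, a neighbourhood $V\subset U$ of $y$ and $\delta>0$ such that $M(\Gamma(E,F,D'))\geqslant\delta$ for every continuum $F\subset D'$ intersecting both $\partial U$ and $\partial V$. Finite mean oscillation: $Q$ has finite mean oscillation at $b$ if $Q$ is integrable (with respect to $v$) in some ball $B(b,r)$, $r>0$, and $$\limsup_{\varepsilon\to0}\frac1{v(B(b,\varepsilon))}\int_{B(b,\varepsilon)}|Q(x)-\overline{Q}_\varepsilon|\,dv(x)<\infty,\qquad \overline{Q}_\varepsilon=\frac1{v(B(b,\varepsilon))}\int_{B(b,\varepsilon)}Q(x)\,dv(x).$$ *)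

theory Defs
  imports "HOL-Analysis.Analysis"
begin

section \<open>Smooth functions on open subsets of Euclidean space\<close>

definition partial_deriv ::
    "'n \<Rightarrow> (real^'n \<Rightarrow> 'b::real_normed_vector) \<Rightarrow> real^'n \<Rightarrow> 'b" where
  "partial_deriv i f x = frechet_derivative f (at x) (axis i 1)"

primrec Ck_on ::
    "nat \<Rightarrow> (real^'n \<Rightarrow> 'b::real_normed_vector) \<Rightarrow> (real^'n) set \<Rightarrow> bool" where
  "Ck_on 0 f S \<longleftrightarrow> continuous_on S f"
| "Ck_on (Suc k) f S \<longleftrightarrow>
     (\<forall>x\<in>S. f differentiable (at x)) \<and> (\<forall>i. Ck_on k (partial_deriv i f) S)"

definition smooth_on :: "(real^'n) set \<Rightarrow> (real^'n \<Rightarrow> 'b::real_normed_vector) \<Rightarrow> bool" where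
  "smooth_on S f \<longleftrightarrow> (\<forall>k. Ck_on k f S)"

section \<open>Riemannian manifolds\<close>

text \<open>
  The underlying space of a manifold is a whole type \<open>'a\<close> whose class makes it Hausdorff and
  second countable; the dimension is \<open>CARD('n)\<close>. A chart is a pair of a domain and a
  coordinate map; the values of the map outside the domain are irrelevant. The
  metric tensor is given by its coefficient matrix \<open>gmat M c p\<close> in each chart \<open>c\<close> at each
  point \<open>p\<close> of the domain of \<open>c\<close>, subject to the transformation law of a (0,2)-tensor.
\<close>

type_synonym ('a, 'n) chart = "'a set \<times> ('a \<Rightarrow> real^'n)"

record ('a, 'n) riem =
  atlas :: "('a, 'n) chart set"
  gmat :: "('a, 'n) chart \<Rightarrow> 'a \<Rightarrow> real^'n^'n"

definition is_chart :: "('a::topological_space, 'n::finite) chart \<Rightarrow> bool" where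
  "is_chart c \<longleftrightarrow> open (fst c) \<and> open (snd c ` fst c) \<and>
     homeomorphism (fst c) (snd c ` fst c) (snd c) (inv_into (fst c) (snd c))"

definition transition ::
    "('a, 'n::finite) chart \<Rightarrow> ('a, 'n) chart \<Rightarrow> real^'n \<Rightarrow> real^'n" where
  "transition c c' = snd c' \<circ> inv_into (fst c) (snd c)"

definition compatible_charts ::
    "('a, 'n::finite) chart \<Rightarrow> ('a, 'n) chart \<Rightarrow> bool" where
  "compatible_charts c c' \<longleftrightarrow>
     smooth_on (snd c ` (fst c \<inter> fst c')) (transition c c') \<and>
     smooth_on (snd c' ` (fst c \<inter> fst c')) (transition c' c)"

definition gform :: "('a, 'n::finite) riem \<Rightarrow> ('a, 'n) chart \<Rightarrow> 'a \<Rightarrow> real^'n \<Rightarrow> real^'n \<Rightarrow> real" where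
  "gform M c p u w = u \<bullet> (gmat M c p *v w)"

definition gcoord :: "('a, 'n::finite) riem \<Rightarrow> ('a, 'n) chart \<Rightarrow> real^'n \<Rightarrow> real^'n^'n" where
  "gcoord M c x = gmat M c (inv_into (fst c) (snd c) x)"

definition riemannian_manifold ::
    "('a::{t2_space, second_countable_topology}, 'n::finite) riem \<Rightarrow> bool" where
  "riemannian_manifold M \<longleftrightarrow>
     (\<Union>c\<in>atlas M. fst c) = UNIV \<and>
     (\<forall>c\<in>atlas M. is_chart c) \<and>
     (\<forall>c\<in>atlas M. \<forall>c'\<in>atlas M. compatible_charts c c') \<and>
     (\<forall>c\<in>atlas M. smooth_on (snd c ` fst c) (gcoord M c)) \<and>
     (\<forall>c\<in>atlas M. \<forall>p\<in>fst c.
        transpose (gmat M c p) = gmat M c p \<and> (\<forall>u. u \<noteq> 0 \<longrightarrow> gform M c p u u > 0)) \<and>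
     (\<forall>c\<in>atlas M. \<forall>c'\<in>atlas M. \<forall>p\<in>fst c \<inter> fst c'.
        let J = jacobian (transition c c') (at (snd c p))
        in gmat M c p = transpose J ** gmat M c' p ** J)"

subsection \<open>Geodesic distance\<close>

definition C1_curve ::
    "('a::topological_space, 'n::finite) riem \<Rightarrow> real \<Rightarrow> real \<Rightarrow> (real \<Rightarrow> 'a) \<Rightarrow> bool" where
  "C1_curve M a b \<gamma> \<longleftrightarrow> continuous_on {a..b} \<gamma> \<and>
     (\<forall>c\<in>atlas M. \<exists>w. continuous_on {t\<in>{a..b}. \<gamma> t \<in> fst c} w \<and>
        (\<forall>t\<in>{a..b}. \<gamma> t \<in> fst c \<longrightarrow>
           ((snd c \<circ> \<gamma>) has_vector_derivative w t) (at t within {a..b})))"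

definition piecewise_C1_curve ::
    "('a::topological_space, 'n::finite) riem \<Rightarrow> (real \<Rightarrow> 'a) \<Rightarrow> bool" where
  "piecewise_C1_curve M \<gamma> \<longleftrightarrow>
     (\<exists>k (\<tau> :: nat \<Rightarrow> real). \<tau> 0 = 0 \<and> \<tau> k = 1 \<and>
        (\<forall>i<k. \<tau> i < \<tau> (Suc i) \<and> C1_curve M (\<tau> i) (\<tau> (Suc i)) \<gamma>))"

text \<open>The speed does not depend on the chart chosen, by the transformation law.\<close>

definition speed :: "('a, 'n::finite) riem \<Rightarrow> (real \<Rightarrow> 'a) \<Rightarrow> real \<Rightarrow> real" where
  "speed M \<gamma> t =
     (let c = (SOME c. c \<in> atlas M \<and> \<gamma> t \<in> fst c);
          w = vector_derivative (snd c \<circ> \<gamma>) (at t)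
      in sqrt (gform M c (\<gamma> t) w w))"

definition riem_length :: "('a, 'n::finite) riem \<Rightarrow> (real \<Rightarrow> 'a) \<Rightarrow> ennreal" where
  "riem_length M \<gamma> = (\<integral>\<^sup>+ t\<in>{0..1}. ennreal (speed M \<gamma> t) \<partial>lborel)"

text \<open>The infimum over the empty set is \<open>\<infinity>\<close>: points in different components are at infinite distance.\<close>

definition gdist :: "('a::topological_space, 'n::finite) riem \<Rightarrow> 'a \<Rightarrow> 'a \<Rightarrow> ennreal" where
  "gdist M x y =
     (INF \<gamma>\<in>{\<gamma>. piecewise_C1_curve M \<gamma> \<and> \<gamma> 0 = x \<and> \<gamma> 1 = y}. riem_length M \<gamma>)"

definition gball :: "('a::topological_space, 'n::finite) riem \<Rightarrow> 'a \<Rightarrow> real \<Rightarrow> 'a set" where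
  "gball M x0 r = {x. gdist M x x0 < ennreal r}"

definition gsphere :: "('a::topological_space, 'n::finite) riem \<Rightarrow> 'a \<Rightarrow> real \<Rightarrow> 'a set" where
  "gsphere M x0 r = {x. gdist M x x0 = ennreal r}"

definition gannulus ::
    "('a::topological_space, 'n::finite) riem \<Rightarrow> real \<Rightarrow> real \<Rightarrow> 'a \<Rightarrow> 'a set" where
  "gannulus M r1 r2 x0 = {x. ennreal r1 < gdist M x x0 \<and> gdist M x x0 < ennreal r2}"

subsection \<open>Riemannian volume\<close>

text \<open>
  The Borel measure that is \<open>sqrt (det g) dx\<close> in every chart (it is unique since countably many
  chart domains cover the space), completed, so that \<open>measurable\<close> means
  measurable with respect to the complete volume measure.
\<close>

definition riem_borel_volume ::
    "('a::{t2_space, second_countable_topology}, 'n::finite) riem \<Rightarrow> 'a measure" where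
  "riem_borel_volume M = (THE \<mu>. sets \<mu> = sets borel \<and>
     (\<forall>c\<in>atlas M. \<forall>S\<in>sets borel. S \<subseteq> fst c \<longrightarrow>
        emeasure \<mu> S = (\<integral>\<^sup>+ x\<in>snd c ` S. ennreal (sqrt (det (gcoord M c x))) \<partial>lborel)))"

definition riem_volume ::
    "('a::{t2_space, second_countable_topology}, 'n::finite) riem \<Rightarrow> 'a measure" where
  "riem_volume M = completion (riem_borel_volume M)"

subsection \<open>Geodesics and normal neighbourhoods\<close>

definition christoffel ::
    "('a, 'n::finite) riem \<Rightarrow> ('a, 'n) chart \<Rightarrow> real^'n \<Rightarrow> 'n \<Rightarrow> 'n \<Rightarrow> 'n \<Rightarrow> real" where
  "christoffel M c x k i j =
     (\<Sum>l\<in>UNIV. matrix_inv (gcoord M c x) $ k $ l *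
        (partial_deriv i (\<lambda>y. gcoord M c y $ j $ l) x
         + partial_deriv j (\<lambda>y. gcoord M c y $ i $ l) x
         - partial_deriv l (\<lambda>y. gcoord M c y $ i $ j) x)) / 2"

definition geodesic ::
    "('a::topological_space, 'n::finite) riem \<Rightarrow> real \<Rightarrow> real \<Rightarrow> (real \<Rightarrow> 'a) \<Rightarrow> bool" where
  "geodesic M a b \<gamma> \<longleftrightarrow> continuous_on {a..b} \<gamma> \<and>
     (\<forall>c\<in>atlas M. \<exists>w. \<forall>t\<in>{a..b}. \<gamma> t \<in> fst c \<longrightarrow>
        ((snd c \<circ> \<gamma>) has_vector_derivative w t) (at t within {a..b}) \<and>
        (w has_vector_derivative
           (\<chi> k. - (\<Sum>i\<in>UNIV. \<Sum>j\<in>UNIV.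
                      christoffel M c (snd c (\<gamma> t)) k i j * w t $ i * w t $ j)))
          (at t within {a..b}))"

text \<open>
  \<open>exp_rel M c p w q\<close>: the exponential map at \<open>p\<close> is defined at the tangent vector with
  components \<open>w\<close> in the chart \<open>c\<close>, and its value there is \<open>q\<close>.
\<close>

definition exp_rel ::
    "('a::topological_space, 'n::finite) riem \<Rightarrow> ('a, 'n) chart \<Rightarrow> 'a \<Rightarrow> real^'n \<Rightarrow> 'a \<Rightarrow> bool" where
  "exp_rel M c p w q \<longleftrightarrow>
     (\<exists>\<gamma>. geodesic M 0 1 \<gamma> \<and> \<gamma> 0 = p \<and> \<gamma> 1 = q \<and>
          ((snd c \<circ> \<gamma>) has_vector_derivative w) (at 0 within {0..1}))"

text \<open>
  Normal coordinates \<open>\<phi>\<close> at \<open>x0\<close> are an inverse of \<open>exp \<circ> E\<close>, where \<open>E\<close> is a linear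
  isometry of Euclidean space onto the tangent space at \<open>x0\<close>, on a star-shaped open set.
  Empty geodesic spheres have to be excluded in the last clause, since on a
  compact manifold all spheres of large radius are empty.
\<close>

definition normal_coordinates ::
    "('a::topological_space, 'n::finite) riem \<Rightarrow> 'a \<Rightarrow> 'a set \<Rightarrow> ('a \<Rightarrow> real^'n) \<Rightarrow> bool" where
  "normal_coordinates M x0 U \<phi> \<longleftrightarrow>
     x0 \<in> U \<and> is_chart (U, \<phi>) \<and> (\<forall>c\<in>atlas M. compatible_charts (U, \<phi>) c) \<and> \<phi> x0 = 0 \<and>
     (\<forall>v\<in>\<phi> ` U. closed_segment 0 v \<subseteq> \<phi> ` U) \<and>
     (\<exists>c\<in>atlas M. \<exists>E. x0 \<in> fst c \<and> linear E \<and> (\<forall>u w. gform M c x0 (E u) (E w) = u \<bullet> w) \<and>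
        (\<forall>p\<in>U. exp_rel M c x0 (E (\<phi> p)) p)) \<and>
     (\<forall>r>0. gsphere M x0 r \<noteq> {} \<and> gsphere M x0 r \<subseteq> U \<longrightarrow> \<phi> ` gsphere M x0 r = sphere 0 r)"

definition normal_neighbourhood ::
    "('a::topological_space, 'n::finite) riem \<Rightarrow> 'a \<Rightarrow> 'a set \<Rightarrow> bool" where
  "normal_neighbourhood M x0 U \<longleftrightarrow> (\<exists>\<phi>. normal_coordinates M x0 U \<phi>)"

section \<open>Curves and the modulus\<close>

text \<open>A curve is given by a parameter interval together with a map.\<close>

type_synonym 'a curve = "real set \<times> (real \<Rightarrow> 'a)"

definition curve_length ::
    "('a::topological_space, 'n::finite) riem \<Rightarrow> real set \<Rightarrow> (real \<Rightarrow> 'a) \<Rightarrow> ennreal" where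
  "curve_length M I \<gamma> =
     (SUP (k, \<tau>)\<in>{(k :: nat, \<tau> :: nat \<Rightarrow> real). mono_on {..k} \<tau> \<and> \<tau> ` {..k} \<subseteq> I}.
        \<Sum>i<k. gdist M (\<gamma> (\<tau> i)) (\<gamma> (\<tau> (Suc i))))"

definition locally_rectifiable ::
    "('a::topological_space, 'n::finite) riem \<Rightarrow> 'a curve \<Rightarrow> bool" where
  "locally_rectifiable M C \<longleftrightarrow>
     (\<forall>a b. a \<le> b \<and> {a..b} \<subseteq> fst C \<longrightarrow> curve_length M {a..b} (snd C) < \<infinity>)"

text \<open>
  The arc length integral over a compact interval is the integral along the arc length
  parametrization, whose value at \<open>s\<close> is \<open>\<gamma> t\<close> for any \<open>t\<close> such that \<open>\<gamma>\<close> has length \<open>s\<close>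
  on \<open>{a..t}\<close>.
\<close>

definition arc_integral_on ::
    "('a::topological_space, 'n::finite) riem \<Rightarrow> real \<Rightarrow> real \<Rightarrow> (real \<Rightarrow> 'a) \<Rightarrow>
      ('a \<Rightarrow> ennreal) \<Rightarrow> ennreal" where
  "arc_integral_on M a b \<gamma> \<rho> =
     (\<integral>\<^sup>+ s\<in>{0..enn2real (curve_length M {a..b} \<gamma>)}.
        \<rho> (\<gamma> (SOME t. t \<in> {a..b} \<and> curve_length M {a..t} \<gamma> = ennreal s)) \<partial>lborel)"

definition arc_integral ::
    "('a::topological_space, 'n::finite) riem \<Rightarrow> 'a curve \<Rightarrow> ('a \<Rightarrow> ennreal) \<Rightarrow> ennreal" where
  "arc_integral M C \<rho> =
     (SUP (a, b)\<in>{(a, b). a \<le> b \<and> {a..b} \<subseteq> fst C}. arc_integral_on M a b (snd C) \<rho>)"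

definition admissible ::
    "('a::topological_space, 'n::finite) riem \<Rightarrow> 'a curve set \<Rightarrow> ('a \<Rightarrow> ennreal) set" where
  "admissible M \<Gamma> = {\<rho>. \<rho> \<in> borel_measurable borel \<and>
     (\<forall>C\<in>\<Gamma>. locally_rectifiable M C \<longrightarrow> arc_integral M C \<rho> \<ge> 1)}"

definition modulus ::
    "('a::{t2_space, second_countable_topology}, 'n::finite) riem \<Rightarrow> 'a curve set \<Rightarrow> ennreal" where
  "modulus M \<Gamma> = (INF \<rho>\<in>admissible M \<Gamma>. \<integral>\<^sup>+ x. \<rho> x ^ CARD('n) \<partial>riem_volume M)"

definition joining_curves ::
    "'a::topological_space set \<Rightarrow> 'a set \<Rightarrow> 'a set \<Rightarrow> 'a curve set" where
  "joining_curves E F G = {({s..t}, \<gamma>) | s t \<gamma>. s < t \<and> continuous_on {s..t} \<gamma> \<and>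
     \<gamma> s \<in> E \<and> \<gamma> t \<in> F \<and> (\<forall>\<tau>. s < \<tau> \<and> \<tau> < t \<longrightarrow> \<gamma> \<tau> \<in> G)}"

definition image_curves :: "('a \<Rightarrow> 'b) \<Rightarrow> 'a curve set \<Rightarrow> 'b curve set" where
  "image_curves f \<Gamma> = (\<lambda>(I, \<gamma>). (I, f \<circ> \<gamma>)) ` \<Gamma>"

section \<open>Mappings and boundary behaviour\<close>

definition is_domain :: "'a::topological_space set \<Rightarrow> bool" where
  "is_domain D \<longleftrightarrow> D \<noteq> {} \<and> open D \<and> connected D"

definition is_continuum :: "'a::topological_space set \<Rightarrow> bool" where
  "is_continuum E \<longleftrightarrow> compact E \<and> connected E"

definition open_mapping_on ::
    "'a::topological_space set \<Rightarrow> ('a \<Rightarrow> 'b::topological_space) \<Rightarrow> bool" where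
  "open_mapping_on D f \<longleftrightarrow> (\<forall>S. open S \<and> S \<subseteq> D \<longrightarrow> open (f ` S))"

definition discrete_mapping_on ::
    "'a::topological_space set \<Rightarrow> ('a \<Rightarrow> 'b::topological_space) \<Rightarrow> bool" where
  "discrete_mapping_on D f \<longleftrightarrow> (\<forall>z. discrete {x \<in> D. f x = z})"

definition ring_Q_mapping_at ::
    "('a::{t2_space, second_countable_topology}, 'n::finite) riem \<Rightarrow>
     ('b::{t2_space, second_countable_topology}, 'n) riem \<Rightarrow>
     'a set \<Rightarrow> ('a \<Rightarrow> 'b) \<Rightarrow> ('a \<Rightarrow> ennreal) \<Rightarrow> 'a \<Rightarrow> bool" where
  "ring_Q_mapping_at M N D f Q b \<longleftrightarrow>
     (\<exists>r0>0. (\<exists>U. normal_neighbourhood M b U \<and> closure (gball M b r0) \<subseteq> U) \<and>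
        (\<forall>r1 r2 E1 E2. 0 < r1 \<and> r1 < r2 \<and> r2 < r0 \<and>
           is_continuum E1 \<and> E1 \<subseteq> closure (gball M b r1) \<inter> D \<and>
           is_continuum E2 \<and> E2 \<subseteq> (- gball M b r2) \<inter> D \<longrightarrow>
           (\<forall>\<eta> :: real \<Rightarrow> ennreal.
              \<eta> \<in> borel_measurable (lebesgue_on {r1<..<r2}) \<and>
              (\<integral>\<^sup>+ r. \<eta> r \<partial>lebesgue_on {r1<..<r2}) \<ge> 1 \<longrightarrow>
              modulus N (image_curves f (joining_curves E1 E2 D)) \<le>
                (\<integral>\<^sup>+ x\<in>gannulus M r1 r2 b.
                   Q x * \<eta> (enn2real (gdist M x b)) ^ CARD('n) \<partial>riem_volume M))))"

definition cluster_set ::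
    "('a::topological_space \<Rightarrow> 'b::topological_space) \<Rightarrow> 'a set \<Rightarrow> 'a \<Rightarrow> 'b set" where
  "cluster_set f D x =
     {z. \<exists>\<xi> :: nat \<Rightarrow> 'a. (\<forall>k. \<xi> k \<in> D) \<and> \<xi> \<longlonglongrightarrow> x \<and> (\<lambda>k. f (\<xi> k)) \<longlonglongrightarrow> z}"

definition domain_locally_connected_at :: "'a::topological_space set \<Rightarrow> 'a \<Rightarrow> bool" where
  "domain_locally_connected_at D b \<longleftrightarrow>
     (\<forall>U. open U \<and> b \<in> U \<longrightarrow> (\<exists>V. open V \<and> b \<in> V \<and> V \<subseteq> U \<and> connected (V \<inter> D)))"

text \<open>Here \<open>D\<close> is the domain, and accessibility is that of its boundary at \<open>y\<close>.\<close>

definition strongly_accessible_at ::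
    "('a::{t2_space, second_countable_topology}, 'n::finite) riem \<Rightarrow> 'a set \<Rightarrow> 'a \<Rightarrow> bool" where
  "strongly_accessible_at M D y \<longleftrightarrow> y \<in> frontier D \<and>
     (\<forall>U. open U \<and> y \<in> U \<longrightarrow>
        (\<exists>E V. \<exists>\<delta>>0. compact E \<and> E \<subseteq> D \<and> open V \<and> y \<in> V \<and> V \<subseteq> U \<and>
           (\<forall>F. is_continuum F \<and> F \<subseteq> D \<and> F \<inter> frontier U \<noteq> {} \<and> F \<inter> frontier V \<noteq> {} \<longrightarrow>
              modulus M (joining_curves E F D) \<ge> ennreal \<delta>)))"

definition mean_over ::
    "('a::{t2_space, second_countable_topology}, 'n::finite) riem \<Rightarrow> 'a set \<Rightarrow> ('a \<Rightarrow> ennreal) \<Rightarrow> ennreal" where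
  "mean_over M B h = (\<integral>\<^sup>+ x\<in>B. h x \<partial>riem_volume M) / emeasure (riem_volume M) B"

text \<open>
  \<open>Q\<close> takes values in \<open>[0, \<infinity>]\<close>, so the absolute difference is formed in \<open>ereal\<close>; the means
  are finite for small \<open>\<epsilon>\<close> by integrability.
\<close>

definition finite_mean_oscillation_at ::
    "('a::{t2_space, second_countable_topology}, 'n::finite) riem \<Rightarrow> ('a \<Rightarrow> ennreal) \<Rightarrow> 'a \<Rightarrow> bool" where
  "finite_mean_oscillation_at M Q b \<longleftrightarrow>
     (\<exists>r>0. Q \<in> borel_measurable (restrict_space (riem_volume M) (gball M b r)) \<and>
            (\<integral>\<^sup>+ x\<in>gball M b r. Q x \<partial>riem_volume M) < \<infinity>) \<and>
     Limsup (at_right 0) (\<lambda>\<epsilon>. mean_over M (gball M b \<epsilon>)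
       (\<lambda>x. e2ennreal \<bar>enn2ereal (Q x) - enn2ereal (mean_over M (gball M b \<epsilon>) Q)\<bar>)) < \<infinity>"

end

theory Submission
  imports Defs
begin

text \<open>
  Suppose that \<open>C(f, b)\<close> contains a point \<open>y'\<close> besides \<open>y\<close>, and separate \<open>y'\<close> from \<open>y\<close> by a
  neighbourhood \<open>U\<close> of \<open>y\<close>. As \<open>D\<close> is locally connected at \<open>b\<close>, arbitrarily close to \<open>b\<close> there
  are continua \<open>C\<close> in \<open>D\<close> whose images meet the boundaries of \<open>U\<close> and of any smaller
  neighbourhood of \<open>y\<close>, so by strong accessibility the curves joining \<open>f(C)\<close> to a fixed compact set
  \<open>E\<close> in \<open>D'\<close> have modulus at least \<open>\<delta> > 0\<close>. Since \<open>M\<close> is compact and \<open>C(f, \<partial>D)\<close> lies in \<open>\<partial>D'\<close>,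
  \<open>f\<close> is a proper map of \<open>D\<close> onto \<open>D'\<close>; hence the preimage of \<open>E\<close> lies in a continuum in \<open>D\<close> at a
  positive distance from \<open>b\<close>, and whole paths can be lifted. The modulus is therefore bounded by the
  ring inequality, and for \<open>Q\<close> of finite mean oscillation its right-hand side tends to 0, since the
  means of \<open>Q\<close> over the balls of radius \<open>2 ^ -k\<close> grow at most linearly in \<open>k\<close>.
\<close>

section \<open>Charts and the Riemannian distance\<close>

text \<open>The map need not be a local homeomorphism, so lifts are not unique and cannot be patched
  from local inverses; they come from compactness of the preimage of the path together with
  discreteness of the fibres. Accessibility concerns curves from \<open>E\<close> to f(C), while a
  starting point for a lift is at hand only over f(C). A curve is therefore reversed before it is
  lifted, and the arc length integral, which is defined through a choice of parameters, has to be
  shown invariant under reversal. Once this is done, the inequality of moduli is an inclusion of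
  admissible classes. Distance, length and volume are given by an infimum, a supremum and a definite
  description; coordinates make them tractable, since near a point the distance is comparable to the
  coordinate distance and balls of radius \<open>r\<close> have volume comparable to
  \<open>r ^ n\<close>. This bounds the volume ratio of consecutive dyadic balls, hence the
  increment of the means of \<open>Q\<close> by a constant. The resulting linear growth is just slow
  enough to be beaten by the divergence of the harmonic series when \<open>n\<close> is at least
  2.\<close>

lemma nn_FTC_bound:
  fixes f :: "real \<Rightarrow> 'v::euclidean_space"
  assumes "a \<le> b" and cf: "continuous_on {a..b} f" and F: "finite F"
    and der: "\<And>t. t \<in> {a<..<b} - F \<Longrightarrow> (f has_vector_derivative v t) (at t)"
    and cv: "continuous_on ({a<..<b} - F) v"
  shows "ennreal (norm (f b - f a)) \<le> (\<integral>\<^sup>+t\<in>{a..b}. ennreal (norm (v t)) \<partial>lborel)"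
proof -
  define O' where "O' = {a<..<b} - F"
  have oO: "open O'" unfolding O'_def using F by (simp add: open_Diff finite_imp_closed)
  \<comment> \<open>Nothing is assumed of \<open>v\<close> on \<open>F\<close> or outside the
    interval. Cut off to an open set on which it is continuous, it becomes Borel measurable.\<close>
  define g where "g = (\<lambda>t. indicator O' t *\<^sub>R v t)"
  have gm: "g \<in> borel_measurable lborel"
    unfolding g_def using borel_measurable_continuous_on_indicator[of O' v] oO cv O'_def by simp
  have 1: "(\<integral>\<^sup>+t. ennreal (norm (g t)) \<partial>lborel) \<le> (\<integral>\<^sup>+t\<in>{a..b}. ennreal (norm (v t)) \<partial>lborel)"
    unfolding g_def O'_def by (rule nn_integral_mono) (auto simp: indicator_def)
  show ?thesis
  \<comment> \<open>An infinite integral leaves nothing to prove; a finite one makes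
    \<open>g\<close> integrable, and the fundamental theorem tolerates the finite exceptional set
    because \<open>f\<close> is continuous.\<close>
  proof (cases "(\<integral>\<^sup>+t. ennreal (norm (g t)) \<partial>lborel) < \<infinity>")
    case False
    then have "(\<integral>\<^sup>+t. ennreal (norm (g t)) \<partial>lborel) = top" by (simp add: less_top[symmetric])
    then show ?thesis using 1 by (simp add: top_unique)
  next
    case True
    then have ig: "integrable lborel g" using gm by (intro integrableI_bounded) auto
    have h1: "(g has_integral integral\<^sup>L lborel g) UNIV"
      using has_integral_integral_lborel[OF ig] .
    have der2: "(f has_vector_derivative g t) (at t)" if "t \<in> {a<..<b} - F" for t
      using der[OF that] that by (simp add: g_def O'_def)
    have "(g has_integral (f b - f a)) {a..b}"
      by (rule fundamental_theorem_of_calculus_interior_strong[OF F \<open>a \<le> b\<close> _ cf]) (use der2 in auto)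
    then have "((\<lambda>t. if t \<in> {a..b} then g t else 0) has_integral (f b - f a)) UNIV"
      by (simp only: has_integral_restrict_UNIV)
    moreover have "(\<lambda>t. if t \<in> {a..b} then g t else 0) = g"
      by (auto simp: fun_eq_iff g_def O'_def indicator_def)
    ultimately have "integral\<^sup>L lborel g = f b - f a"
      using has_integral_unique[OF h1] by simp
    then show ?thesis using integral_norm_bound_ennreal[OF ig] 1 by (metis order.trans)
  qed
qed

text \<open>The integral is a supremum over simple functions below \<open>f\<close>, and each of
  these is moved by the invariance of Lebesgue measure under reflection. Arbitrary integrands matter
  here: the one in \<open>arc_integral_on\<close> contains a choice, and the speed is controlled
  only almost everywhere.\<close>

lemma nn_integral_reflect_le:
  fixes f :: "real \<Rightarrow> ennreal"
  shows "(\<integral>\<^sup>+x. f x \<partial>lborel) \<le> (\<integral>\<^sup>+x. f (c - x) \<partial>lborel)"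
proof -
  have d: "distr lborel borel (\<lambda>x::real. c - x) = lborel"
    using lborel_distr_uminus lborel_distr_plus[of c]
  proof -
    have "distr lborel borel (\<lambda>x::real. c - x) = distr (distr lborel borel uminus) borel ((+) c)"
      by (subst distr_distr) (auto simp: o_def)
    then show ?thesis using lborel_distr_uminus lborel_distr_plus[of c] by simp
  qed
  show ?thesis
    unfolding nn_integral_def[of _ f]
  proof (rule SUP_least, clarify)
    fix g assume g: "simple_function lborel g" "g \<le> f"
    have gm: "g \<in> borel_measurable borel" using borel_measurable_simple_function[OF g(1)] by simp
    have "integral\<^sup>S lborel g = (\<integral>\<^sup>+x. g x \<partial>lborel)" using nn_integral_eq_simple_integral[OF g(1)] by simp
    also have "\<dots> = (\<integral>\<^sup>+x. g x \<partial>distr lborel borel (\<lambda>x::real. c - x))" by (simp add: d)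
    also have "\<dots> = (\<integral>\<^sup>+x. g (c - x) \<partial>lborel)" by (subst nn_integral_distr) (use gm in auto)
    also have "\<dots> \<le> (\<integral>\<^sup>+x. f (c - x) \<partial>lborel)" by (rule nn_integral_mono) (use g(2) in \<open>auto simp: le_fun_def\<close>)
    finally show "integral\<^sup>S lborel g \<le> (\<integral>\<^sup>+x. f (c - x) \<partial>lborel)" .
  qed
qed

text \<open>No measurability of \<open>f\<close> is needed, since reflection is a bimeasurable bijection.\<close>

lemma nn_integral_reflect:
  fixes f :: "real \<Rightarrow> ennreal"
  shows "(\<integral>\<^sup>+x. f (c - x) \<partial>lborel) = (\<integral>\<^sup>+x. f x \<partial>lborel)"
  using nn_integral_reflect_le[of f c] nn_integral_reflect_le[of "\<lambda>x. f (c - x)" c] by (simp add: antisym)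

locale riem_mfd =
  fixes M :: "('a::{t2_space, second_countable_topology}, 'n::finite) riem"
  assumes mfd: "riemannian_manifold M"
begin

lemma atlas_cover: obtains c where "c \<in> atlas M" "p \<in> fst c"
  using mfd unfolding riemannian_manifold_def by blast

lemma chartD:
  assumes "c \<in> atlas M"
  shows chart_open: "open (fst c)" and chart_image_open: "open (snd c ` fst c)"
    and chart_cont: "continuous_on (fst c) (snd c)"
    and chart_inv_cont: "continuous_on (snd c ` fst c) (inv_into (fst c) (snd c))"
    and chart_inv: "\<And>p. p \<in> fst c \<Longrightarrow> inv_into (fst c) (snd c) (snd c p) = p"
    and chart_inj: "inj_on (snd c) (fst c)"
proof -
  have "is_chart c" using mfd assms unfolding riemannian_manifold_def by blast
  then show "open (fst c)" "open (snd c ` fst c)" "continuous_on (fst c) (snd c)"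
    "continuous_on (snd c ` fst c) (inv_into (fst c) (snd c))"
    "\<And>p. p \<in> fst c \<Longrightarrow> inv_into (fst c) (snd c) (snd c p) = p"
    by (auto simp: is_chart_def homeomorphism_def)
  then show "inj_on (snd c) (fst c)" by (metis inj_on_inverseI)
qed

lemma chart_inv_into: "x \<in> snd c ` fst c \<Longrightarrow> inv_into (fst c) (snd c) x \<in> fst c"
  and chart_inv_right: "x \<in> snd c ` fst c \<Longrightarrow> snd c (inv_into (fst c) (snd c) x) = x"
  by (simp_all add: inv_into_into f_inv_into_f)

lemma chart_image_open_sub:
  assumes c: "c \<in> atlas M" and W: "open W" "W \<subseteq> fst c"
  shows "open (snd c ` W)"
proof -
  have "snd c ` W = (inv_into (fst c) (snd c)) -` W \<inter> snd c ` fst c"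
    using W chart_inv[OF c] by (force simp: image_iff)
  then show ?thesis
    using continuous_open_preimage[OF chart_inv_cont[OF c] chart_image_open[OF c] W(1)] by (simp add: Int_commute)
qed

lemma chart_preimage_open:
  assumes c: "c \<in> atlas M" and W: "open W"
  shows "open {p \<in> fst c. snd c p \<in> W}"
proof -
  have "{p \<in> fst c. snd c p \<in> W} = fst c \<inter> snd c -` W" by auto
  then show ?thesis
    using continuous_open_preimage[OF chart_cont[OF c] chart_open[OF c] W] by simp
qed

lemma chart_preimage_compact:
  assumes c: "c \<in> atlas M" and K: "compact K" "K \<subseteq> snd c ` fst c"
  shows "compact {p \<in> fst c. snd c p \<in> K}"
proof -
  have "{p \<in> fst c. snd c p \<in> K} = inv_into (fst c) (snd c) ` K"
    using K(2) chart_inv[OF c] chart_inv_into[of _ c] chart_inv_right[of _ c] by (force simp: image_iff)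
  then show ?thesis
    using compact_continuous_image[OF continuous_on_subset[OF chart_inv_cont[OF c] K(2)] K(1)] by simp
qed

lemma transition_smooth:
  assumes "c \<in> atlas M" "c' \<in> atlas M"
  shows "smooth_on (snd c ` (fst c \<inter> fst c')) (transition c c')"
  using mfd assms unfolding riemannian_manifold_def compatible_charts_def by blast

lemma transition_diff:
  assumes "c \<in> atlas M" "c' \<in> atlas M" "x \<in> snd c ` (fst c \<inter> fst c')"
  shows "(transition c c' has_derivative (\<lambda>h. jacobian (transition c c') (at x) *v h)) (at x)"
proof -
  have "Ck_on (Suc 0) (transition c c') (snd c ` (fst c \<inter> fst c'))"
    using transition_smooth[OF assms(1,2)] unfolding smooth_on_def by blast
  then have "transition c c' differentiable (at x)" using assms(3) unfolding Ck_on.simps by blast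
  then show ?thesis by (simp add: jacobian_works)
qed

text \<open>Smoothness in the sense of \<open>Ck_on\<close> speaks of partial derivatives only, so
  the jacobian applied to \<open>h\<close> is expanded in them.\<close>

lemma transition_jac_cont:
  assumes "c \<in> atlas M" "c' \<in> atlas M"
  shows "continuous_on (snd c ` (fst c \<inter> fst c')) (\<lambda>x. jacobian (transition c c') (at x) *v h)"
proof -
  let ?S = "snd c ` (fst c \<inter> fst c')"
  have 1: "Ck_on (Suc 0) (transition c c') ?S"
    using transition_smooth[OF assms(1,2)] unfolding smooth_on_def by blast
  have 2: "jacobian (transition c c') (at x) *v h
      = (\<Sum>i\<in>UNIV. h $ i *\<^sub>R partial_deriv i (transition c c') x)" if "x \<in> ?S" for x
  proof -
    have d: "transition c c' differentiable (at x)" using 1 that unfolding Ck_on.simps by blast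
    have lin: "linear (frechet_derivative (transition c c') (at x))" using linear_frechet_derivative[OF d] .
    have "jacobian (transition c c') (at x) *v h = frechet_derivative (transition c c') (at x) h"
      using lin unfolding jacobian_def by (simp add: matrix_works)
    also have "\<dots> = frechet_derivative (transition c c') (at x) (\<Sum>i\<in>UNIV. h $ i *\<^sub>R axis i 1)"
      using basis_expansion[of h] by (simp add: scalar_mult_eq_scaleR)
    also have "\<dots> = (\<Sum>i\<in>UNIV. h $ i *\<^sub>R frechet_derivative (transition c c') (at x) (axis i 1))"
      using lin by (simp add: linear_sum linear_scale)
    finally show ?thesis by (simp add: partial_deriv_def)
  qed
  have "continuous_on ?S (\<lambda>x. \<Sum>i\<in>UNIV. h $ i *\<^sub>R partial_deriv i (transition c c') x)"
    using 1 by (intro continuous_intros) auto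
  then show ?thesis using 2 by (simp cong: continuous_on_cong)
qed

lemma gmat_change:
  assumes "c \<in> atlas M" "c' \<in> atlas M" "p \<in> fst c \<inter> fst c'"
  shows "gmat M c p = transpose (jacobian (transition c c') (at (snd c p))) ** gmat M c' p
     ** jacobian (transition c c') (at (snd c p))"
  using mfd assms unfolding riemannian_manifold_def Let_def by blast

lemma gform_change:
  assumes "c \<in> atlas M" "c' \<in> atlas M" "p \<in> fst c \<inter> fst c'"
  defines "J \<equiv> jacobian (transition c c') (at (snd c p))"
  shows "gform M c p u w = gform M c' p (J *v u) (J *v w)"
proof -
  have "gform M c p u w = u \<bullet> (transpose J *v (gmat M c' p *v (J *v w)))"
    unfolding gform_def gmat_change[OF assms(1-3)] J_def by (simp add: matrix_vector_mul_assoc matrix_mul_assoc)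
  also have "\<dots> = (J *v u) \<bullet> (gmat M c' p *v (J *v w))"
    by (metis dot_lmul_matrix inner_commute matrix_transpose_mul transpose_matrix_vector)
  finally show ?thesis by (simp add: gform_def)
qed

lemma gform_pos: "c \<in> atlas M \<Longrightarrow> p \<in> fst c \<Longrightarrow> u \<noteq> 0 \<Longrightarrow> gform M c p u u > 0"
  using mfd unfolding riemannian_manifold_def by blast

lemma gcoord_cont:
  assumes "c \<in> atlas M" shows "continuous_on (snd c ` fst c) (gcoord M c)"
proof -
  have "Ck_on 0 (gcoord M c) (snd c ` fst c)"
    using mfd assms unfolding riemannian_manifold_def smooth_on_def by blast
  then show ?thesis by simp
qed

lemma gcoord_chart: "c \<in> atlas M \<Longrightarrow> p \<in> fst c \<Longrightarrow> gcoord M c (snd c p) = gmat M c p"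
  by (simp add: gcoord_def chart_inv)

lemma gmat_cont: assumes "c \<in> atlas M" shows "continuous_on (fst c) (gmat M c)"
proof -
  have "continuous_on (fst c) (\<lambda>p. gcoord M c (snd c p))"
    using continuous_on_compose2[OF gcoord_cont[OF assms] chart_cont[OF assms]] by auto
  then show ?thesis using gcoord_chart[OF assms] by (simp cong: continuous_on_cong)
qed

lemma deriv_change:
  assumes c: "c \<in> atlas M" "c' \<in> atlas M" and p: "\<gamma> t \<in> fst c \<inter> fst c'"
    and cont: "continuous (at t within S) \<gamma>" and tS: "t \<in> S"
    and d: "((snd c \<circ> \<gamma>) has_vector_derivative w) (at t within S)"
  shows "((snd c' \<circ> \<gamma>) has_vector_derivative
     (jacobian (transition c c') (at (snd c (\<gamma> t))) *v w)) (at t within S)"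
proof -
  let ?J = "jacobian (transition c c') (at (snd c (\<gamma> t)))"
  have "(transition c c' has_derivative (\<lambda>h. ?J *v h)) (at ((snd c \<circ> \<gamma>) t) within (snd c \<circ> \<gamma>) ` S)"
    using transition_diff[OF c] p by (simp add: has_derivative_at_withinI)
  from vector_derivative_diff_chain_within[OF d this]
  have 1: "((transition c c' \<circ> (snd c \<circ> \<gamma>)) has_vector_derivative ?J *v w) (at t within S)" .
  have "eventually (\<lambda>s. \<gamma> s \<in> fst c) (at t within S)"
    using cont p chart_open[OF c(1)] unfolding continuous_within by (auto intro: topological_tendstoD)
  then have "eventually (\<lambda>s. (transition c c' \<circ> (snd c \<circ> \<gamma>)) s = (snd c' \<circ> \<gamma>) s) (at t within S)"
    by eventually_elim (simp add: transition_def chart_inv[OF c(1)])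
  then show ?thesis
    using has_derivative_transform_eventually[OF 1[unfolded has_vector_derivative_def]] tS p
    by (simp add: has_vector_derivative_def transition_def chart_inv[OF c(1)])
qed

lemma speed_eq:
  assumes c: "c \<in> atlas M" and p: "\<gamma> t \<in> fst c" and cont: "isCont \<gamma> t"
    and d: "((snd c \<circ> \<gamma>) has_vector_derivative w) (at t)"
  shows "speed M \<gamma> t = sqrt (gform M c (\<gamma> t) w w)"
proof -
  define c' where "c' = (SOME c. c \<in> atlas M \<and> \<gamma> t \<in> fst c)"
  have c': "c' \<in> atlas M" "\<gamma> t \<in> fst c'"
    using someI[of "\<lambda>c. c \<in> atlas M \<and> \<gamma> t \<in> fst c" c] c p unfolding c'_def by auto
  from deriv_change[OF c c'(1) _ _ _ d] p c' cont
  have "((snd c' \<circ> \<gamma>) has_vector_derivative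
     (jacobian (transition c c') (at (snd c (\<gamma> t))) *v w)) (at t)" by auto
  then have "vector_derivative (snd c' \<circ> \<gamma>) (at t) = jacobian (transition c c') (at (snd c (\<gamma> t))) *v w"
    by (rule vector_derivative_at)
  then show ?thesis
    unfolding speed_def Let_def c'_def[symmetric]
    using gform_change[OF c c'(1), of "\<gamma> t" w w] p c' by simp
qed

end

section \<open>Piecewise C1 curves and their reparametrization\<close>

text \<open>An inductive form of \<open>piecewise_C1_curve\<close> with free end points:
  concatenation and reparametrization become inductions over the last piece instead of computations
  with partitions.\<close>

inductive pwC1 :: "('a::topological_space, 'n::finite) riem \<Rightarrow> (real \<Rightarrow> 'a) \<Rightarrow> real \<Rightarrow> real \<Rightarrow> bool"
  for M \<gamma> where
  refl: "pwC1 M \<gamma> a a"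
| step: "pwC1 M \<gamma> a b \<Longrightarrow> b < c \<Longrightarrow> C1_curve M b c \<gamma> \<Longrightarrow> pwC1 M \<gamma> a c"

lemma pwC1_chain:
  assumes "\<And>i. i < k \<Longrightarrow> \<tau> i < \<tau> (Suc i) \<and> C1_curve M (\<tau> i) (\<tau> (Suc i)) \<gamma>"
  shows "pwC1 M \<gamma> (\<tau> 0) (\<tau> (k::nat))"
  using assms by (induction k) (auto intro: pwC1.intros)

lemma pwC1_chain_ex:
  "pwC1 M \<gamma> a b \<Longrightarrow> \<exists>k (\<tau> :: nat \<Rightarrow> real). \<tau> 0 = a \<and> \<tau> k = b \<and>
        (\<forall>i<k. \<tau> i < \<tau> (Suc i) \<and> C1_curve M (\<tau> i) (\<tau> (Suc i)) \<gamma>)"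
proof (induction rule: pwC1.induct)
  case (refl a)
  show ?case by (intro exI[of _ 0] exI[of _ "\<lambda>_. a"]) auto
next
  case (step a b c)
  then obtain k \<tau> where "\<tau> 0 = a" "\<tau> k = b"
        "\<forall>i<k. \<tau> i < \<tau> (Suc i) \<and> C1_curve M (\<tau> i) (\<tau> (Suc i)) \<gamma>" by blast
  with step show ?case
    by (intro exI[of _ "Suc k"] exI[of _ "\<lambda>i. if i \<le> k then \<tau> i else c"]) (auto simp: less_Suc_eq)
qed

lemma piecewise_C1_curve_iff: "piecewise_C1_curve M \<gamma> \<longleftrightarrow> pwC1 M \<gamma> 0 1"
proof
  assume "piecewise_C1_curve M \<gamma>"
  then obtain k \<tau> where "\<tau> 0 = 0" "\<tau> k = 1" "\<forall>i<k. \<tau> i < \<tau> (Suc i) \<and> C1_curve M (\<tau> i) (\<tau> (Suc i)) \<gamma>"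
    unfolding piecewise_C1_curve_def by auto
  then show "pwC1 M \<gamma> 0 1" using pwC1_chain[of k \<tau> M \<gamma>] by simp
next
  assume "pwC1 M \<gamma> 0 1"
  then show "piecewise_C1_curve M \<gamma>" unfolding piecewise_C1_curve_def by (rule pwC1_chain_ex)
qed

lemma pwC1_le: "pwC1 M \<gamma> a b \<Longrightarrow> a \<le> b"
  by (induction rule: pwC1.induct) auto

lemma pwC1_trans: "pwC1 M \<gamma> b c \<Longrightarrow> pwC1 M \<gamma> a b \<Longrightarrow> pwC1 M \<gamma> a c"
  by (induction rule: pwC1.induct) (auto intro: pwC1.intros)

lemma C1_curve_continuous:
  assumes "C1_curve M p q \<gamma>" shows "continuous_on {p..q} \<gamma>" "continuous_on {p<..<q} \<gamma>"
proof -
  show "continuous_on {p..q} \<gamma>" using assms by (simp add: C1_curve_def)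
  then show "continuous_on {p<..<q} \<gamma>" by (rule continuous_on_subset) auto
qed

lemma C1_curve_cong:
  assumes "C1_curve M a b \<gamma>" and e: "\<And>t. t \<in> {a..b} \<Longrightarrow> \<gamma> t = \<gamma>' t"
  shows "C1_curve M a b \<gamma>'"
  unfolding C1_curve_def
proof (intro conjI ballI)
  have "continuous_on {a..b} \<gamma>" using assms(1) by (simp add: C1_curve_def)
  then show "continuous_on {a..b} \<gamma>'" using e by (rule continuous_on_eq)
next
  fix c assume "c \<in> atlas M"
  then obtain w where w: "continuous_on {t\<in>{a..b}. \<gamma> t \<in> fst c} w"
    "\<forall>t\<in>{a..b}. \<gamma> t \<in> fst c \<longrightarrow> ((snd c \<circ> \<gamma>) has_vector_derivative w t) (at t within {a..b})"
    using assms(1) unfolding C1_curve_def by blast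
  have "{t\<in>{a..b}. \<gamma> t \<in> fst c} = {t\<in>{a..b}. \<gamma>' t \<in> fst c}" using e by auto
  moreover have "((snd c \<circ> \<gamma>') has_vector_derivative w t) (at t within {a..b})"
    if "t \<in> {a..b}" "\<gamma>' t \<in> fst c" for t
  proof (rule has_vector_derivative_transform[OF that(1)])
    show "((snd c \<circ> \<gamma>) has_vector_derivative w t) (at t within {a..b})" using w(2) that e by auto
  qed (simp add: e)
  ultimately show "\<exists>w. continuous_on {t\<in>{a..b}. \<gamma>' t \<in> fst c} w \<and>
        (\<forall>t\<in>{a..b}. \<gamma>' t \<in> fst c \<longrightarrow> ((snd c \<circ> \<gamma>') has_vector_derivative w t) (at t within {a..b}))"
    using w(1) by (intro exI[of _ w]) auto
qed

text \<open>The slope \<open>m\<close> may have either sign, so that scalings and reflections are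
  both instances.\<close>

lemma C1_curve_affine:
  assumes C: "C1_curve M a b \<gamma>" and g: "(\<lambda>t. m * t + d) ` {a'..b'} \<subseteq> {a..b}"
  shows "C1_curve M a' b' (\<lambda>t. \<gamma> (m * t + d))"
  unfolding C1_curve_def
proof (intro conjI ballI)
  have c: "continuous_on S (\<lambda>t. m * t + d)" for S by (intro continuous_intros)
  show "continuous_on {a'..b'} (\<lambda>t. \<gamma> (m * t + d))"
    using continuous_on_compose2[OF _ c g, of \<gamma>] C by (auto simp: C1_curve_def)
  fix ch assume "ch \<in> atlas M"
  then obtain w where w: "continuous_on {t\<in>{a..b}. \<gamma> t \<in> fst ch} w"
    "\<forall>t\<in>{a..b}. \<gamma> t \<in> fst ch \<longrightarrow> ((snd ch \<circ> \<gamma>) has_vector_derivative w t) (at t within {a..b})"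
    using C unfolding C1_curve_def by blast
  have "continuous_on {t\<in>{a'..b'}. \<gamma> (m*t+d) \<in> fst ch} (\<lambda>t. m *\<^sub>R w (m * t + d))"
    by (intro continuous_intros continuous_on_compose2[OF w(1) c]) (use g in \<open>auto simp: image_subset_iff\<close>)
  moreover have "((snd ch \<circ> (\<lambda>t. \<gamma> (m * t + d))) has_vector_derivative (m *\<^sub>R w (m * t + d))) (at t within {a'..b'})"
    if t: "t \<in> {a'..b'}" "\<gamma> (m*t+d) \<in> fst ch" for t
  proof -
    have 1: "((\<lambda>t. m * t + d) has_vector_derivative m) (at t within {a'..b'})"
      by (auto intro!: derivative_eq_intros)
    have 2: "((snd ch \<circ> \<gamma>) has_vector_derivative w (m*t+d)) (at (m*t+d) within (\<lambda>t. m * t + d) ` {a'..b'})"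
      by (rule has_vector_derivative_within_subset[OF _ g]) (use w(2) t g in \<open>auto simp: image_subset_iff\<close>)
    from vector_diff_chain_within[OF 1 2] show ?thesis by (simp add: o_def)
  qed
  ultimately show "\<exists>w. continuous_on {t\<in>{a'..b'}. \<gamma> (m*t+d) \<in> fst ch} w \<and>
        (\<forall>t\<in>{a'..b'}. \<gamma> (m*t+d) \<in> fst ch \<longrightarrow>
          ((snd ch \<circ> (\<lambda>t. \<gamma> (m * t + d))) has_vector_derivative w t) (at t within {a'..b'}))"
    by blast
qed

lemma pwC1_cong:
  "pwC1 M \<gamma> a b \<Longrightarrow> (\<And>t. t \<in> {a..b} \<Longrightarrow> \<gamma> t = \<gamma>' t) \<Longrightarrow> pwC1 M \<gamma>' a b"
proof (induction rule: pwC1.induct)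
  case (step a b c)
  have ab: "a \<le> b" using pwC1_le[OF step.hyps(1)] .
  have "pwC1 M \<gamma>' a b" using step.IH step.prems step.hyps(2) by auto
  moreover have "C1_curve M b c \<gamma>'" using C1_curve_cong[OF step.hyps(3)] step.prems ab by auto
  ultimately show ?case using step.hyps(2) pwC1.step by metis
qed (simp add: pwC1.refl)

lemma pwC1_affine:
  assumes "m > 0"
  shows "pwC1 M \<gamma> a b \<Longrightarrow> pwC1 M (\<lambda>t. \<gamma> (m * t + d)) ((a - d) / m) ((b - d) / m)"
proof (induction rule: pwC1.induct)
  case (step a b c)
  have "C1_curve M ((b - d) / m) ((c - d) / m) (\<lambda>t. \<gamma> (m * t + d))"
    by (rule C1_curve_affine[OF step.hyps(3)]) (use assms in \<open>auto simp: field_simps\<close>)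
  moreover have "(b - d) / m < (c - d) / m" using step.hyps(2) assms by (simp add: divide_strict_right_mono)
  ultimately show ?case using step.IH pwC1.step by metis
qed (rule pwC1.refl)

lemma pwC1_reflect:
  "pwC1 M \<gamma> a b \<Longrightarrow> pwC1 M (\<lambda>t. \<gamma> (d - t)) (d - b) (d - a)"
proof (induction rule: pwC1.induct)
  case (step a b c)
  have "C1_curve M (d - c) (d - b) (\<lambda>t. \<gamma> (- 1 * t + d))"
    by (rule C1_curve_affine[OF step.hyps(3)]) auto
  then have "C1_curve M (d - c) (d - b) (\<lambda>t. \<gamma> (d - t))" by (simp add: algebra_simps)
  moreover have "d - c < d - b" using step.hyps(2) by simp
  ultimately have "pwC1 M (\<lambda>t. \<gamma> (d - t)) (d - c) (d - b)" using pwC1.step pwC1.refl by metis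
  then show ?case using step.IH pwC1_trans by metis
qed (rule pwC1.refl)

lemma pwC1_cont: "pwC1 M \<gamma> a b \<Longrightarrow> continuous_on {a..b} \<gamma>"
proof (induction rule: pwC1.induct)
  case (step a b c)
  have "{a..c} = {a..b} \<union> {b..c}" using pwC1_le[OF step.hyps(1)] step.hyps(2) by auto
  then show ?case using step.IH step.hyps(3)
    by (auto intro!: continuous_on_closed_Un simp: C1_curve_def)
qed simp

text \<open>\<open>F\<close> consists of the break points. Being finite, it is a null set, so
  statements about C1 pieces turn into statements that hold almost everywhere on the whole
  curve.\<close>

lemma pwC1_regular:
  "pwC1 M \<gamma> a b \<Longrightarrow> \<exists>F. finite F \<and> (\<forall>t\<in>{a<..<b} - F. \<exists>p q. p < t \<and> t < q \<and> a \<le> p \<and> q \<le> b \<and> C1_curve M p q \<gamma>)"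
proof (induction rule: pwC1.induct)
  case (step a b c)
  then obtain F where F: "finite F" "\<forall>t\<in>{a<..<b} - F. \<exists>p q. p < t \<and> t < q \<and> a \<le> p \<and> q \<le> b \<and> C1_curve M p q \<gamma>"
    by blast
  have ab: "a \<le> b" using pwC1_le[OF step.hyps(1)] .
  show ?case
  proof (intro exI[of _ "insert b F"] conjI ballI)
    fix t assume t: "t \<in> {a<..<c} - insert b F"
    show "\<exists>p q. p < t \<and> t < q \<and> a \<le> p \<and> q \<le> c \<and> C1_curve M p q \<gamma>"
    proof (cases "t < b")
      case True
      then have "t \<in> {a<..<b} - F" using t by auto
      then obtain p q where "p < t \<and> t < q \<and> a \<le> p \<and> q \<le> b \<and> C1_curve M p q \<gamma>" using F(2) by blast
      then show ?thesis using step.hyps(2) by (intro exI[of _ p] exI[of _ q]) auto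
    next
      case False then show ?thesis using t step.hyps ab by (intro exI[of _ b] exI[of _ c]) auto
    qed
  qed (use F in auto)
qed auto

context riem_mfd
begin

text \<open>The velocity field in \<open>C1_curve\<close> is existentially quantified and one-sided
  at the ends. On the open interval it agrees with \<open>vector_derivative\<close>, a canonical
  choice that does not depend on the piece under consideration.\<close>

lemma C1_curve_deriv:
  assumes C: "C1_curve M p q \<gamma>" and c: "c \<in> atlas M"
  defines "S \<equiv> {s \<in> {p<..<q}. \<gamma> s \<in> fst c}" and "v \<equiv> (\<lambda>s. vector_derivative (snd c \<circ> \<gamma>) (at s))"
  shows C1_open: "open S" and C1_deriv: "\<And>t. t \<in> S \<Longrightarrow> ((snd c \<circ> \<gamma>) has_vector_derivative v t) (at t)"
    and C1_deriv_cont: "continuous_on S v"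
    and C1_speed: "\<And>t. t \<in> S \<Longrightarrow> speed M \<gamma> t = sqrt (gform M c (\<gamma> t) (v t) (v t))"
    and C1_speed_cont: "continuous_on S (speed M \<gamma>)"
proof -
  obtain w where w: "continuous_on {t\<in>{p..q}. \<gamma> t \<in> fst c} w"
    "\<forall>t\<in>{p..q}. \<gamma> t \<in> fst c \<longrightarrow> ((snd c \<circ> \<gamma>) has_vector_derivative w t) (at t within {p..q})"
    using C c unfolding C1_curve_def by blast
  have cont: "continuous_on {p<..<q} \<gamma>"
    using C1_curve_continuous[OF C] by simp
  have "S = {p<..<q} \<inter> \<gamma> -` fst c" by (auto simp: S_def)
  then show oS: "open S" using continuous_open_preimage[OF cont open_greaterThanLessThan chart_open[OF c]] by simp
  have wv: "((snd c \<circ> \<gamma>) has_vector_derivative w t) (at t)" if "t \<in> S" for t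
    using w(2) that at_within_Icc_at[of p t q] by (auto simp: S_def)
  then have vw: "v t = w t" if "t \<in> S" for t using that by (auto simp: v_def intro: vector_derivative_at)
  show d: "((snd c \<circ> \<gamma>) has_vector_derivative v t) (at t)" if "t \<in> S" for t
    using wv vw that by simp
  have "continuous_on S w" by (rule continuous_on_subset[OF w(1)]) (auto simp: S_def)
  then show cv: "continuous_on S v" using vw by (simp cong: continuous_on_cong)
  have cS: "continuous_on S \<gamma>" by (rule continuous_on_subset[OF cont]) (auto simp: S_def)
  show sp: "speed M \<gamma> t = sqrt (gform M c (\<gamma> t) (v t) (v t))" if "t \<in> S" for t
    using speed_eq[OF c _ _ d[OF that]] that cont by (auto simp: S_def continuous_on_eq_continuous_at)
  have "continuous_on S (\<lambda>t. gmat M c (\<gamma> t))"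
    by (rule continuous_on_compose2[OF gmat_cont[OF c] cS]) (auto simp: S_def)
  then have "continuous_on S (\<lambda>t. sqrt (gform M c (\<gamma> t) (v t) (v t)))"
    unfolding gform_def matrix_vector_mult_def using cv
    by (intro continuous_intros) 
  then show "continuous_on S (speed M \<gamma>)" using sp by (simp cong: continuous_on_cong)
qed

lemma C1_speed_isCont:
  assumes "C1_curve M p q \<gamma>" "p < t" "t < q"
  shows "isCont (speed M \<gamma>) t"
proof -
  obtain c where c: "c \<in> atlas M" "\<gamma> t \<in> fst c" using atlas_cover .
  have "t \<in> {s \<in> {p<..<q}. \<gamma> s \<in> fst c}" using c assms by auto
  then show ?thesis using C1_speed_cont[OF assms(1) c(1)] C1_open[OF assms(1) c(1)]
    using continuous_on_eq_continuous_at by blast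
qed

lemma C1_vderiv_ex:
  assumes "C1_curve M p q \<gamma>" "p < t" "t < q" "c \<in> atlas M" "\<gamma> t \<in> fst c"
  shows "((snd c \<circ> \<gamma>) has_vector_derivative vector_derivative (snd c \<circ> \<gamma>) (at t)) (at t)"
    "isCont (\<lambda>s. vector_derivative (snd c \<circ> \<gamma>) (at s)) t"
    "speed M \<gamma> t = sqrt (gform M c (\<gamma> t) (vector_derivative (snd c \<circ> \<gamma>) (at t)) (vector_derivative (snd c \<circ> \<gamma>) (at t)))"
proof -
  have t: "t \<in> {s \<in> {p<..<q}. \<gamma> s \<in> fst c}" using assms by auto
  show "((snd c \<circ> \<gamma>) has_vector_derivative vector_derivative (snd c \<circ> \<gamma>) (at t)) (at t)"
    "speed M \<gamma> t = sqrt (gform M c (\<gamma> t) (vector_derivative (snd c \<circ> \<gamma>) (at t)) (vector_derivative (snd c \<circ> \<gamma>) (at t)))"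
    using C1_deriv[OF assms(1,4) t] C1_speed[OF assms(1,4) t] .
  show "isCont (\<lambda>s. vector_derivative (snd c \<circ> \<gamma>) (at s)) t"
    using C1_deriv_cont[OF assms(1,4)] C1_open[OF assms(1,4)] t continuous_on_eq_continuous_at by blast
qed

section \<open>Additivity and invariance of length\<close>

definition len :: "(real \<Rightarrow> 'a) \<Rightarrow> real \<Rightarrow> real \<Rightarrow> ennreal" where
  "len \<gamma> a b = (\<integral>\<^sup>+t\<in>{a..b}. ennreal (speed M \<gamma> t) \<partial>lborel)"

lemma AE_not_finite: "finite F \<Longrightarrow> AE t in lborel. (t::real) \<notin> F"
  by (intro AE_not_in finite_imp_null_set_lborel)

text \<open>At break points and end points \<open>speed\<close> is an uncontrolled value. Additivity
  of integrals needs measurability, hence the replacement by a Borel function that agrees with it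
  off a finite set.\<close>

lemma speed_meas:
  assumes "pwC1 M \<gamma> a b"
  obtains g :: "real \<Rightarrow> ennreal" where "g \<in> borel_measurable borel"
    "AE t in lborel. t \<in> {a..b} \<longrightarrow> ennreal (speed M \<gamma> t) = g t"
proof -
  obtain F where F: "finite F" "\<forall>t\<in>{a<..<b} - F. \<exists>p q. p < t \<and> t < q \<and> a \<le> p \<and> q \<le> b \<and> C1_curve M p q \<gamma>"
    using pwC1_regular[OF assms] by blast
  let ?O = "{a<..<b} - F"
  have o: "open ?O" using F(1) by (simp add: open_Diff finite_imp_closed)
  have "continuous_on ?O (speed M \<gamma>)"
    unfolding continuous_on_eq_continuous_at[OF o] using F(2) C1_speed_isCont by blast
  then have m: "(\<lambda>t. indicator ?O t *\<^sub>R speed M \<gamma> t) \<in> borel_measurable borel"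
    using o by (intro borel_measurable_continuous_on_indicator) auto
  have "AE t in lborel. t \<notin> F \<union> {a, b}" using F(1) by (intro AE_not_finite) auto
  then have "AE t in lborel. t \<in> {a..b} \<longrightarrow> ennreal (speed M \<gamma> t) = ennreal (indicator ?O t *\<^sub>R speed M \<gamma> t)"
    by eventually_elim (auto simp: indicator_def)
  then show ?thesis using that[of "\<lambda>t. ennreal (indicator ?O t *\<^sub>R speed M \<gamma> t)"] m by auto
qed

lemma len_add:
  assumes "pwC1 M \<gamma> a b" "pwC1 M \<gamma> b c"
  shows "len \<gamma> a c = len \<gamma> a b + len \<gamma> b c"
proof -
  have le: "a \<le> b" "b \<le> c" using assms pwC1_le by auto
  obtain g where g[measurable]: "g \<in> borel_measurable borel" "AE t in lborel. t \<in> {a..c} \<longrightarrow> ennreal (speed M \<gamma> t) = g t"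
    using speed_meas[OF pwC1_trans[OF assms(2,1)]] .
  have *: "len \<gamma> s t = (\<integral>\<^sup>+u\<in>{s..t}. g u \<partial>lborel)" if "{s..t} \<subseteq> {a..c}" for s t
    unfolding len_def by (rule nn_integral_cong_AE, use g(2) in eventually_elim)
      (use that in \<open>auto simp: indicator_def\<close>)
  have "len \<gamma> a c = (\<integral>\<^sup>+u. (g u * indicator {a..b} u + g u * indicator {b..c} u) \<partial>lborel)"
    unfolding *[OF order_refl]
    by (rule nn_integral_cong_AE, use AE_lborel_singleton[of b] in eventually_elim)
      (use le in \<open>auto simp: indicator_def\<close>)
  also have "\<dots> = len \<gamma> a b + len \<gamma> b c"
    by (subst nn_integral_add) (use le in \<open>auto simp: *\<close>)
  finally show ?thesis .
qed

lemma speed_cong: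
  assumes "eventually (\<lambda>s. \<gamma> s = \<gamma>' s) (nhds t)"
  shows "speed M \<gamma> t = speed M \<gamma>' t"
proof -
  have "\<gamma> t = \<gamma>' t" using eventually_nhds_x_imp_x[OF assms] .
  moreover have "vector_derivative (snd c \<circ> \<gamma>) (at t) = vector_derivative (snd c \<circ> \<gamma>') (at t)" for c :: "('a,'n) chart"
    by (rule vector_derivative_cong_eq) (use assms in \<open>auto elim: eventually_mono\<close>)
  ultimately show ?thesis unfolding speed_def by simp
qed

lemma len_cong:
  assumes "\<And>t. t \<in> {a<..<b} \<Longrightarrow> \<gamma> t = \<gamma>' t"
  shows "len \<gamma> a b = len \<gamma>' a b"
proof -
  have s: "speed M \<gamma> t = speed M \<gamma>' t" if "t \<in> {a<..<b}" for t
    by (rule speed_cong) (use that assms eventually_nhds_in_open[of "{a<..<b}" t] in \<open>auto elim: eventually_mono\<close>)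
  have "AE t in lborel. t \<notin> {a, b}" by (intro AE_not_finite) auto
  then show ?thesis unfolding len_def
    by (intro nn_integral_cong_AE, eventually_elim) (auto simp: indicator_def s)
qed

lemma speed_affine:
  assumes "C1_curve M p q \<gamma>" "p < m * t + d" "m * t + d < q"
  shows "speed M (\<lambda>t. \<gamma> (m * t + d)) t = \<bar>m\<bar> * speed M \<gamma> (m * t + d)"
proof -
  define s where "s = m * t + d"
  have c0: "continuous_on {p<..<q} \<gamma>"
    using C1_curve_continuous[OF assms(1)] by simp
  then have ic: "isCont \<gamma> s" using assms by (simp add: s_def continuous_on_eq_continuous_at)
  obtain c where c: "c \<in> atlas M" "\<gamma> s \<in> fst c" using atlas_cover .
  let ?v = "vector_derivative (snd c \<circ> \<gamma>) (at s)"
  have d: "((snd c \<circ> \<gamma>) has_vector_derivative ?v) (at s)"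
    and sp: "speed M \<gamma> s = sqrt (gform M c (\<gamma> s) ?v ?v)"
    using C1_vderiv_ex[OF assms(1) _ _ c] assms(2,3) by (auto simp: s_def)
  have 1: "((\<lambda>t. m * t + d) has_vector_derivative m) (at t)" by (auto intro!: derivative_eq_intros)
  have "((snd c \<circ> \<gamma> \<circ> (\<lambda>t. m * t + d)) has_vector_derivative m *\<^sub>R ?v) (at t)"
    using vector_diff_chain_at[OF 1, of "snd c \<circ> \<gamma>"] d by (simp add: s_def)
  then have 2: "((snd c \<circ> (\<lambda>t. \<gamma> (m * t + d))) has_vector_derivative m *\<^sub>R ?v) (at t)" by (simp add: o_def)
  have ic2: "isCont (\<lambda>t. \<gamma> (m * t + d)) t"
    using isCont_o2[of t "\<lambda>t. m * t + d" \<gamma>] ic by (auto simp: s_def)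
  have "speed M (\<lambda>t. \<gamma> (m * t + d)) t = sqrt (gform M c (\<gamma> s) (m *\<^sub>R ?v) (m *\<^sub>R ?v))"
    using speed_eq[OF c(1) _ ic2 2] c(2) by (simp add: s_def)
  also have "gform M c (\<gamma> s) (m *\<^sub>R ?v) (m *\<^sub>R ?v) = m\<^sup>2 * gform M c (\<gamma> s) ?v ?v"
    unfolding gform_def by (simp add: matrix_vector_mult_scaleR power2_eq_square)
  finally show ?thesis using sp by (simp add: real_sqrt_mult s_def)
qed

lemma len_affine:
  assumes P: "pwC1 M \<gamma> a b" and m: "m > 0"
  shows "len (\<lambda>t. \<gamma> (m * t + d)) ((a - d) / m) ((b - d) / m) = len \<gamma> a b"
proof -
  obtain F where F: "finite F" "\<forall>t\<in>{a<..<b} - F. \<exists>p q. p < t \<and> t < q \<and> a \<le> p \<and> q \<le> b \<and> C1_curve M p q \<gamma>"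
    using pwC1_regular[OF P] by blast
  obtain g where g[measurable]: "g \<in> borel_measurable borel" and g2: "AE t in lborel. t \<in> {a..b} \<longrightarrow> ennreal (speed M \<gamma> t) = g t"
    using speed_meas[OF P] .
  \<comment> \<open>The set where \<open>g\<close> fails to represent the speed is null, and it has
    to be null again after pulling back along the affine map. The affine substitution applied to the
    indicator of \<open>N\<close> shows this.\<close>
  from AE_E[OF g2] obtain N where N0:
    "{t \<in> space lborel. \<not> (t \<in> {a..b} \<longrightarrow> ennreal (speed M \<gamma> t) = g t)} \<subseteq> N"
    "emeasure lborel N = 0" "N \<in> sets lborel" .
  then have N: "{t. \<not> (t \<in> {a..b} \<longrightarrow> ennreal (speed M \<gamma> t) = g t)} \<subseteq> N" "N \<in> null_sets lborel"
    by (simp_all add: null_sets_def)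
  have [measurable]: "N \<in> sets borel" using N(2) by auto
  have "(\<integral>\<^sup>+x. indicator N x \<partial>lborel) = 0" using N(2) by (simp add: null_sets_def)
  then have "ennreal \<bar>m\<bar> * (\<integral>\<^sup>+x. indicator N (d + m * x) \<partial>lborel) = 0"
    using nn_integral_real_affine[of "indicator N" m d] m by simp
  then have "(\<integral>\<^sup>+x. indicator N (d + m * x) \<partial>lborel) = 0" using m by simp
  then have "AE x in lborel. indicator N (d + m * x) = (0::ennreal)"
    by (subst (asm) nn_integral_0_iff_AE) auto
  then have nN: "AE x in lborel. m * x + d \<notin> N"
    by eventually_elim (auto simp: indicator_def add.commute split: if_splits)
  have "finite ((\<lambda>s. (s - d) / m) ` (F \<union> {a, b}))" using F by auto
  note AE_not_finite[OF this]
  then have "AE t in lborel. ennreal (speed M (\<lambda>t. \<gamma> (m * t + d)) t) * indicator {(a - d) / m..(b - d) / m} t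
      = ennreal m * (g (d + m * t) * indicator {a..b} (d + m * t))"
    using nN
  proof eventually_elim
    case (elim t)
    have t: "t = ((m * t + d) - d) / m" using m by simp
    have nF: "m * t + d \<notin> F \<union> {a, b}" using elim(1) t by (metis image_eqI)
    have tI: "t \<in> {(a - d) / m..(b - d) / m} \<longleftrightarrow> m * t + d \<in> {a..b}" using m by (auto simp: field_simps)
    show ?case
    proof (cases "m * t + d \<in> {a..b}")
      case True
      then obtain p q where "p < m * t + d" "m * t + d < q" "C1_curve M p q \<gamma>" using F(2) nF by fastforce
      from speed_affine[OF this(3,1,2)]
      have "ennreal (speed M (\<lambda>t. \<gamma> (m * t + d)) t) = ennreal m * ennreal (speed M \<gamma> (m * t + d))"
        using m by (simp add: ennreal_mult')
      moreover have "ennreal (speed M \<gamma> (m * t + d)) = g (m * t + d)" using True elim(2) N(1) by auto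
      ultimately show ?thesis using True tI by (simp add: add.commute del: atLeastAtMost_iff)
    next
      case False
      then show ?thesis using tI by (simp add: add.commute del: atLeastAtMost_iff)
    qed
  qed
  then have "len (\<lambda>t. \<gamma> (m * t + d)) ((a - d) / m) ((b - d) / m)
     = (\<integral>\<^sup>+t. ennreal m * (g (d + m * t) * indicator {a..b} (d + m * t)) \<partial>lborel)"
    unfolding len_def by (rule nn_integral_cong_AE)
  also have "\<dots> = ennreal m * (\<integral>\<^sup>+t. (g (d + m * t) * indicator {a..b} (d + m * t)) \<partial>lborel)"
    by (rule nn_integral_cmult) auto
  also have "\<dots> = (\<integral>\<^sup>+t. g t * indicator {a..b} t \<partial>lborel)"
    using nn_integral_real_affine[of "\<lambda>t. g t * indicator {a..b} t" m d] m by simp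
  also have "\<dots> = len \<gamma> a b" unfolding len_def
    by (rule nn_integral_cong_AE, use g2 in eventually_elim) (auto simp: indicator_def)
  finally show ?thesis .
qed

lemma len_reflect:
  assumes P: "pwC1 M \<gamma> a b"
  shows "len (\<lambda>t. \<gamma> (d - t)) (d - b) (d - a) = len \<gamma> a b"
proof -
  obtain F where F: "finite F" "\<forall>t\<in>{a<..<b} - F. \<exists>p q. p < t \<and> t < q \<and> a \<le> p \<and> q \<le> b \<and> C1_curve M p q \<gamma>"
    using pwC1_regular[OF P] by blast
  have "finite ((\<lambda>s. d - s) ` (F \<union> {a, b}))" using F by auto
  note AE_not_finite[OF this]
  then have "AE t in lborel. ennreal (speed M (\<lambda>t. \<gamma> (d - t)) t) * indicator {d - b..d - a} t
      = ennreal (speed M \<gamma> (d - t)) * indicator {a..b} (d - t)"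
  proof eventually_elim
    case (elim t)
    have nF: "d - t \<notin> F \<union> {a, b}" using elim by (auto simp: image_iff algebra_simps)
    show ?case
    proof (cases "d - t \<in> {a..b}")
      case True
      then obtain p q where "p < d - t" "d - t < q" "C1_curve M p q \<gamma>" using F(2) nF by fastforce
      then have "speed M (\<lambda>t. \<gamma> (d - t)) t = speed M \<gamma> (d - t)"
        using speed_affine[of p q \<gamma> "-1" t d] by (simp add: algebra_simps)
      then show ?thesis using True by (auto simp: indicator_def)
    qed (auto simp: indicator_def)
  qed
  then have "len (\<lambda>t. \<gamma> (d - t)) (d - b) (d - a) = (\<integral>\<^sup>+t. ennreal (speed M \<gamma> (d - t)) * indicator {a..b} (d - t) \<partial>lborel)"
    unfolding len_def by (rule nn_integral_cong_AE)
  also have "\<dots> = len \<gamma> a b" unfolding len_def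
    using nn_integral_reflect[of "\<lambda>t. ennreal (speed M \<gamma> t) * indicator {a..b} t" d] .
  finally show ?thesis .
qed

section \<open>Symmetry and triangle inequality of the geodesic distance\<close>

lemma gdist_alt: "gdist M x y = (INF \<gamma>\<in>{\<gamma>. pwC1 M \<gamma> 0 1 \<and> \<gamma> 0 = x \<and> \<gamma> 1 = y}. len \<gamma> 0 1)"
  unfolding gdist_def piecewise_C1_curve_iff riem_length_def len_def ..

lemma gdist_le: "pwC1 M \<gamma> 0 1 \<Longrightarrow> gdist M (\<gamma> 0) (\<gamma> 1) \<le> len \<gamma> 0 1"
  unfolding gdist_alt by (rule INF_lower) auto

lemma gdist_sym_le: "gdist M x y \<le> gdist M y x"
  unfolding gdist_alt[of y x]
proof (rule INF_greatest, clarify)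
  fix \<gamma> assume g: "pwC1 M \<gamma> 0 1"
  have "pwC1 M (\<lambda>t. \<gamma> (1 - t)) 0 1" using pwC1_reflect[OF g, of 1] by simp
  from gdist_le[OF this] show "gdist M (\<gamma> 1) (\<gamma> 0) \<le> len \<gamma> 0 1"
    using len_reflect[OF g, of 1] by simp
qed

lemma gdist_sym: "gdist M x y = gdist M y x"
  by (simp add: antisym gdist_sym_le)

lemma gdist_concat:
  assumes g1: "pwC1 M \<gamma>1 0 1" and g2: "pwC1 M \<gamma>2 0 1" and e: "\<gamma>1 1 = \<gamma>2 0"
  shows "gdist M (\<gamma>1 0) (\<gamma>2 1) \<le> len \<gamma>1 0 1 + len \<gamma>2 0 1"
proof -
  \<comment> \<open>Both curves are run at double speed, so that the concatenation is again
    parametrized by the unit interval, as \<open>gdist\<close> demands.\<close>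
  define \<gamma> where "\<gamma> = (\<lambda>t. if t \<le> 1/2 then \<gamma>1 (2 * t + 0) else \<gamma>2 (2 * t + -1))"
  have e1: "\<gamma>1 (2 * t + 0) = \<gamma> t" if "t \<in> {0..1/2}" for t
    using that by (simp add: \<gamma>_def)
  have e2: "\<gamma>2 (2 * t + -1) = \<gamma> t" if "t \<in> {1/2..1}" for t
  proof (cases "t = 1/2")
    case True
    have g: "\<gamma> t = \<gamma>1 (2 * t + 0)" using that True by (simp add: \<gamma>_def)
    have h: "2 * t + 0 = 1" "2 * t + -1 = 0" using True by simp_all
    show ?thesis unfolding g h using e by simp
  next
    case False
    then have "\<not> t \<le> 1/2" using that by auto
    then show ?thesis by (simp add: \<gamma>_def)
  qed
  have a1: "pwC1 M (\<lambda>t. \<gamma>1 (2 * t + 0)) 0 (1/2)" using pwC1_affine[OF _ g1, of 2 0] by simp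
  have a2: "pwC1 M (\<lambda>t. \<gamma>2 (2 * t + -1)) (1/2) 1" using pwC1_affine[OF _ g2, of 2 "-1"] by simp
  have p: "pwC1 M \<gamma> 0 (1/2)" "pwC1 M \<gamma> (1/2) 1"
    using pwC1_cong[OF a1 e1] pwC1_cong[OF a2 e2] by auto
  have "len \<gamma> 0 1 = len \<gamma> 0 (1/2) + len \<gamma> (1/2) 1" by (rule len_add[OF p])
  also have "len \<gamma> 0 (1/2) = len (\<lambda>t. \<gamma>1 (2 * t + 0)) 0 (1/2)" by (rule len_cong) (auto simp: \<gamma>_def)
  also have "\<dots> = len \<gamma>1 0 1" using len_affine[OF g1, of 2 0] by simp
  also have "len \<gamma> (1/2) 1 = len (\<lambda>t. \<gamma>2 (2 * t + -1)) (1/2) 1" by (rule len_cong) (auto simp: \<gamma>_def)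
  also have "\<dots> = len \<gamma>2 0 1" using len_affine[OF g2, of 2 "-1"] by simp
  finally show ?thesis using gdist_le[OF pwC1_trans[OF p(2,1)]] by (simp add: \<gamma>_def)
qed

lemma gdist_triangle: "gdist M x z \<le> gdist M x y + gdist M y z"
proof (rule ennreal_le_epsilon)
  fix e :: real assume fin: "gdist M x y + gdist M y z < top" and e: "0 < e"
  have *: "\<exists>\<gamma>. pwC1 M \<gamma> 0 1 \<and> \<gamma> 0 = x \<and> \<gamma> 1 = y \<and> len \<gamma> 0 1 \<le> gdist M x y + ennreal (e/2)"
    if "gdist M x y < top" for x y
  proof -
    have "gdist M x y < gdist M x y + ennreal (e/2)" using that e ennreal_add_left_cancel_less[of "gdist M x y" 0 "ennreal (e/2)"] by simp
    then have "(INF \<gamma>\<in>{\<gamma>. pwC1 M \<gamma> 0 1 \<and> \<gamma> 0 = x \<and> \<gamma> 1 = y}. len \<gamma> 0 1) < gdist M x y + ennreal (e/2)"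
      by (simp add: gdist_alt)
    then show ?thesis by (subst (asm) INF_less_iff) (auto intro: less_imp_le)
  qed
  obtain \<gamma>1 where 1: "pwC1 M \<gamma>1 0 1" "\<gamma>1 0 = x" "\<gamma>1 1 = y" "len \<gamma>1 0 1 \<le> gdist M x y + ennreal (e/2)"
    using *[of x y] fin by auto
  obtain \<gamma>2 where 2: "pwC1 M \<gamma>2 0 1" "\<gamma>2 0 = y" "\<gamma>2 1 = z" "len \<gamma>2 0 1 \<le> gdist M y z + ennreal (e/2)"
    using *[of y z] fin by auto
  have "gdist M x z \<le> len \<gamma>1 0 1 + len \<gamma>2 0 1" using gdist_concat[OF 1(1) 2(1)] 1 2 by simp
  also have "\<dots> \<le> (gdist M x y + ennreal (e/2)) + (gdist M y z + ennreal (e/2))" by (rule add_mono[OF 1(4) 2(4)])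
  also have "\<dots> = (gdist M x y + gdist M y z) + (ennreal (e/2) + ennreal (e/2))" by (simp add: ac_simps)
  also have "ennreal (e/2) + ennreal (e/2) = ennreal e" using e by (subst ennreal_plus[symmetric]) auto
  finally show "gdist M x z \<le> gdist M x y + gdist M y z + ennreal e" .
qed

lemma gdist_refl [simp]: "gdist M x x = 0"
proof -
  have C: "C1_curve M 0 1 (\<lambda>_. x)" unfolding C1_curve_def
    by (auto intro!: exI[of _ "\<lambda>_. 0"] simp: o_def)
  then have p: "pwC1 M (\<lambda>_. x) 0 1" using pwC1.step[OF pwC1.refl _ C] by simp
  obtain c where c: "c \<in> atlas M" "x \<in> fst c" using atlas_cover .
  have "speed M (\<lambda>_. x) t = sqrt (gform M c x 0 0)" for t
    by (rule speed_eq[OF c(1)]) (auto simp: c o_def)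
  then have "len (\<lambda>_. x) 0 1 = 0" by (simp add: len_def gform_def)
  then show ?thesis using gdist_le[OF p] by simp
qed


section \<open>Comparison of the geodesic distance with the distance in coordinates\<close>

lemma gform_scale: "gform M c p (a *\<^sub>R u) (a *\<^sub>R u) = a\<^sup>2 * gform M c p u u"
  unfolding gform_def by (simp add: matrix_vector_mult_scaleR power2_eq_square)

lemma chart_cball:
  assumes c: "c \<in> atlas M" and p: "p \<in> fst c"
  obtains R where "R > 0" "cball (snd c p) R \<subseteq> snd c ` fst c"
  using open_contains_cball_eq[OF chart_image_open[OF c]] p by (metis imageI)

text \<open>The form is homogeneous of degree two in \<open>u\<close>, so its extrema over the
  compact product of \<open>K\<close> and the unit sphere are the bounds; the minimum is attained
  and therefore positive.\<close>

lemma gform_bounds: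
  assumes c: "c \<in> atlas M" and K: "compact K" "K \<subseteq> snd c ` fst c" "K \<noteq> {}"
  obtains l L where "l > 0" "L > 0"
    "\<And>q u. q \<in> fst c \<Longrightarrow> snd c q \<in> K \<Longrightarrow> l * norm u \<le> sqrt (gform M c q u u)"
    "\<And>q u. q \<in> fst c \<Longrightarrow> snd c q \<in> K \<Longrightarrow> sqrt (gform M c q u u) \<le> L * norm u"
proof -
  let ?C = "K \<times> sphere (0 :: real^'n) 1"
  let ?h = "\<lambda>z. snd z \<bullet> (gcoord M c (fst z) *v snd z)"
  have cg: "continuous_on ?C (\<lambda>z. gcoord M c (fst z))"
    by (rule continuous_on_compose2[OF gcoord_cont[OF c] continuous_on_fst]) (use K in \<open>auto intro: continuous_on_id\<close>)
  have ch: "continuous_on ?C ?h"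
    unfolding matrix_vector_mult_def using cg by (intro continuous_intros)
  have cC: "compact ?C" using K by (intro compact_Times) auto
  have "axis undefined 1 \<in> sphere (0 :: real^'n) 1" by simp
  then have ne: "?C \<noteq> {}" using K by blast
  obtain z where z: "z \<in> ?C" "\<forall>y\<in>?C. ?h z \<le> ?h y" using continuous_attains_inf[OF cC ne ch] by blast
  obtain z' where z': "z' \<in> ?C" "\<forall>y\<in>?C. ?h y \<le> ?h z'" using continuous_attains_sup[OF cC ne ch] by blast
  have pos: "?h y > 0" if "y \<in> ?C" for y
  proof -
    have "fst y \<in> snd c ` fst c" using that K(2) by auto
    then obtain q where q: "q \<in> fst c" "fst y = snd c q" by auto
    have "gform M c q (snd y) (snd y) > 0" using gform_pos[OF c q(1), of "snd y"] that by (cases "snd y = 0") auto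
    then show ?thesis using q gcoord_chart[OF c q(1)] by (simp add: gform_def)
  qed
  have eq: "gform M c q u u = (norm u)\<^sup>2 * ?h (snd c q, u /\<^sub>R norm u)" if "q \<in> fst c" "u \<noteq> 0" for q u
    using that gform_scale[of c q "norm u" "u /\<^sub>R norm u"] by (simp add: gform_def gcoord_chart[OF c])
  have in_C: "(snd c q, u /\<^sub>R norm u) \<in> ?C" if "snd c q \<in> K" "u \<noteq> 0" for q u
    using that by simp
  show ?thesis
  proof (rule that[of "sqrt (?h z)" "sqrt (?h z')"])
    fix q and u :: "real^'n" assume q: "q \<in> fst c" "snd c q \<in> K"
    show "sqrt (?h z) * norm u \<le> sqrt (gform M c q u u)"
    proof (cases "u = 0")
      case False
      have "?h z \<le> ?h (snd c q, u /\<^sub>R norm u)" using z(2) in_C[OF q(2) False] by blast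
      then have "sqrt ((norm u)\<^sup>2 * ?h z) \<le> sqrt ((norm u)\<^sup>2 * ?h (snd c q, u /\<^sub>R norm u))"
        by (intro real_sqrt_le_mono mult_left_mono zero_le_power2)
      then show ?thesis using eq[OF q(1) False] by (simp add: real_sqrt_mult mult.commute)
    qed (simp add: gform_def)
    show "sqrt (gform M c q u u) \<le> sqrt (?h z') * norm u"
    proof (cases "u = 0")
      case False
      have "?h (snd c q, u /\<^sub>R norm u) \<le> ?h z'" using z'(2) in_C[OF q(2) False] by blast
      then have "sqrt ((norm u)\<^sup>2 * ?h (snd c q, u /\<^sub>R norm u)) \<le> sqrt ((norm u)\<^sup>2 * ?h z')"
        by (intro real_sqrt_le_mono mult_left_mono zero_le_power2)
      then show ?thesis using eq[OF q(1) False] by (simp add: real_sqrt_mult mult.commute)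
    qed (simp add: gform_def)
  qed (use pos[OF z(1)] pos[OF z'(1)] in auto)
qed

text \<open>As long as the curve stays in the coordinate ball, its length dominates \<open>l\<close>
  times the coordinate displacement. A curve that ends outside the ball of radius \<open>s\<close>
  first attains displacements arbitrarily close to \<open>s\<close>.\<close>

lemma len_lower:
  assumes c: "c \<in> atlas M" and p: "p \<in> fst c" and R: "cball (snd c p) R \<subseteq> snd c ` fst c"
    and l: "l > 0" "\<And>q u. q \<in> fst c \<Longrightarrow> snd c q \<in> cball (snd c p) R \<Longrightarrow> l * norm u \<le> sqrt (gform M c q u u)"
    and g: "pwC1 M \<gamma> 0 1" "\<gamma> 0 = p" and s: "0 < s" "s \<le> R"
    and out: "\<not> (\<gamma> 1 \<in> fst c \<and> snd c (\<gamma> 1) \<in> ball (snd c p) s)"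
  shows "ennreal (l * s) \<le> len \<gamma> 0 1"
proof -
  define B where "B = {q \<in> fst c. snd c q \<in> ball (snd c p) s}"
  define f where "f = snd c \<circ> \<gamma>"
  have oB: "open B" unfolding B_def by (rule chart_preimage_open[OF c open_ball])
  have cont: "continuous_on {0..1} \<gamma>" using pwC1_cont[OF g(1)] .
  define S where "S = {t\<in>{0..1}. \<gamma> t \<in> - B}"
  have "closed S" unfolding S_def
    using continuous_closed_preimage[OF cont closed_atLeastAtMost, of "- B"] oB by (simp add: vimage_def Int_def closed_Compl)
  have 1: "1 \<in> S" using out by (auto simp: S_def B_def)
  have bS: "bdd_below S" by (auto simp: S_def intro: bdd_belowI[of _ 0])
  \<comment> \<open>The first exit time. At \<open>T\<close> the curve may already have left the
    chart domain, so coordinates are used only at earlier parameters.\<close>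
  define T where "T = Inf S"
  have TS: "T \<in> S" unfolding T_def using closed_contains_Inf[OF _ bS \<open>closed S\<close>] 1 by auto
  have before: "\<gamma> t \<in> B" if "0 \<le> t" "t < T" for t
    using that cInf_lower[OF _ bS] TS by (force simp: S_def T_def not_le[symmetric])
  have T0: "T > 0" using TS g(2) p s by (cases "T = 0") (auto simp: S_def B_def)
  have T1: "T \<le> 1" using TS by (simp add: S_def)
  \<comment> \<open>If the displacement stayed at most \<open>s'\<close> before \<open>T\<close>,
    the curve would lie in the preimage of a closed coordinate ball. That set is compact, hence
    closed in the whole manifold, and so it would contain the exit point as well.\<close>
  have far: "\<exists>t. 0 \<le> t \<and> t < T \<and> norm (f t - snd c p) > s'" if s': "s' < s" for s'
  proof (rule ccontr)
    assume neg: "\<not> ?thesis"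
    let ?C = "{q \<in> fst c. snd c q \<in> cball (snd c p) s'}"
    have "cball (snd c p) s' \<subseteq> snd c ` fst c" using R s s' by (auto simp: subset_iff)
    then have "closed ?C" by (intro compact_imp_closed chart_preimage_compact[OF c] compact_cball)
    moreover have c2: "continuous_on {0..T} \<gamma>" using cont by (rule continuous_on_subset) (use T1 in auto)
    ultimately have "closed ({0..T} \<inter> \<gamma> -` ?C)" by (intro continuous_closed_preimage) auto
    moreover have "{0..<T} \<subseteq> {0..T} \<inter> \<gamma> -` ?C"
      using before neg by (auto simp: B_def f_def dist_norm norm_minus_commute not_less)
    ultimately have "closure {0..<T} \<subseteq> {0..T} \<inter> \<gamma> -` ?C" by (rule closure_minimal[rotated])
    moreover have "T \<in> closure {0..<T}" using T0 by simp
    ultimately have "\<gamma> T \<in> ?C" by blast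
    then have "\<gamma> T \<in> B" using s' by (auto simp: B_def)
    then show False using TS by (simp add: S_def)
  qed
  obtain F where F: "finite F" "\<forall>t\<in>{0<..<1} - F. \<exists>p q. p < t \<and> t < q \<and> 0 \<le> p \<and> q \<le> 1 \<and> C1_curve M p q \<gamma>"
    using pwC1_regular[OF g(1)] by blast
  let ?v = "\<lambda>t. vector_derivative f (at t)"
  have bound: "ennreal (l * norm (f t0 - snd c p)) \<le> len \<gamma> 0 1" if t0: "0 \<le> t0" "t0 < T" for t0
  proof -
    have inB: "\<gamma> t \<in> fst c" "snd c (\<gamma> t) \<in> cball (snd c p) R" if "t \<in> {0..t0}" for t
      using before[of t] that t0 s by (auto simp: B_def)
    have c0: "continuous_on {0..t0} \<gamma>" using cont by (rule continuous_on_subset) (use t0 T1 in auto)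
    have cf: "continuous_on {0..t0} (\<lambda>t. l *\<^sub>R f t)" unfolding f_def o_def
      by (intro continuous_intros continuous_on_compose2[OF chart_cont[OF c] c0]) (use inB in auto)
    have reg: "(f has_vector_derivative ?v t) (at t)" "isCont ?v t"
      "speed M \<gamma> t = sqrt (gform M c (\<gamma> t) (?v t) (?v t))" if "t \<in> {0<..<t0} - F" for t
    proof -
      have "t \<in> {0<..<1} - F" using that t0 T1 by auto
      then obtain a b where ab: "C1_curve M a b \<gamma>" "a < t" "t < b" using F(2) by blast
      have "\<gamma> t \<in> fst c" using inB(1)[of t] that by auto
      from C1_vderiv_ex[OF ab c this] show "(f has_vector_derivative ?v t) (at t)" "isCont ?v t"
        "speed M \<gamma> t = sqrt (gform M c (\<gamma> t) (?v t) (?v t))" unfolding f_def by auto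
    qed
    have "ennreal (norm (l *\<^sub>R f t0 - l *\<^sub>R f 0)) \<le> (\<integral>\<^sup>+t\<in>{0..t0}. ennreal (norm (l *\<^sub>R ?v t)) \<partial>lborel)"
    proof (rule nn_FTC_bound[OF t0(1) cf F(1)])
      show "((\<lambda>t. l *\<^sub>R f t) has_vector_derivative l *\<^sub>R ?v t) (at t)" if "t \<in> {0<..<t0} - F" for t
        using reg(1)[OF that] by (intro derivative_eq_intros) auto
      show "continuous_on ({0<..<t0} - F) (\<lambda>t. l *\<^sub>R ?v t)"
        by (intro continuous_intros continuous_at_imp_continuous_on ballI reg(2))
    qed
    also have "\<dots> \<le> len \<gamma> 0 1"
      unfolding len_def
    proof (rule nn_integral_mono_AE)
      have "AE t in lborel. t \<notin> F \<union> {0, t0}" using F(1) by (intro AE_not_finite) auto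
      then show "AE t in lborel. ennreal (norm (l *\<^sub>R ?v t)) * indicator {0..t0} t
          \<le> ennreal (speed M \<gamma> t) * indicator {0..1} t"
      proof eventually_elim
        case (elim t)
        show ?case
        proof (cases "t \<in> {0<..<t0}")
          case True
          then have t: "t \<in> {0<..<t0} - F" "t \<in> {0..t0}" using elim by auto
          have "l * norm (?v t) \<le> speed M \<gamma> t" using reg(3)[OF t(1)] l(2)[OF inB[OF t(2)]] by simp
          then show ?thesis using True t0 T1 l(1) by (auto simp: indicator_def intro: ennreal_leI)
        qed (use elim in \<open>auto simp: indicator_def\<close>)
      qed
    qed
    finally show ?thesis using l(1) g(2) by (simp add: f_def scaleR_diff_right[symmetric])
  qed
  show ?thesis
  proof (rule ccontr)
    assume "\<not> ?thesis"
    then have lt: "len \<gamma> 0 1 < ennreal (l * s)" by simp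
    then obtain x where x: "len \<gamma> 0 1 = ennreal x" "0 \<le> x" by (cases "len \<gamma> 0 1") auto
    then have "x < l * s" using lt by (simp add: ennreal_less_iff)
    then have "x / l < s" using l(1) by (simp add: field_simps)
    then obtain t where t: "0 \<le> t" "t < T" "norm (f t - snd c p) > x / l" using far by blast
    then have "x < l * norm (f t - snd c p)" using l(1) by (simp add: field_simps)
    then show False using bound[OF t(1,2)] x l(1) by (simp add: ennreal_le_iff2)
  qed
qed

lemma gdist_lower:
  assumes c: "c \<in> atlas M" and p: "p \<in> fst c" and R: "cball (snd c p) R \<subseteq> snd c ` fst c"
    and l: "l > 0" "\<And>q u. q \<in> fst c \<Longrightarrow> snd c q \<in> cball (snd c p) R \<Longrightarrow> l * norm u \<le> sqrt (gform M c q u u)"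
    and s: "0 < s" "s \<le> R" and out: "\<not> (q \<in> fst c \<and> snd c q \<in> ball (snd c p) s)"
  shows "ennreal (l * s) \<le> gdist M p q"
  unfolding gdist_alt using out by (intro INF_greatest) (auto intro!: len_lower[OF c p R l _ _ s])

text \<open>The segment in coordinates is a competitor in the infimum. Since \<open>C1_curve\<close>
  refers to every chart of the atlas, the velocity of the segment is carried to the other charts by
  the jacobian of the transition map.\<close>

lemma gdist_upper:
  assumes c: "c \<in> atlas M" and B: "convex B" "B \<subseteq> snd c ` fst c"
    and L: "\<And>q u. q \<in> fst c \<Longrightarrow> snd c q \<in> B \<Longrightarrow> sqrt (gform M c q u u) \<le> L * norm u"
    and q: "q \<in> fst c" "snd c q \<in> B" "q' \<in> fst c" "snd c q' \<in> B"
  shows "gdist M q q' \<le> ennreal (L * dist (snd c q) (snd c q'))"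
proof -
  let ?i = "inv_into (fst c) (snd c)"
  define y where "y = snd c q" define v where "v = snd c q' - snd c q"
  define x where "x = (\<lambda>t::real. y + t *\<^sub>R v)"
  define \<gamma> where "\<gamma> = (\<lambda>t. ?i (x t))"
  have xB: "x t \<in> B" if "t \<in> {0..1}" for t
  proof -
    have "x t = (1 - t) *\<^sub>R snd c q + t *\<^sub>R snd c q'" by (simp add: x_def y_def v_def algebra_simps)
    then show ?thesis using convexD[OF B(1) q(2,4), of "1 - t" t] that by simp
  qed
  have g_in: "\<gamma> t \<in> fst c" "snd c (\<gamma> t) = x t" if "t \<in> {0..1}" for t
    using xB[OF that] B(2) chart_inv_into[of "x t" c] chart_inv_right[of "x t" c] by (auto simp: \<gamma>_def)
  have cx: "continuous_on S x" for S unfolding x_def by (intro continuous_intros)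
  have contg: "continuous_on {0..1} \<gamma>" unfolding \<gamma>_def
    by (rule continuous_on_compose2[OF chart_inv_cont[OF c] cx]) (use xB B in auto)
  have dx: "(x has_vector_derivative v) (at t within S)" for t S
    unfolding x_def by (auto intro!: derivative_eq_intros)
  have dc: "((snd c \<circ> \<gamma>) has_vector_derivative v) (at t within {0..1})" if "t \<in> {0..1}" for t
    by (rule has_vector_derivative_transform[OF that _ dx]) (use g_in in auto)
  have "C1_curve M 0 1 \<gamma>"
    unfolding C1_curve_def
  proof (intro conjI ballI contg)
    fix c' assume c': "c' \<in> atlas M"
    let ?w = "\<lambda>t. jacobian (transition c c') (at (x t)) *v v"
    have sub: "x t \<in> snd c ` (fst c \<inter> fst c')" if "t \<in> {0..1}" "\<gamma> t \<in> fst c'" for t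
      using g_in[OF that(1)] that(2) by (metis IntI image_eqI)
    have "continuous_on {t \<in> {0..1}. \<gamma> t \<in> fst c'} ?w"
      by (rule continuous_on_compose2[OF transition_jac_cont[OF c c'] cx]) (use sub in auto)
    moreover have "((snd c' \<circ> \<gamma>) has_vector_derivative ?w t) (at t within {0..1})"
      if "t \<in> {0..1}" "\<gamma> t \<in> fst c'" for t
      using deriv_change[OF c c' _ _ that(1) dc[OF that(1)]] g_in[OF that(1)] that contg
      by (auto simp: continuous_on_eq_continuous_within)
    ultimately show "\<exists>w. continuous_on {t \<in> {0..1}. \<gamma> t \<in> fst c'} w \<and>
        (\<forall>t\<in>{0..1}. \<gamma> t \<in> fst c' \<longrightarrow> ((snd c' \<circ> \<gamma>) has_vector_derivative w t) (at t within {0..1}))"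
      by blast
  qed
  then have pw: "pwC1 M \<gamma> 0 1" by (intro pwC1.step[OF pwC1.refl]) simp_all
  have sp: "speed M \<gamma> t \<le> L * norm v" if "t \<in> {0<..<1}" for t
  proof -
    have t: "t \<in> {0..1}" using that by auto
    have "isCont \<gamma> t" using contg that by (metis continuous_on_interior interior_atLeastAtMost_real)
    moreover have "((snd c \<circ> \<gamma>) has_vector_derivative v) (at t)"
      using dc[OF t] at_within_Icc_at[of 0 t 1] that by auto
    ultimately have "speed M \<gamma> t = sqrt (gform M c (\<gamma> t) v v)" using speed_eq[OF c, of \<gamma> t v] g_in(1)[OF t] by blast
    then show ?thesis using L[OF g_in(1)[OF t]] g_in(2)[OF t] xB[OF t] by simp
  qed
  have "len \<gamma> 0 1 \<le> (\<integral>\<^sup>+t. ennreal (L * norm v) * indicator {0..1} t \<partial>(lborel :: real measure))"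
    unfolding len_def
  proof (rule nn_integral_mono_AE)
    have "AE t in lborel. (t::real) \<notin> {0, 1}" by (intro AE_not_finite) auto
    then show "AE t in lborel. ennreal (speed M \<gamma> t) * indicator {0..1} t
          \<le> ennreal (L * norm v) * indicator {0..1} t"
      by eventually_elim (auto simp: indicator_def intro!: ennreal_leI sp)
  qed
  also have "\<dots> = ennreal (L * norm v)" by (subst nn_integral_cmult) auto
  finally have "len \<gamma> 0 1 \<le> ennreal (L * norm v)" .
  moreover have "\<gamma> 0 = q" "\<gamma> 1 = q'"
    using q chart_inv[OF c] by (auto simp: \<gamma>_def x_def y_def v_def)
  ultimately show ?thesis using gdist_le[OF pw] by (auto simp: v_def dist_norm norm_minus_commute)
qed

text \<open>The lower bound includes points outside the chart domain; this is what forces small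
  geodesic balls into the chart.\<close>

lemma chart_dist:
  obtains c R l L where "c \<in> atlas M" "p \<in> fst c" "R > 0" "l > 0" "L > 0"
    "cball (snd c p) R \<subseteq> snd c ` fst c"
    "\<forall>s q. 0 < s \<and> s \<le> R \<and> \<not> (q \<in> fst c \<and> snd c q \<in> ball (snd c p) s) \<longrightarrow> ennreal (l * s) \<le> gdist M p q"
    "\<forall>q\<in>fst c. snd c q \<in> cball (snd c p) R \<longrightarrow> gdist M p q \<le> ennreal (L * dist (snd c p) (snd c q))"
proof -
  obtain c where c: "c \<in> atlas M" "p \<in> fst c" using atlas_cover .
  obtain R where R: "R > 0" "cball (snd c p) R \<subseteq> snd c ` fst c" using chart_cball[OF c] .
  obtain l L where "l > 0" "L > 0"
    "\<And>q u. q \<in> fst c \<Longrightarrow> snd c q \<in> cball (snd c p) R \<Longrightarrow> l * norm u \<le> sqrt (gform M c q u u)"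
    "\<And>q u. q \<in> fst c \<Longrightarrow> snd c q \<in> cball (snd c p) R \<Longrightarrow> sqrt (gform M c q u u) \<le> L * norm u"
    using gform_bounds[OF c(1) compact_cball R(2)] R(1) by (metis centre_in_cball empty_iff less_imp_le)
  then show ?thesis
    using that[of c R l L] c R gdist_lower[OF c R(2)] gdist_upper[OF c(1) convex_cball R(2) _ c(2)] by auto
qed

lemma gdist_zero: assumes "gdist M x y = 0" shows "x = y"
proof (rule ccontr)
  assume ne: "x \<noteq> y"
  obtain c R l L where c: "c \<in> atlas M" "x \<in> fst c" "R > 0" "l > 0" "L > 0"
    "cball (snd c x) R \<subseteq> snd c ` fst c"
    and low: "\<forall>s q. 0 < s \<and> s \<le> R \<and> \<not> (q \<in> fst c \<and> snd c q \<in> ball (snd c x) s) \<longrightarrow> ennreal (l * s) \<le> gdist M x q"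
    and upp: "\<forall>q\<in>fst c. snd c q \<in> cball (snd c x) R \<longrightarrow> gdist M x q \<le> ennreal (L * dist (snd c x) (snd c q))"
    using chart_dist[of x] .
  obtain s where s: "0 < s" "s \<le> R" "\<not> (y \<in> fst c \<and> snd c y \<in> ball (snd c x) s)"
  proof (cases "y \<in> fst c")
    case True
    then have "snd c x \<noteq> snd c y" using ne chart_inj[OF c(1)] c(2) by (auto dest: inj_onD)
    then show ?thesis using that[of "min R (dist (snd c x) (snd c y))"] c(3) by auto
  qed (use that[of R] c(3) in auto)
  have "ennreal (l * s) \<le> gdist M x y" using low s by blast
  then have "ennreal (l * s) \<le> 0" using assms by simp
  then show False using c(4) s(1) by (simp add: mult_le_0_iff)
qed

lemma gdist_near:
  assumes "e > 0" shows "eventually (\<lambda>q. gdist M q p < e) (nhds p)"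
proof -
  obtain c R l L where c: "c \<in> atlas M" "p \<in> fst c" "R > 0" "l > 0" "L > 0"
    "cball (snd c p) R \<subseteq> snd c ` fst c"
    and low: "\<forall>s q. 0 < s \<and> s \<le> R \<and> \<not> (q \<in> fst c \<and> snd c q \<in> ball (snd c p) s) \<longrightarrow> ennreal (l * s) \<le> gdist M p q"
    and upp: "\<forall>q\<in>fst c. snd c q \<in> cball (snd c p) R \<longrightarrow> gdist M p q \<le> ennreal (L * dist (snd c p) (snd c q))"
    using chart_dist[of p] .
  obtain e' where e': "0 < e'" "ennreal e' < e"
  proof (cases e)
    case (real r)
    then show ?thesis using that[of "r/2"] assms by (auto simp: ennreal_less_iff)
  qed (use that[of 1] in auto)
  let ?W = "{q \<in> fst c. snd c q \<in> ball (snd c p) (min R (e' / L))}"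
  have "open ?W" by (rule chart_preimage_open[OF c(1) open_ball])
  moreover have "p \<in> ?W" using c e' by simp
  moreover have "gdist M q p < e" if "q \<in> ?W" for q
  proof -
    have "gdist M p q \<le> ennreal (L * dist (snd c p) (snd c q))" using that upp by auto
    also have "\<dots> \<le> ennreal e'" using that c(5) by (intro ennreal_leI) (auto simp: field_simps)
    finally show ?thesis using e'(2) gdist_sym[of p q] by simp
  qed
  ultimately show ?thesis unfolding eventually_nhds by blast
qed

lemma gdist_open: "open {x. gdist M x x0 < e}"
proof (subst open_subopen, intro ballI)
  fix x assume "x \<in> {x. gdist M x x0 < e}"
  then have lt: "gdist M x x0 < e" by simp
  then have "0 < e - gdist M x x0" by (simp add: diff_gr0_ennreal)
  from gdist_near[OF this, of x] obtain W where W: "open W" "x \<in> W" "\<forall>q\<in>W. gdist M q x < e - gdist M x x0"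
    unfolding eventually_nhds by blast
  have "gdist M q x0 < e" if "q \<in> W" for q
  proof -
    have "gdist M q x0 \<le> gdist M q x + gdist M x x0" by (rule gdist_triangle)
    also have "\<dots> < (e - gdist M x x0) + gdist M x x0"
      using W(3) that lt by (simp add: add.commute[of _ "gdist M x x0"] ennreal_add_left_cancel_less less_top order.strict_trans2[OF lt])
    also have "\<dots> = e" using lt by (simp add: diff_add_cancel_ennreal)
    finally show ?thesis .
  qed
  then show "\<exists>T. open T \<and> x \<in> T \<and> T \<subseteq> {x. gdist M x x0 < e}" using W by blast
qed

lemma gball_open: "open (gball M x r)"
  unfolding gball_def by (rule gdist_open)

lemma gball_centre [simp]: "r > 0 \<Longrightarrow> x \<in> gball M x r"
  by (simp add: gball_def)

text \<open>Together with \<open>gball_open\<close>, this says that the geodesic distance induces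
  the given topology.\<close>

lemma gball_subset:
  assumes "open W" "p \<in> W"
  obtains r where "r > 0" "gball M p r \<subseteq> W"
proof -
  obtain c R l L where c: "c \<in> atlas M" "p \<in> fst c" "R > 0" "l > 0" "L > 0"
    "cball (snd c p) R \<subseteq> snd c ` fst c"
    and low: "\<forall>s q. 0 < s \<and> s \<le> R \<and> \<not> (q \<in> fst c \<and> snd c q \<in> ball (snd c p) s) \<longrightarrow> ennreal (l * s) \<le> gdist M p q"
    and upp: "\<forall>q\<in>fst c. snd c q \<in> cball (snd c p) R \<longrightarrow> gdist M p q \<le> ennreal (L * dist (snd c p) (snd c q))"
    using chart_dist[of p] .
  have "open (snd c ` (W \<inter> fst c))" using assms(1) chart_open[OF c(1)] by (intro chart_image_open_sub[OF c(1)]) auto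
  then obtain s0 where s0: "s0 > 0" "ball (snd c p) s0 \<subseteq> snd c ` (W \<inter> fst c)"
    using assms(2) c(2) by (meson IntI imageI openE)
  define s where "s = min s0 R"
  have s: "0 < s" "s \<le> R" using s0 c by (auto simp: s_def)
  have "q \<in> W" if q: "q \<in> gball M p (l * s)" for q
  proof (rule ccontr)
    assume nW: "q \<notin> W"
    have "\<not> (q \<in> fst c \<and> snd c q \<in> ball (snd c p) s)"
    proof
      assume *: "q \<in> fst c \<and> snd c q \<in> ball (snd c p) s"
      then have "snd c q \<in> snd c ` (W \<inter> fst c)" using s0 by (auto simp: s_def)
      then obtain q' where "q' \<in> W" "q' \<in> fst c" "snd c q' = snd c q" by force
      then show False using nW * chart_inj[OF c(1)] by (auto dest: inj_onD)
    qed
    from low s this have "ennreal (l * s) \<le> gdist M p q" by blast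
    then show False using q gdist_sym[of p q] by (simp add: gball_def)
  qed
  then show ?thesis using that[of "l * s"] c s by auto
qed

end

section \<open>Change of variables and the Riemannian volume\<close>

text \<open>The change of variables theorem of the library needs a well-ordered index type; a finite
  type is therefore replaced by an initial segment of the natural numbers of the same size.\<close>

typedef ('n::finite) fidx = "{..<CARD('n)} :: nat set"
  by (rule exI[of _ 0]) simp

instantiation fidx :: (finite) wellorder
begin

definition less_eq_fidx :: "'a fidx \<Rightarrow> 'a fidx \<Rightarrow> bool" where "less_eq_fidx x y \<longleftrightarrow> Rep_fidx x \<le> Rep_fidx y"
definition less_fidx :: "'a fidx \<Rightarrow> 'a fidx \<Rightarrow> bool" where "less_fidx x y \<longleftrightarrow> Rep_fidx x < Rep_fidx y"

instance
proof
  fix P :: "'a fidx \<Rightarrow> bool" and a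
  assume H: "\<And>x. (\<And>y. y < x \<Longrightarrow> P y) \<Longrightarrow> P x"
  show "P a"
  proof (induction "Rep_fidx a" arbitrary: a rule: less_induct)
    case less
    show ?case by (rule H) (rule less, simp add: less_fidx_def)
  qed
qed (auto simp: less_eq_fidx_def less_fidx_def Rep_fidx_inject)

end

lemma UNIV_fidx: "(UNIV :: 'n::finite fidx set) = Abs_fidx ` {..<CARD('n)}"
  using type_definition.univ[OF type_definition_fidx] .

instance fidx :: (finite) finite
  by standard (simp add: UNIV_fidx)

lemma card_fidx: "CARD('n::finite fidx) = CARD('n)"
  using type_definition.card[OF type_definition_fidx] by simp

lemma fidx_bij: obtains h :: "'n::finite fidx \<Rightarrow> 'n" where "bij h"
proof -
  obtain h where "bij_betw h (UNIV :: 'n fidx set) (UNIV :: 'n set)"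
    using finite_same_card_bij[of "UNIV :: 'n fidx set" "UNIV :: 'n set"] card_fidx by auto
  then show ?thesis using that by blast
qed

section \<open>Determinants and Lebesgue measure under renaming of coordinates\<close>

text \<open>Conjugation by a bijection takes transpositions to transpositions, so induction over a
  product of transpositions applies.\<close>

lemma sign_conj:
  fixes h :: "'m::finite \<Rightarrow> 'n::finite"
  assumes h: "bij h" and q: "q permutes UNIV"
  shows "sign (h \<circ> q \<circ> inv h) = sign q"
  using q finite[of UNIV]
proof (induction rule: permutes_induct)
  case id
  then show ?case using h by (simp add: o_def bij_is_surj surj_f_inv_f sign_id[unfolded id_def] cong: id_apply)
next
  case (swap a b p)
  have pm: "permutation (h \<circ> p \<circ> inv h)" "permutation p"
  proof -
    have "bij (h \<circ> p \<circ> inv h)" using h swap by (intro bij_comp bij_imp_bij_inv) (auto dest: permutes_bij)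
    then show "permutation (h \<circ> p \<circ> inv h)" by (simp add: permutation)
    show "permutation p" using swap permutes_bij by (auto simp: permutation)
  qed
  have eq: "h \<circ> (Transposition.transpose a b \<circ> p) \<circ> inv h = Transposition.transpose (h a) (h b) \<circ> (h \<circ> p \<circ> inv h)"
    using h by (auto simp: fun_eq_iff Transposition.transpose_def dest: bij_is_inj injD)
  have ne: "h a \<noteq> h b" using h \<open>a \<noteq> b\<close> by (auto dest: bij_is_inj injD)
  show ?case
    unfolding eq sign_compose[OF permutation_swap_id pm(1)] sign_compose[OF permutation_swap_id pm(2)]
    using \<open>sign (h \<circ> p \<circ> inv h) = sign p\<close> ne \<open>a \<noteq> b\<close> by (simp add: sign_swap_id)
qed

lemma det_reindex:
  fixes A :: "real^'n^'n" and h :: "'m::finite \<Rightarrow> 'n::finite"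
  assumes h: "bij h"
  shows "det ((\<chi> i j. A $ h i $ h j) :: real^'m^'m) = det A"
  unfolding det_def
proof (rule sum.reindex_bij_witness[of _ "\<lambda>p. inv h \<circ> p \<circ> h" "\<lambda>q. h \<circ> q \<circ> inv h"], goal_cases)
  case (1 q) then show ?case using h by (auto simp: fun_eq_iff bij_is_inj)
next
  case (2 q) then show ?case using h 
    by (auto intro!: bij_imp_permutes bij_comp bij_imp_bij_inv dest: permutes_bij)
next
  case (3 p) then show ?case using h by (auto simp: fun_eq_iff bij_is_surj surj_f_inv_f)
next
  case (4 p) then show ?case using h 
    by (auto intro!: bij_imp_permutes bij_comp bij_imp_bij_inv dest: permutes_bij)
next
  case (5 q)
  have "(\<Prod>i\<in>UNIV. A $ i $ (h \<circ> q \<circ> inv h) i) = (\<Prod>i\<in>UNIV. A $ h i $ h (q i))"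
    by (rule prod.reindex_bij_witness[of _ h "inv h"]) (use h in \<open>auto simp: bij_is_inj bij_is_surj surj_f_inv_f\<close>)
  then show ?case using sign_conj[OF h] 5 by simp
qed

definition reindex :: "('m \<Rightarrow> 'n) \<Rightarrow> real^'n \<Rightarrow> real^'m" where
  "reindex h x = (\<chi> i. x $ h i)"

lemma reindex_nth [simp]: "reindex h x $ i = x $ h i"
  by (simp add: reindex_def)

lemma reindex_linear: "linear (reindex h :: real^'n::finite \<Rightarrow> real^'m::finite)"
  by (rule linearI) (auto simp: vec_eq_iff)

lemma reindex_cont: "continuous_on S (reindex h :: real^'n::finite \<Rightarrow> real^'m::finite)"
  using linear_continuous_on[OF linear_conv_bounded_linear[THEN iffD1, OF reindex_linear]] .

lemma reindex_inverse:
  assumes "bij h"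
  shows "reindex (inv h) (reindex h x) = x" "reindex h (reindex (inv h) y) = y"
  using assms by (auto simp: vec_eq_iff bij_is_surj surj_f_inv_f bij_is_inj)

text \<open>Boxes are carried to boxes with the same side lengths, and Lebesgue measure is
  determined by its values on boxes.\<close>

lemma lborel_reindex:
  fixes h :: "'m::finite \<Rightarrow> 'n::finite"
  assumes h: "bij h"
  shows "distr lborel borel (reindex h) = lborel"
proof (rule lborel_eqI[symmetric])
  have B: "(\<Prod>b\<in>Basis. w \<bullet> b) = (\<Prod>i\<in>UNIV. w $ i)" for w :: "real^'k::finite"
  proof -
    have Bs: "(Basis :: (real^'k) set) = (\<lambda>i. axis i 1) ` UNIV" by (auto simp: Basis_vec_def)
    have "inj (\<lambda>i::'k. axis i (1::real))" by (auto simp: inj_on_def axis_eq_axis)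
    then show ?thesis unfolding Bs by (subst prod.reindex) (auto simp: inner_axis)
  qed
  have m: "reindex h \<in> borel_measurable (borel :: (real^'n) measure)"
    using reindex_cont[of UNIV h] by (rule borel_measurable_continuous_onI)
  fix l u :: "real^'m" assume le: "\<And>b. b \<in> Basis \<Longrightarrow> l \<bullet> b \<le> u \<bullet> b"
  have "reindex h -` box l u = box (reindex (inv h) l) (reindex (inv h) u)"
    using h by (auto simp: mem_box_cart bij_is_inj) (metis bij_inv_eq_iff)+
  then have "emeasure (distr lborel borel (reindex h)) (box l u)
     = emeasure lborel (box (reindex (inv h) l) (reindex (inv h) u))"
    using m by (subst emeasure_distr) auto
  also have "\<dots> = (\<Prod>b\<in>Basis. (reindex (inv h) u - reindex (inv h) l) \<bullet> b)"
  proof -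
    have "l $ i \<le> u $ i" for i using le[of "axis i 1"] by (auto simp: inner_axis axis_in_Basis_iff)
    then have "\<forall>b\<in>Basis. reindex (inv h) l \<bullet> b \<le> reindex (inv h) u \<bullet> b"
      by (auto simp: Basis_vec_def inner_axis)
    then show ?thesis by (simp add: emeasure_lborel_box_eq)
  qed
  also have "\<dots> = (\<Prod>i\<in>UNIV. (u - l) $ inv h i)" by (subst B) simp
  also have "(\<Prod>i\<in>UNIV. (u - l) $ inv h i) = (\<Prod>i\<in>UNIV. (u - l) $ i)"
    by (rule prod.reindex_bij_witness[of _ h "inv h"]) (use h in \<open>auto simp: bij_is_inj bij_is_surj surj_f_inv_f\<close>)
  also have "\<dots> = (\<Prod>b\<in>Basis. (u - l) \<bullet> b)" by (subst B) simp
  finally show "emeasure (distr lborel borel (reindex h)) (box l u) = ennreal (\<Prod>b\<in>Basis. (u - l) \<bullet> b)" .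
qed simp

lemma nn_integral_reindex:
  fixes h :: "'m::finite \<Rightarrow> 'n::finite" and F :: "real^'m \<Rightarrow> ennreal"
  assumes h: "bij h" and F: "F \<in> borel_measurable borel"
  shows "(\<integral>\<^sup>+y. F y \<partial>lborel) = (\<integral>\<^sup>+x. F (reindex h x) \<partial>lborel)"
proof -
  have m: "reindex h \<in> lborel \<rightarrow>\<^sub>M (borel :: (real^'m) measure)"
    using borel_measurable_continuous_onI[OF reindex_cont[of UNIV h]] by simp
  have "(\<integral>\<^sup>+y. F y \<partial>lborel) = (\<integral>\<^sup>+y. F y \<partial>distr lborel borel (reindex h))" using lborel_reindex[OF h] by simp
  also have "\<dots> = (\<integral>\<^sup>+x. F (reindex h x) \<partial>lborel)" by (rule nn_integral_distr[OF m]) (use F in simp)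
  finally show ?thesis .
qed

text \<open>A bridge from extended nonnegative integrals to the pair of absolute integrability and
  real integral, which is the form in which change of variables is available.\<close>

lemma nn_integral_eq_iff_integral:
  fixes F :: "'v::euclidean_space \<Rightarrow> real"
  assumes F: "F \<in> borel_measurable borel" "\<And>x. 0 \<le> F x" and T: "T \<in> sets borel" and r: "0 \<le> r"
  shows "(\<integral>\<^sup>+x\<in>T. ennreal (F x) \<partial>lborel) = ennreal r \<longleftrightarrow> F absolutely_integrable_on T \<and> integral T F = r"
proof -
  let ?G = "\<lambda>x. F x * indicator T x"
  have G: "?G \<in> borel_measurable borel" "\<And>x. 0 \<le> ?G x" using F T by (auto simp: indicator_def)
  have e: "(\<integral>\<^sup>+x\<in>T. ennreal (F x) \<partial>lborel) = (\<integral>\<^sup>+x. ennreal (?G x) \<partial>lborel)"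
    by (rule nn_integral_cong) (auto simp: indicator_def)
  have u: "(?G has_integral r) UNIV \<longleftrightarrow> (F has_integral r) T"
    using has_integral_restrict_UNIV[of T F r] by (simp add: indicator_def of_bool_def if_distrib cong: if_cong)
  have "(\<integral>\<^sup>+x\<in>T. ennreal (F x) \<partial>lborel) = ennreal r \<longleftrightarrow> (F has_integral r) T"
    unfolding e u[symmetric] using nn_integral_has_integral[OF G _ r] nn_integral_has_integral_lborel[OF G] by blast
  also have "\<dots> \<longleftrightarrow> F absolutely_integrable_on T \<and> integral T F = r"
    using nonnegative_absolutely_integrable_1[of F T] F(2) set_lebesgue_integral_eq_integral(1)
    by (auto simp: has_integral_iff)
  finally show ?thesis .
qed

text \<open>Change of variables is an equivalence between finite values of two integrals of
  vector-valued functions, hence the passage through \<open>real^1\<close>. If one side takes no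
  finite value, neither does the other, so infinite integrals agree too. The function
  \<open>e\<close> is a globally Borel version of the transformed integrand, which is prescribed
  only on \<open>S\<close>.\<close>

lemma nn_change_of_variables_wellorder:
  fixes g :: "real^'m::{finite,wellorder} \<Rightarrow> real^'m::_" and f e :: "real^'m::_ \<Rightarrow> real"
  assumes S: "S \<in> sets borel" "g ` S \<in> sets borel"
    and der: "\<And>x. x \<in> S \<Longrightarrow> (g has_derivative g' x) (at x within S)" and inj: "inj_on g S"
    and f: "f \<in> borel_measurable borel" "\<And>x. 0 \<le> f x" and e: "e \<in> borel_measurable borel" "\<And>x. 0 \<le> e x"
    and ef: "\<And>x. x \<in> S \<Longrightarrow> e x = \<bar>det (matrix (g' x))\<bar> * f (g x)"
  shows "(\<integral>\<^sup>+x\<in>g ` S. ennreal (f x) \<partial>lborel) = (\<integral>\<^sup>+x\<in>S. ennreal (e x) \<partial>lborel)"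
proof -
  have S': "S \<in> sets lebesgue" using S by simp
  let ?D = "\<lambda>x. \<bar>det (matrix (g' x))\<bar> *\<^sub>R (vec (f (g x)) :: real^1)"
  have a: "?D absolutely_integrable_on S \<and> integral S ?D = vec r
    \<longleftrightarrow> e absolutely_integrable_on S \<and> integral S e = r" for r
  proof -
    have *: "?D x $ 1 = e x" if "x \<in> S" for x using ef[OF that] by simp
    have ai: "?D absolutely_integrable_on S \<longleftrightarrow> e absolutely_integrable_on S"
      unfolding absolutely_integrable_on_1_iff
      by (rule set_integrable_cong) (use * in auto)
    have "integral S ?D = vec (integral S (\<lambda>x. ?D x $ 1))" unfolding integral_on_1_eq ..
    also have "integral S (\<lambda>x. ?D x $ 1) = integral S e" by (rule integral_cong) (use * in auto)
    finally show ?thesis using ai by (auto simp: vec_eq_iff)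
  qed
  have b: "(\<lambda>x. vec (f x) :: real^1) absolutely_integrable_on (g ` S) \<and> integral (g ` S) (\<lambda>x. vec (f x) :: real^1) = vec r
    \<longleftrightarrow> f absolutely_integrable_on (g ` S) \<and> integral (g ` S) f = r" for r
    by (auto simp: absolutely_integrable_on_1_iff integral_on_1_eq vec_eq_iff)
  have c: "(\<integral>\<^sup>+x\<in>g ` S. ennreal (f x) \<partial>lborel) = ennreal r \<longleftrightarrow> (\<integral>\<^sup>+x\<in>S. ennreal (e x) \<partial>lborel) = ennreal r"
    if "0 \<le> r" for r
    unfolding nn_integral_eq_iff_integral[OF f S(2) that] nn_integral_eq_iff_integral[OF e S(1) that]
    using has_absolute_integral_change_of_variables[OF S' der inj, of "\<lambda>x. vec (f x) :: real^1" "vec r"] a b by blast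
  show ?thesis
  proof (cases "\<integral>\<^sup>+x\<in>g ` S. ennreal (f x) \<partial>lborel" rule: ennreal_cases)
    case (real r)
    then show ?thesis using c[of r] by simp
  next
    case top
    then show ?thesis using c by (cases "\<integral>\<^sup>+x\<in>S. ennreal (e x) \<partial>lborel" rule: ennreal_cases) auto
  qed
qed

text \<open>The map is conjugated with the renaming of coordinates \<open>reindex\<close>. This
  preserves Lebesgue measure, and it preserves the jacobian determinant by
  \<open>det_reindex\<close>.\<close>

lemma nn_change_of_variables:
  fixes g :: "real^'n::finite \<Rightarrow> real^'n" and f e :: "real^'n \<Rightarrow> real"
  assumes S: "S \<in> sets borel" "g ` S \<in> sets borel"
    and der: "\<And>x. x \<in> S \<Longrightarrow> (g has_derivative (\<lambda>v. J x *v v)) (at x within S)" and inj: "inj_on g S"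
    and f: "f \<in> borel_measurable borel" "\<And>x. 0 \<le> f x" and e: "e \<in> borel_measurable borel" "\<And>x. 0 \<le> e x"
    and ef: "\<And>x. x \<in> S \<Longrightarrow> e x = \<bar>det (J x)\<bar> * f (g x)"
  shows "(\<integral>\<^sup>+x\<in>g ` S. ennreal (f x) \<partial>lborel) = (\<integral>\<^sup>+x\<in>S. ennreal (e x) \<partial>lborel)"
proof -
  obtain h :: "'n fidx \<Rightarrow> 'n" where h: "bij h" using fidx_bij .
  let ?P = "reindex h" and ?Q = "reindex (inv h)"
  note inv = reindex_inverse[OF h]
  have Pm: "?P \<in> borel_measurable borel" and Qm: "?Q \<in> borel_measurable borel"
    using borel_measurable_continuous_onI[OF reindex_cont[of UNIV h]]
      borel_measurable_continuous_onI[OF reindex_cont[of UNIV "inv h"]] .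
  have im: "?P ` X = ?Q -` X" for X
  proof (intro set_eqI iffI)
    fix y assume "y \<in> ?Q -` X"
    then show "y \<in> ?P ` X" using inv(2)[of y] by (metis image_eqI vimageD)
  qed (auto simp: inv)
  have Pb: "?P ` X \<in> sets borel" if "X \<in> sets borel" for X
    using measurable_sets[OF Qm that] by (simp add: im)
  define g2 where "g2 = (\<lambda>y. ?P (g (?Q y)))"
  define g2' where "g2' = (\<lambda>y v. ?P (J (?Q y) *v ?Q v))"
  have img: "g2 ` (?P ` S) = ?P ` g ` S" by (simp add: g2_def image_image inv)
  have mat: "matrix (g2' y) = (\<chi> i j. J (?Q y) $ h i $ h j)" for y
  proof -
    have "inv h i = j \<longleftrightarrow> i = h j" for i j using bij_inv_eq_iff[OF h, of j i] by auto
    then have Qa: "?Q (axis j 1) = axis (h j) 1" for j by (simp add: vec_eq_iff axis_def)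
    show ?thesis unfolding matrix_def g2'_def Qa
      by (simp add: vec_eq_iff matrix_vector_mult_basis column_def)
  qed
  have "(\<integral>\<^sup>+y\<in>g2 ` (?P ` S). ennreal (f (?Q y)) \<partial>lborel) = (\<integral>\<^sup>+y\<in>?P ` S. ennreal (e (?Q y)) \<partial>lborel)"
  proof (rule nn_change_of_variables_wellorder)
    show "?P ` S \<in> sets borel" "g2 ` (?P ` S) \<in> sets borel" using Pb S by (auto simp: img)
    show "(g2 has_derivative g2' y) (at y within ?P ` S)" if y: "y \<in> ?P ` S" for y
    proof -
      have QS: "?Q ` ?P ` S = S" by (simp add: image_image inv)
      have d1: "(?Q has_derivative ?Q) (at y within ?P ` S)"
        by (rule bounded_linear_imp_has_derivative) (simp add: linear_conv_bounded_linear[symmetric] reindex_linear)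
      have d2: "(?P has_derivative ?P) (at z within X)" for z X
        by (rule bounded_linear_imp_has_derivative) (simp add: linear_conv_bounded_linear[symmetric] reindex_linear)
      have "?Q y \<in> S" using y inv by auto
      then have "(g has_derivative (\<lambda>v. J (?Q y) *v v)) (at (?Q y) within ?Q ` ?P ` S)" using der QS by simp
      from diff_chain_within[OF diff_chain_within[OF d1 this] d2]
      show ?thesis by (simp add: g2_def g2'_def[abs_def] o_def)
    qed
    show "inj_on g2 (?P ` S)"
      using inj inv by (auto simp: inj_on_def g2_def) metis
    show "(\<lambda>y. f (?Q y)) \<in> borel_measurable borel" "(\<lambda>y. e (?Q y)) \<in> borel_measurable borel"
      using measurable_compose[OF Qm f(1)] measurable_compose[OF Qm e(1)] .
    show "e (?Q y) = \<bar>det (matrix (g2' y))\<bar> * f (?Q (g2 y))" if "y \<in> ?P ` S" for y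
      using that ef inv by (auto simp: mat det_reindex[OF h] g2_def)
  qed (use f e in auto)
  moreover have red: "(\<integral>\<^sup>+y\<in>?P ` X. ennreal (F (?Q y)) \<partial>lborel) = (\<integral>\<^sup>+x\<in>X. ennreal (F x) \<partial>lborel)"
    if F: "F \<in> borel_measurable borel" "X \<in> sets borel" for F :: "real^'n \<Rightarrow> real" and X
  proof -
    have "(\<lambda>y. ennreal (F (?Q y)) * indicator (?P ` X) y) \<in> borel_measurable borel"
      using measurable_compose[OF Qm F(1)] Pb[OF F(2)] by auto
    from nn_integral_reindex[OF h this]
    have "(\<integral>\<^sup>+y\<in>?P ` X. ennreal (F (?Q y)) \<partial>lborel)
       = (\<integral>\<^sup>+x. ennreal (F (?Q (?P x))) * indicator (?P ` X) (?P x) \<partial>lborel)" .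
    also have "\<dots> = (\<integral>\<^sup>+x\<in>X. ennreal (F x) \<partial>lborel)"
      by (rule nn_integral_cong) (auto simp: inv im indicator_def)
    finally show ?thesis .
  qed
  ultimately show ?thesis using red[OF f(1) S(2)] red[OF e(1) S(1)] by (simp add: img)
qed

text \<open>All matrices on the segment from the identity to \<open>A\<close> are positive definite
  and hence invertible, so the determinant cannot vanish on the way from 1 to
  \<open>det A\<close>.\<close>

lemma det_pos_of_positive_definite:
  fixes A :: "real^'n::finite^'n"
  assumes pd: "\<And>u. u \<noteq> 0 \<Longrightarrow> u \<bullet> (A *v u) > 0"
  shows "det A > 0"
proof (rule ccontr)
  assume neg: "\<not> det A > 0"
  define B where "B = (\<lambda>t::real. t *\<^sub>R A + (1 - t) *\<^sub>R mat 1)"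
  have c: "continuous_on {0..1} (\<lambda>t. det (B t))"
    unfolding det_def B_def by (intro continuous_intros)
  have "det (B 0) = 1" "det (B 1) = det A" by (simp_all add: B_def)
  then have "\<exists>t\<ge>0. t \<le> 1 \<and> det (B t) = 0"
    using IVT2'[of "\<lambda>t. det (B t)" 1 0 0, OF _ _ _ c] neg by auto
  then obtain t where t: "0 \<le> t" "t \<le> 1" "det (B t) = 0" by blast
  then have "\<not> invertible (B t)" by (simp add: invertible_det_nz)
  then have "\<not> (\<exists>C. C ** B t = mat 1)" by (simp add: invertible_left_inverse)
  then obtain x where x: "B t *v x = 0" "x \<noteq> 0" by (auto simp: matrix_left_invertible_ker)
  have "x \<bullet> (B t *v x) = t * (x \<bullet> (A *v x)) + (1 - t) * (x \<bullet> x)"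
    by (simp add: B_def matrix_vector_mult_add_rdistrib scaleR_matrix_vector_assoc[symmetric] inner_add_right)
  moreover have "x \<bullet> (A *v x) > 0" "x \<bullet> x > 0" using pd x(2) by auto
  ultimately have "x \<bullet> (B t *v x) > 0" using t
    by (cases "t = 0") (auto intro!: add_pos_nonneg mult_pos_pos mult_nonneg_nonneg)
  then show False using x(1) by simp
qed

lemma suminf_ennreal_swap:
  fixes f :: "nat \<Rightarrow> nat \<Rightarrow> ennreal"
  shows "(\<Sum>i. \<Sum>j. f i j) = (\<Sum>j. \<Sum>i. f i j)"
proof -
  have "(\<Sum>i. \<Sum>j. f i j) = (\<Sum>i. \<integral>\<^sup>+j. f i j \<partial>count_space UNIV)" by (simp add: nn_integral_count_space_nat)
  also have "\<dots> = (\<integral>\<^sup>+j. (\<Sum>i. f i j) \<partial>count_space UNIV)" by (rule nn_integral_suminf[symmetric]) simp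
  finally show ?thesis by (simp add: nn_integral_count_space_nat)
qed

section \<open>Existence, uniqueness and local growth of the Riemannian volume\<close>

context riem_mfd
begin

lemma det_gcoord_pos:
  assumes c: "c \<in> atlas M" and x: "x \<in> snd c ` fst c"
  shows "det (gcoord M c x) > 0"
proof (rule det_pos_of_positive_definite)
  fix u :: "real^'n" assume "u \<noteq> 0"
  then show "u \<bullet> (gcoord M c x *v u) > 0"
    using gform_pos[OF c chart_inv_into[OF x]] by (simp add: gform_def gcoord_def)
qed

text \<open>Extended by zero outside the coordinate domain, the density is Borel and nonnegative on
  all of Euclidean space, whatever \<open>gcoord\<close> yields there.\<close>

definition chart_density :: "('a, 'n) chart \<Rightarrow> real^'n \<Rightarrow> real" where
  "chart_density c x = indicator (snd c ` fst c) x *\<^sub>R sqrt (det (gcoord M c x))"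

lemma sqrt_det_cont: "c \<in> atlas M \<Longrightarrow> continuous_on (snd c ` fst c) (\<lambda>x. sqrt (det (gcoord M c x)))"
  unfolding det_def using gcoord_cont by (intro continuous_intros)

lemma chart_density_meas: "c \<in> atlas M \<Longrightarrow> chart_density c \<in> borel_measurable borel"
  unfolding chart_density_def[abs_def]
  by (intro borel_measurable_continuous_on_indicator sqrt_det_cont) (auto simp: chart_image_open)

lemma chart_density_nonneg: "c \<in> atlas M \<Longrightarrow> 0 \<le> chart_density c x"
  using det_gcoord_pos[of c x] by (auto simp: chart_density_def indicator_def less_imp_le)

definition chart_vol :: "('a, 'n) chart \<Rightarrow> 'a set \<Rightarrow> ennreal" where
  "chart_vol c S = (\<integral>\<^sup>+x\<in>snd c ` S. ennreal (sqrt (det (gcoord M c x))) \<partial>lborel)"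

lemma chart_image_borel:
  assumes c: "c \<in> atlas M" and S: "S \<in> sets borel" "S \<subseteq> fst c"
  shows "snd c ` S \<in> sets borel"
proof -
  let ?U = "snd c ` fst c" and ?i = "inv_into (fst c) (snd c)"
  have "?i \<in> borel_measurable (restrict_space borel ?U)"
    by (rule borel_measurable_continuous_on_restrict[OF chart_inv_cont[OF c]])
  from measurable_sets[OF this S(1)]
  have "?i -` S \<inter> ?U \<in> sets borel"
    using chart_image_open[OF c] by (simp add: space_restrict_space sets_restrict_space_iff)
  moreover have "snd c ` S = ?i -` S \<inter> ?U"
    using S chart_inv[OF c] by (force simp: image_iff)
  ultimately show ?thesis by simp
qed

lemma chart_vol_density:
  assumes c: "c \<in> atlas M" and S: "S \<in> sets borel" "S \<subseteq> fst c"
  shows "chart_vol c S = (\<integral>\<^sup>+x\<in>snd c ` S. ennreal (chart_density c x) \<partial>lborel)"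
    and "chart_vol c S = emeasure (density lborel (\<lambda>x. ennreal (chart_density c x))) (snd c ` S)"
proof -
  show 1: "chart_vol c S = (\<integral>\<^sup>+x\<in>snd c ` S. ennreal (chart_density c x) \<partial>lborel)"
    unfolding chart_vol_def by (rule nn_integral_cong) (use S in \<open>auto simp: chart_density_def indicator_def\<close>)
  show "chart_vol c S = emeasure (density lborel (\<lambda>x. ennreal (chart_density c x))) (snd c ` S)"
    unfolding 1 using chart_density_meas[OF c] chart_image_borel[OF c S] by (subst emeasure_density) auto
qed

text \<open>By the law \<open>g = J^T g' J\<close>, the square root of the determinant acquires the
  factor \<open>|det J|\<close>, which is exactly the factor in the change of variables.\<close>

lemma chart_vol_change:
  assumes c: "c \<in> atlas M" "c' \<in> atlas M" and S: "S \<in> sets borel" "S \<subseteq> fst c \<inter> fst c'"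
  shows "chart_vol c S = chart_vol c' S"
proof -
  let ?T = "transition c c'" and ?J = "\<lambda>x. jacobian (transition c c') (at x)"
  have S': "S \<subseteq> fst c" "S \<subseteq> fst c'" using S by auto
  have Tc: "?T (snd c p) = snd c' p" if "p \<in> S" for p
    using that S' chart_inv[OF c(1)] by (auto simp: transition_def)
  have im: "?T ` snd c ` S = snd c' ` S" using Tc by (force simp: image_iff)
  have "(\<integral>\<^sup>+x\<in>?T ` snd c ` S. ennreal (chart_density c' x) \<partial>lborel) = (\<integral>\<^sup>+x\<in>snd c ` S. ennreal (chart_density c x) \<partial>lborel)"
  proof (rule nn_change_of_variables)
    show "snd c ` S \<in> sets borel" "?T ` snd c ` S \<in> sets borel"
      using chart_image_borel[OF c(1) S(1) S'(1)] chart_image_borel[OF c(2) S(1) S'(2)] by (auto simp: im)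
    show "(?T has_derivative (\<lambda>v. ?J x *v v)) (at x within snd c ` S)" if "x \<in> snd c ` S" for x
    proof -
      have "x \<in> snd c ` (fst c \<inter> fst c')" using that S(2) by blast
      from transition_diff[OF c this] show ?thesis by (rule has_derivative_at_withinI)
    qed
    show "inj_on ?T (snd c ` S)"
    proof (rule inj_onI)
      fix x y assume "x \<in> snd c ` S" "y \<in> snd c ` S" and e: "?T x = ?T y"
      then obtain p q where pq: "p \<in> S" "x = snd c p" "q \<in> S" "y = snd c q" by blast
      have "?T (snd c p) = ?T (snd c q)" using e pq(2,4) by (simp only:)
      then have "snd c' p = snd c' q" using Tc[OF pq(1)] Tc[OF pq(3)] by (simp only:)
      then have "p = q" by (rule inj_onD[OF inj_on_subset[OF chart_inj[OF c(2)] S'(2)] _ pq(1) pq(3)])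
      then show "x = y" using pq by simp
    qed
    show "chart_density c x = \<bar>det (?J x)\<bar> * chart_density c' (?T x)" if x: "x \<in> snd c ` S" for x
    proof -
      obtain p where p: "p \<in> S" "x = snd c p" using x by auto
      have "det (gmat M c p) = (det (?J x))\<^sup>2 * det (gmat M c' p)"
        using gmat_change[OF c, of p] p S by (simp add: det_mul det_transpose power2_eq_square subset_iff)
      moreover have "p \<in> fst c" "p \<in> fst c'" using p S' by auto
      ultimately show ?thesis
        using p Tc[OF p(1)] by (simp add: chart_density_def gcoord_chart c real_sqrt_mult)
    qed
  qed (auto intro: chart_density_meas chart_density_nonneg c)
  then show ?thesis unfolding chart_vol_density(1)[OF c(1) S(1) S'(1)] chart_vol_density(1)[OF c(2) S(1) S'(2)] im by simp
qed

lemma chart_vol_suminf: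
  assumes c: "c \<in> atlas M" and X: "\<And>i::nat. X i \<in> sets borel" "\<And>i. X i \<subseteq> fst c" "disjoint_family X"
  shows "(\<Sum>i. chart_vol c (X i)) = chart_vol c (\<Union>i. X i)"
proof -
  let ?\<nu> = "density lborel (\<lambda>x. ennreal (chart_density c x))"
  have U: "(\<Union>i. X i) \<in> sets borel" "(\<Union>i. X i) \<subseteq> fst c" using X by auto
  have "disjoint_family (\<lambda>i. snd c ` X i)"
    using X(3) inj_on_image_Int[OF chart_inj[OF c] X(2) X(2)] unfolding disjoint_family_on_def by (metis image_empty)
  then have "(\<Sum>i. emeasure ?\<nu> (snd c ` X i)) = emeasure ?\<nu> (\<Union>i. snd c ` X i)"
    using chart_image_borel[OF c X(1,2)] by (intro suminf_emeasure) auto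
  then show ?thesis
    unfolding chart_vol_density(2)[OF c X(1,2)] chart_vol_density(2)[OF c U] by (simp add: image_UN)
qed

lemma countable_charts:
  obtains ch :: "nat \<Rightarrow> ('a, 'n) chart" where "\<forall>i. ch i \<in> atlas M" "(\<Union>i. fst (ch i)) = UNIV"
proof -
  have "\<And>S. S \<in> fst ` atlas M \<Longrightarrow> open S" using chart_open by auto
  then obtain F where F: "F \<subseteq> fst ` atlas M" "countable F" "\<Union>F = \<Union>(fst ` atlas M)"
    using Lindelof[of "fst ` atlas M"] by blast
  have un: "\<Union>(fst ` atlas M) = UNIV" using atlas_cover by blast
  then have ne: "F \<noteq> {}" using F(3) by auto
  define ch where "ch = (\<lambda>i. SOME c. c \<in> atlas M \<and> fst c = from_nat_into F i)"
  have "\<exists>c. c \<in> atlas M \<and> fst c = from_nat_into F i" for i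
    using from_nat_into[OF ne, of i] F(1) by (metis imageE subsetD)
  then have ch: "ch i \<in> atlas M \<and> fst (ch i) = from_nat_into F i" for i unfolding ch_def by (rule someI_ex)
  have "(\<Union>i. fst (ch i)) = \<Union>(range (from_nat_into F))" using ch by auto
  then have "(\<Union>i. fst (ch i)) = UNIV" using range_from_nat_into[OF ne F(2)] F(3) un by simp
  then show ?thesis using that[of ch] ch by blast
qed

definition is_riem_vol :: "'a measure \<Rightarrow> bool" where
  "is_riem_vol \<mu> \<longleftrightarrow> sets \<mu> = sets borel \<and>
     (\<forall>c\<in>atlas M. \<forall>S\<in>sets borel. S \<subseteq> fst c \<longrightarrow> emeasure \<mu> S = chart_vol c S)"

text \<open>The space is cut into countably many disjoint Borel pieces, each inside one chart. Any
  volume measure must be the sum of the chart volumes of the pieces, which gives uniqueness; the sum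
  has the required values in every chart because chart volumes agree on overlaps.\<close>

lemma ex1_riem_vol: "\<exists>!\<mu>. is_riem_vol \<mu>"
proof -
  obtain ch where ch0: "\<forall>i. ch i \<in> atlas M" "(\<Union>i::nat. fst (ch i)) = UNIV" using countable_charts .
  then have ch: "\<And>i. ch i \<in> atlas M" "(\<Union>i::nat. fst (ch i)) = UNIV" by auto
  define A where "A = disjointed (\<lambda>i. fst (ch i))"
  have A: "disjoint_family A" "\<And>i. A i \<subseteq> fst (ch i)" "(\<Union>i. A i) = UNIV"
    unfolding A_def UN_disjointed_eq by (rule disjoint_family_disjointed, rule disjointed_subset, rule ch(2))
  have Ab: "A i \<in> sets borel" for i
  proof -
    have "range (\<lambda>i. fst (ch i)) \<subseteq> sets borel" by (intro image_subsetI borel_open chart_open ch)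
    from sets.range_disjointed_sets[OF this] show ?thesis unfolding A_def by auto
  qed
  define m where "m = (\<lambda>S. \<Sum>i. chart_vol (ch i) (S \<inter> A i))"
  define \<mu> where "\<mu> = measure_of UNIV (sets borel) m"
  have sets: "sets \<mu> = sets borel" unfolding \<mu>_def using sets.sigma_sets_eq[of borel] by simp
  have ca: "countably_additive (sets \<mu>) m"
  proof (rule countably_additiveI)
    fix X :: "nat \<Rightarrow> 'a set" assume X: "range X \<subseteq> sets \<mu>" "disjoint_family X"
    have Xb: "X j \<in> sets borel" for j using X(1) unfolding sets by blast
    have Xd: "disjoint_family (\<lambda>j. X j \<inter> A i)" for i using X(2) unfolding disjoint_family_on_def by blast
    have Xs: "X j \<inter> A i \<subseteq> fst (ch i)" for i j using A(2) by blast
    have "(\<Sum>j. m (X j)) = (\<Sum>i. \<Sum>j. chart_vol (ch i) (X j \<inter> A i))"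
      unfolding m_def by (rule suminf_ennreal_swap)
    also have "\<dots> = (\<Sum>i. chart_vol (ch i) (\<Union>j. X j \<inter> A i))"
      by (intro suminf_cong chart_vol_suminf ch sets.Int Xb Ab Xd Xs)
    also have "\<dots> = m (\<Union>j. X j)" by (simp add: m_def)
    finally show "(\<Sum>j. m (X j)) = m (\<Union>j. X j)" .
  qed
  have pos: "positive (sets \<mu>) m" by (auto simp: positive_def m_def chart_vol_def)
  have em: "emeasure \<mu> S = m S" if "S \<in> sets borel" for S
    by (rule emeasure_measure_of[OF \<mu>_def _ pos ca]) (use that sets in auto)
  have Sd: "disjoint_family (\<lambda>i. S \<inter> A i)" for S using A(1) unfolding disjoint_family_on_def by blast
  have cov: "(\<Sum>i. chart_vol c (S \<inter> A i)) = chart_vol c S" if "c \<in> atlas M" "S \<in> sets borel" "S \<subseteq> fst c" for c S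
  proof -
    have "(\<Sum>i. chart_vol c (S \<inter> A i)) = chart_vol c (\<Union>i. S \<inter> A i)"
      by (intro chart_vol_suminf sets.Int that(1,2) Ab Sd) (use that(3) in blast)
    moreover have "(\<Union>i. S \<inter> A i) = S" using A(3) by blast
    ultimately show ?thesis by simp
  qed
  have ex: "is_riem_vol \<mu>"
    unfolding is_riem_vol_def
  proof (intro conjI ballI impI sets)
    fix c S assume c: "c \<in> atlas M" and S: "S \<in> sets borel" "S \<subseteq> fst c"
    have "chart_vol (ch i) (S \<inter> A i) = chart_vol c (S \<inter> A i)" for i
      using A(2)[of i] S(2) by (intro chart_vol_change[OF ch(1) c] sets.Int S(1) Ab) blast
    then show "emeasure \<mu> S = chart_vol c S" using em[OF S(1)] cov[OF c S] by (simp add: m_def)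
  qed
  have uniq: "emeasure \<nu> S = m S" if \<nu>: "is_riem_vol \<nu>" and S: "S \<in> sets borel" for \<nu> S
  proof -
    have sn: "sets \<nu> = sets borel" using \<nu> by (simp add: is_riem_vol_def)
    have "emeasure \<nu> (\<Union>i. S \<inter> A i) = (\<Sum>i. emeasure \<nu> (S \<inter> A i))"
      by (rule suminf_emeasure[symmetric]) (use S Ab sn in blast, rule Sd)
    moreover have "(\<Union>i. S \<inter> A i) = S" using A(3) by blast
    moreover have "emeasure \<nu> (S \<inter> A i) = chart_vol (ch i) (S \<inter> A i)" for i
      using \<nu> ch(1)[of i] S Ab[of i] A(2)[of i] unfolding is_riem_vol_def by blast
    ultimately show ?thesis by (simp add: m_def)
  qed
  show ?thesis
  proof (rule ex1I, rule ex)
    fix \<nu> assume \<nu>: "is_riem_vol \<nu>"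
    then have "sets \<nu> = sets borel" by (simp add: is_riem_vol_def)
    then show "\<nu> = \<mu>" using uniq[OF \<nu>] em sets by (intro measure_eqI) auto
  qed
qed

lemma riem_borel_volume_is: "is_riem_vol (riem_borel_volume M)"
proof -
  have "riem_borel_volume M = (THE \<mu>. is_riem_vol \<mu>)"
    unfolding riem_borel_volume_def is_riem_vol_def chart_vol_def ..
  then show ?thesis using theI'[OF ex1_riem_vol] by simp
qed

lemma riem_volume_sets: "S \<in> sets borel \<Longrightarrow> S \<in> sets (riem_volume M)"
  using riem_borel_volume_is unfolding riem_volume_def is_riem_vol_def by (auto intro: sets_completionI_sets)

lemma riem_volume_chart:
  assumes "c \<in> atlas M" "S \<in> sets borel" "S \<subseteq> fst c"
  shows "emeasure (riem_volume M) S = chart_vol c S"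
proof -
  have "S \<in> sets (riem_borel_volume M)" "emeasure (riem_borel_volume M) S = chart_vol c S"
    using riem_borel_volume_is assms unfolding is_riem_vol_def by auto
  then show ?thesis unfolding riem_volume_def by simp
qed

text \<open>The geodesic ball is squeezed between coordinate balls of radii \<open>r / L\<close> and
  \<open>r / l\<close>, and the volume density lies between positive constants on a closed
  coordinate ball.\<close>

lemma gball_volume:
  obtains r0 a A where "r0 > 0" "a > 0" "A > 0"
    "\<And>r. 0 < r \<Longrightarrow> r \<le> r0 \<Longrightarrow> ennreal (a * r ^ CARD('n)) \<le> emeasure (riem_volume M) (gball M p r)"
    "\<And>r. 0 < r \<Longrightarrow> r \<le> r0 \<Longrightarrow> emeasure (riem_volume M) (gball M p r) \<le> ennreal (A * r ^ CARD('n))"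
proof -
  obtain c R l L where c: "c \<in> atlas M" "p \<in> fst c" "R > 0" "l > 0" "L > 0"
    "cball (snd c p) R \<subseteq> snd c ` fst c"
    and low: "\<forall>s q. 0 < s \<and> s \<le> R \<and> \<not> (q \<in> fst c \<and> snd c q \<in> ball (snd c p) s) \<longrightarrow> ennreal (l * s) \<le> gdist M p q"
    and upp: "\<forall>q\<in>fst c. snd c q \<in> cball (snd c p) R \<longrightarrow> gdist M p q \<le> ennreal (L * dist (snd c p) (snd c q))"
    using chart_dist[of p] .
  let ?K = "cball (snd c p) R" and ?h = "\<lambda>x. sqrt (det (gcoord M c x))"
  have ch: "continuous_on ?K ?h" using continuous_on_subset[OF sqrt_det_cont[OF c(1)] c(6)] .
  have ne: "?K \<noteq> {}" using c(3) by auto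
  obtain z where z: "z \<in> ?K" "\<forall>y\<in>?K. ?h z \<le> ?h y" using continuous_attains_inf[OF compact_cball ne ch] by blast
  obtain z' where z': "z' \<in> ?K" "\<forall>y\<in>?K. ?h y \<le> ?h z'" using continuous_attains_sup[OF compact_cball ne ch] by blast
  have hz: "?h z > 0" "?h z' > 0" using det_gcoord_pos[OF c(1)] z z' c(6) by auto
  define P where "P = (\<lambda>s. {q \<in> fst c. snd c q \<in> ball (snd c p) s})"
  have imP: "snd c ` P s = ball (snd c p) s" if "s \<le> R" for s
  proof -
    have "ball (snd c p) s \<subseteq> snd c ` fst c" using c(6) that by (auto simp: subset_iff)
    then show ?thesis by (auto simp: P_def)
  qed
  have Pb: "P s \<in> sets borel" "P s \<subseteq> fst c" for s
    using chart_preimage_open[OF c(1) open_ball, of "snd c p" s] by (auto simp: P_def)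
  define u where "u = unit_ball_vol (real CARD('n))"
  have u: "u > 0" by (simp add: u_def)
  have vb: "emeasure lborel (ball (snd c p) s) = ennreal (u * s ^ CARD('n))" if "s > 0" for s
    using content_ball[of s "snd c p"] that emeasure_lborel_ball_finite[of "snd c p" s]
    by (simp add: emeasure_eq_ennreal_measure u_def)
  have vlow: "ennreal (?h z * (u * s ^ CARD('n))) \<le> emeasure (riem_volume M) (P s)"
    and vupp: "emeasure (riem_volume M) (P s) \<le> ennreal (?h z' * (u * s ^ CARD('n)))"
    if s: "0 < s" "s \<le> R" for s
  proof -
    have e: "emeasure (riem_volume M) (P s) = (\<integral>\<^sup>+x\<in>ball (snd c p) s. ennreal (?h x) \<partial>lborel)"
      using riem_volume_chart[OF c(1) Pb] imP[OF s(2)] by (simp add: chart_vol_def)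
    have const: "(\<integral>\<^sup>+x\<in>ball (snd c p) s. ennreal k \<partial>lborel) = ennreal (k * (u * s ^ CARD('n)))" if "k > 0" for k
      using vb[OF s(1)] that by (subst nn_integral_cmult_indicator) (auto simp: ennreal_mult')
    show "ennreal (?h z * (u * s ^ CARD('n))) \<le> emeasure (riem_volume M) (P s)"
      unfolding e const[OF hz(1), symmetric]
      by (rule nn_integral_mono) (use z(2) s in \<open>auto simp: indicator_def intro!: ennreal_leI\<close>)
    show "emeasure (riem_volume M) (P s) \<le> ennreal (?h z' * (u * s ^ CARD('n)))"
      unfolding e const[OF hz(2), symmetric]
      by (rule nn_integral_mono) (use z'(2) s in \<open>auto simp: indicator_def intro!: ennreal_leI\<close>)
  qed
  have bs: "gball M p r \<in> sets (riem_volume M)" for r by (rule riem_volume_sets) (simp add: gball_open)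
  have Ps: "P s \<in> sets (riem_volume M)" for s by (rule riem_volume_sets[OF Pb(1)])
  show ?thesis
  \<comment> \<open>The radius is limited so that both comparison balls, of radii
    \<open>r / L\<close> and \<open>r / l\<close>, remain in the coordinate ball of radius
    \<open>R\<close>.\<close>
  proof (rule that[of "min (l * R) (L * R)" "?h z * u / L ^ CARD('n)" "?h z' * u / l ^ CARD('n)"])
    fix r assume r: "0 < r" "r \<le> min (l * R) (L * R)"
    have s1: "0 < r / L" "r / L \<le> R" and s2: "0 < r / l" "r / l \<le> R" using r c by (auto simp: field_simps)
    have "P (r / L) \<subseteq> gball M p r"
    proof
      fix q assume q: "q \<in> P (r / L)"
      then have "dist (snd c p) (snd c q) < r / L" by (simp add: P_def)
      then have "snd c q \<in> cball (snd c p) R" using s1(2) by simp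
      moreover have "L * dist (snd c p) (snd c q) < r" "q \<in> fst c"
        using c(5) q by (simp_all add: P_def pos_less_divide_eq mult.commute)
      ultimately have d: "L * dist (snd c p) (snd c q) < r" "q \<in> fst c" "snd c q \<in> cball (snd c p) R" by blast+
      then have "gdist M p q \<le> ennreal (L * dist (snd c p) (snd c q))" using upp by blast
      also have "\<dots> < ennreal r" using d r by (intro ennreal_lessI) auto
      finally show "q \<in> gball M p r" using gdist_sym[of p q] by (simp add: gball_def)
    qed
    have "ennreal (?h z * (u * (r / L) ^ CARD('n))) \<le> emeasure (riem_volume M) (gball M p r)"
      using order.trans[OF vlow[OF s1] emeasure_mono[OF \<open>P (r / L) \<subseteq> gball M p r\<close> bs]] .
    then show "ennreal (?h z * u / L ^ CARD('n) * r ^ CARD('n)) \<le> emeasure (riem_volume M) (gball M p r)"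
      by (simp add: power_divide mult.assoc)
    have "gball M p r \<subseteq> P (r / l)"
    proof (rule ccontr)
      assume "\<not> ?thesis"
      then obtain q where q: "q \<in> gball M p r" "q \<notin> P (r / l)" by blast
      then have "ennreal (l * (r / l)) \<le> gdist M p q" using low s2 unfolding P_def by blast
      then show False using q(1) c(4) gdist_sym[of p q] by (simp add: gball_def)
    qed
    have "emeasure (riem_volume M) (gball M p r) \<le> ennreal (?h z' * (u * (r / l) ^ CARD('n)))"
      using order.trans[OF emeasure_mono[OF \<open>gball M p r \<subseteq> P (r / l)\<close> Ps] vupp[OF s2]] .
    then show "emeasure (riem_volume M) (gball M p r) \<le> ennreal (?h z' * u / l ^ CARD('n) * r ^ CARD('n))"
      by (simp add: power_divide mult.assoc)
  qed (use c hz u in auto)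
qed

end

section \<open>Reversing rectifiable curves\<close>

lemma enn2real_less: "x < ennreal e \<Longrightarrow> enn2real x < e"
  by (cases x) (auto simp: ennreal_less_iff)

context riem_mfd
begin

section \<open>Length as a supremum over partitions\<close>

lemma curve_length_upper:
  "mono_on {..k} \<tau> \<Longrightarrow> \<tau> ` {..k} \<subseteq> I \<Longrightarrow>
    (\<Sum>i<k. gdist M (\<gamma> (\<tau> i)) (\<gamma> (\<tau> (Suc i)))) \<le> curve_length M I \<gamma>"
  unfolding curve_length_def by (rule SUP_upper2[of "(k, \<tau>)"]) auto

lemma curve_length_least:
  assumes "\<And>k \<tau>. mono_on {..k} \<tau> \<Longrightarrow> \<tau> ` {..k} \<subseteq> I \<Longrightarrow>
    (\<Sum>i<k. gdist M (\<gamma> (\<tau> i)) (\<gamma> (\<tau> (Suc i)))) \<le> B"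
  shows "curve_length M I \<gamma> \<le> B"
  unfolding curve_length_def using assms by (intro SUP_least) auto

lemma curve_length_mono: "I \<subseteq> J \<Longrightarrow> curve_length M I \<gamma> \<le> curve_length M J \<gamma>"
  by (rule curve_length_least, rule curve_length_upper) auto

lemma gdist_le_curve_length:
  assumes "s \<le> t" "s \<in> I" "t \<in> I"
  shows "gdist M (\<gamma> s) (\<gamma> t) \<le> curve_length M I \<gamma>"
proof -
  have "(\<Sum>i<Suc 0. gdist M (\<gamma> ((\<lambda>i::nat. if i = 0 then s else t) i)) (\<gamma> ((\<lambda>i::nat. if i = 0 then s else t) (Suc i)))) \<le> curve_length M I \<gamma>"
    by (rule curve_length_upper) (use assms in \<open>auto simp: mono_on_def\<close>)
  then show ?thesis by simp
qed

lemma curve_length_point [simp]: "curve_length M {a..a} \<gamma> = 0"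
proof -
  have "curve_length M {a..a} \<gamma> \<le> 0"
  proof (rule curve_length_least)
    fix k and \<tau> :: "nat \<Rightarrow> real" assume \<tau>: "\<tau> ` {..k} \<subseteq> {a..a}"
    have "\<tau> i = a" if "i \<le> k" for i using \<tau> that by auto
    then show "(\<Sum>i<k. gdist M (\<gamma> (\<tau> i)) (\<gamma> (\<tau> (Suc i)))) \<le> 0" by simp
  qed
  then show ?thesis by simp
qed

lemma curve_length_singleton [simp]: "curve_length M {a} \<gamma> = 0"
  using curve_length_point[of a \<gamma>] by simp

lemma curve_length_cong:
  assumes "\<And>t. t \<in> I \<Longrightarrow> \<gamma> t = \<gamma>' t"
  shows "curve_length M I \<gamma> = curve_length M I \<gamma>'"
proof -
  have "(\<Sum>i<k. gdist M (\<gamma> (\<tau> i)) (\<gamma> (\<tau> (Suc i)))) = (\<Sum>i<k. gdist M (\<gamma>' (\<tau> i)) (\<gamma>' (\<tau> (Suc i))))"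
    if "\<tau> ` {..k} \<subseteq> I" for k and \<tau> :: "nat \<Rightarrow> real"
    by (rule sum.cong) (use that assms in \<open>simp_all add: image_subset_iff\<close>)
  then show ?thesis unfolding curve_length_def by (intro SUP_cong) auto
qed

text \<open>Clamping a partition by \<open>min\<close> and \<open>max\<close> with \<open>b\<close>
  inserts the point \<open>b\<close> without renumbering. Only the step that straddles
  \<open>b\<close> is really split, and there the triangle inequality applies.\<close>

lemma curve_length_split:
  fixes \<tau> :: "nat \<Rightarrow> real"
  assumes \<tau>: "mono_on {..k} \<tau>"
  shows "(\<Sum>i<k. gdist M (\<gamma> (\<tau> i)) (\<gamma> (\<tau> (Suc i))))
    \<le> (\<Sum>i<k. gdist M (\<gamma> (min (\<tau> i) b)) (\<gamma> (min (\<tau> (Suc i)) b)))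
      + (\<Sum>i<k. gdist M (\<gamma> (max (\<tau> i) b)) (\<gamma> (max (\<tau> (Suc i)) b)))"
  unfolding sum.distrib[symmetric]
proof (rule sum_mono)
  fix i assume "i \<in> {..<k}"
  then have le: "\<tau> i \<le> \<tau> (Suc i)" using \<tau> by (auto simp: mono_on_def)
  consider "\<tau> (Suc i) \<le> b" | "b \<le> \<tau> i" | "\<tau> i \<le> b" "b \<le> \<tau> (Suc i)" by linarith
  then show "gdist M (\<gamma> (\<tau> i)) (\<gamma> (\<tau> (Suc i))) \<le> gdist M (\<gamma> (min (\<tau> i) b)) (\<gamma> (min (\<tau> (Suc i)) b))
      + gdist M (\<gamma> (max (\<tau> i) b)) (\<gamma> (max (\<tau> (Suc i)) b))"
  proof cases
    case 1
    then have "\<tau> i \<le> b" using le by simp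
    with 1 show ?thesis by (simp add: min_absorb1 max_absorb2)
  next
    case 2
    then have "b \<le> \<tau> (Suc i)" using le by simp
    with 2 show ?thesis by (simp add: min_absorb2 max_absorb1)
  next
    case 3
    then show ?thesis using gdist_triangle[of "\<gamma> (\<tau> i)" "\<gamma> (\<tau> (Suc i))" "\<gamma> b"]
      by (simp add: min_absorb1 min_absorb2 max_absorb1 max_absorb2)
  qed
qed

lemma curve_length_add:
  assumes "a \<le> b" "b \<le> c"
  shows "curve_length M {a..c} \<gamma> = curve_length M {a..b} \<gamma> + curve_length M {b..c} \<gamma>"
proof (rule antisym)
  show "curve_length M {a..c} \<gamma> \<le> curve_length M {a..b} \<gamma> + curve_length M {b..c} \<gamma>"
  proof (rule curve_length_least)
    fix k and \<tau> :: "nat \<Rightarrow> real" assume \<tau>: "mono_on {..k} \<tau>" "\<tau> ` {..k} \<subseteq> {a..c}"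
    have "(\<Sum>i<k. gdist M (\<gamma> (min (\<tau> i) b)) (\<gamma> (min (\<tau> (Suc i)) b))) \<le> curve_length M {a..b} \<gamma>"
      by (rule curve_length_upper[of k "\<lambda>i. min (\<tau> i) b"]) (use \<tau> assms in \<open>force simp: mono_on_def min_le_iff_disj\<close>)+
    moreover have "(\<Sum>i<k. gdist M (\<gamma> (max (\<tau> i) b)) (\<gamma> (max (\<tau> (Suc i)) b))) \<le> curve_length M {b..c} \<gamma>"
      by (rule curve_length_upper[of k "\<lambda>i. max (\<tau> i) b"]) (use \<tau> assms in \<open>force simp: mono_on_def le_max_iff_disj\<close>)+
    ultimately show "(\<Sum>i<k. gdist M (\<gamma> (\<tau> i)) (\<gamma> (\<tau> (Suc i)))) \<le> curve_length M {a..b} \<gamma> + curve_length M {b..c} \<gamma>"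
      using curve_length_split[OF \<tau>(1), of \<gamma> b] by (meson add_mono order.trans)
  qed
next
  have *: "(\<Sum>i<k1. gdist M (\<gamma> (\<tau>1 i)) (\<gamma> (\<tau>1 (Suc i)))) + (\<Sum>i<k2. gdist M (\<gamma> (\<tau>2 i)) (\<gamma> (\<tau>2 (Suc i)))) \<le> curve_length M {a..c} \<gamma>"
    if 1: "mono_on {..k1} \<tau>1" "\<tau>1 ` {..k1} \<subseteq> {a..b}" and 2: "mono_on {..k2} \<tau>2" "\<tau>2 ` {..k2} \<subseteq> {b..c}"
    for k1 k2 and \<tau>1 \<tau>2 :: "nat \<Rightarrow> real"
  proof -
    \<comment> \<open>Index \<open>Suc k1\<close> carries the first point of the second partition.
      The step from \<open>k1\<close> to \<open>Suc k1\<close> bridges the gap between the two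
      partitions; its contribution is nonnegative and is dropped.\<close>
    define \<tau> where "\<tau> = (\<lambda>i. if i \<le> k1 then \<tau>1 i else \<tau>2 (i - Suc k1))"
    have b1: "\<tau>1 i \<le> b" "a \<le> \<tau>1 i" if "i \<le> k1" for i using 1(2) that by auto
    have b2: "b \<le> \<tau>2 i" "\<tau>2 i \<le> c" if "i \<le> k2" for i using 2(2) that by auto
    have m: "mono_on {..Suc k1 + k2} \<tau>"
    proof (rule mono_onI)
      fix i j assume ij: "i \<in> {..Suc k1 + k2}" "j \<in> {..Suc k1 + k2}" "i \<le> j"
      show "\<tau> i \<le> \<tau> j"
      proof (cases "j \<le> k1")
        case True then show ?thesis using ij 1(1) by (auto simp: \<tau>_def mono_on_def)
      next
        case j: False
        show ?thesis
        proof (cases "i \<le> k1")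
          case True
          then have "\<tau> i \<le> b" using b1 by (simp add: \<tau>_def)
          also have "b \<le> \<tau> j" using j ij b2 by (simp add: \<tau>_def)
          finally show ?thesis .
        next
          case False
          then show ?thesis using mono_onD[OF 2(1), of "i - Suc k1" "j - Suc k1"] j ij by (simp add: \<tau>_def)
        qed
      qed
    qed
    have r: "\<tau> ` {..Suc k1 + k2} \<subseteq> {a..c}"
    proof (rule image_subsetI)
      fix i assume i: "i \<in> {..Suc k1 + k2}"
      show "\<tau> i \<in> {a..c}"
      proof (cases "i \<le> k1")
        case True then show ?thesis using b1[of i] assms by (simp add: \<tau>_def)
      next
        case False
        have "i - Suc k1 \<le> k2" using i by simp
        from b2[OF this] show ?thesis using False assms by (simp add: \<tau>_def)
      qed
    qed
    let ?s = "\<lambda>i. gdist M (\<gamma> (\<tau> i)) (\<gamma> (\<tau> (Suc i)))"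
    have e: "(\<Sum>i<Suc k1 + k2. ?s i) = (\<Sum>i<Suc k1. ?s i) + (\<Sum>i<k2. ?s (Suc k1 + i))"
      by (induction k2) (simp_all add: ac_simps)
    have l1: "(\<Sum>i<k1. gdist M (\<gamma> (\<tau>1 i)) (\<gamma> (\<tau>1 (Suc i)))) \<le> (\<Sum>i<Suc k1. ?s i)"
    proof -
      have "(\<Sum>i<k1. gdist M (\<gamma> (\<tau>1 i)) (\<gamma> (\<tau>1 (Suc i)))) = (\<Sum>i<k1. ?s i)"
        by (rule sum.cong) (auto simp: \<tau>_def)
      then show ?thesis by simp
    qed
    have l2: "(\<Sum>i<k2. gdist M (\<gamma> (\<tau>2 i)) (\<gamma> (\<tau>2 (Suc i)))) = (\<Sum>i<k2. ?s (Suc k1 + i))"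
      by (rule sum.cong) (auto simp: \<tau>_def Suc_diff_le)
    show ?thesis using add_right_mono[OF l1] curve_length_upper[OF m r, of \<gamma>]
      unfolding e l2 by (rule order.trans)
  qed
  show "curve_length M {a..b} \<gamma> + curve_length M {b..c} \<gamma> \<le> curve_length M {a..c} \<gamma>"
  proof -
    let ?P = "\<lambda>I. {(k :: nat, \<tau> :: nat \<Rightarrow> real). mono_on {..k} \<tau> \<and> \<tau> ` {..k} \<subseteq> I}"
    let ?s = "\<lambda>(k, \<tau>). \<Sum>i<k. gdist M (\<gamma> (\<tau> i)) (\<gamma> (\<tau> (Suc i)))"
    have ne: "?P {x..y} \<noteq> {}" if "x \<le> y" for x y :: real
    proof -
      have "(0, \<lambda>_. x) \<in> ?P {x..y}" using that by (auto simp: mono_on_def)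
      then show ?thesis by blast
    qed
    have "curve_length M {a..b} \<gamma> + curve_length M {b..c} \<gamma> = (SUP p\<in>?P {a..b}. ?s p + curve_length M {b..c} \<gamma>)"
      unfolding curve_length_def[of M "{a..b}"] using ne[OF assms(1)] by (subst ennreal_SUP_add_left[symmetric]) auto
    also have "\<dots> \<le> curve_length M {a..c} \<gamma>"
    proof (rule SUP_least)
      fix p assume p: "p \<in> ?P {a..b}"
      have "?s p + curve_length M {b..c} \<gamma> = (SUP q\<in>?P {b..c}. ?s p + ?s q)"
        unfolding curve_length_def[of M "{b..c}"] using ne[OF assms(2)] by (subst ennreal_SUP_add_right[symmetric]) auto
      also have "\<dots> \<le> curve_length M {a..c} \<gamma>"
        using * p by (intro SUP_least) auto
      finally show "?s p + curve_length M {b..c} \<gamma> \<le> curve_length M {a..c} \<gamma>" .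
    qed
    finally show ?thesis .
  qed
qed

lemma curve_length_reflect_le:
  "curve_length M {a..b} (\<lambda>t. \<gamma> (d - t)) \<le> curve_length M {d - b..d - a} \<gamma>"
proof (rule curve_length_least)
  fix k and \<tau> :: "nat \<Rightarrow> real" assume \<tau>: "mono_on {..k} \<tau>" "\<tau> ` {..k} \<subseteq> {a..b}"
  let ?\<sigma> = "\<lambda>i. d - \<tau> (k - i)"
  have "(\<Sum>i<k. gdist M (\<gamma> (d - \<tau> i)) (\<gamma> (d - \<tau> (Suc i))))
      = (\<Sum>i<k. gdist M (\<gamma> (d - \<tau> (k - Suc i))) (\<gamma> (d - \<tau> (Suc (k - Suc i)))))"
    by (rule sum.nat_diff_reindex[symmetric])
  also have "\<dots> = (\<Sum>i<k. gdist M (\<gamma> (?\<sigma> i)) (\<gamma> (?\<sigma> (Suc i))))"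
    by (rule sum.cong) (auto simp: gdist_sym Suc_diff_Suc)
  also have "\<dots> \<le> curve_length M {d - b..d - a} \<gamma>"
    by (rule curve_length_upper[of k ?\<sigma>]) (use \<tau> in \<open>auto simp: mono_on_def image_subset_iff\<close>)
  finally show "(\<Sum>i<k. gdist M (\<gamma> (d - \<tau> i)) (\<gamma> (d - \<tau> (Suc i)))) \<le> curve_length M {d - b..d - a} \<gamma>" .
qed

lemma curve_length_reflect:
  "curve_length M {a..b} (\<lambda>t. \<gamma> (d - t)) = curve_length M {d - b..d - a} \<gamma>"
  using curve_length_reflect_le[of a b \<gamma> d] curve_length_reflect_le[of "d - b" "d - a" "\<lambda>t. \<gamma> (d - t)" d]
  by (simp add: antisym)

section \<open>Continuity of length and reversal of arc length integrals\<close>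

text \<open>A monotone sequence with only two values jumps at most once, so at most one summand is
  nonzero.\<close>

lemma two_valued_sum:
  fixes \<sigma> :: "nat \<Rightarrow> real"
  assumes "mono_on {..k} \<sigma>" "\<sigma> ` {..k} \<subseteq> {s, t}" "s < t"
  shows "(\<Sum>i<k. gdist M (\<gamma> (\<sigma> i)) (\<gamma> (\<sigma> (Suc i)))) \<le> gdist M (\<gamma> s) (\<gamma> (\<sigma> k))"
  using assms
proof (induction k)
  case (Suc k)
  have IH: "(\<Sum>i<k. gdist M (\<gamma> (\<sigma> i)) (\<gamma> (\<sigma> (Suc i)))) \<le> gdist M (\<gamma> s) (\<gamma> (\<sigma> k))"
    by (rule Suc.IH) (use Suc.prems in \<open>auto simp: mono_on_def image_subset_iff\<close>)
  have le: "\<sigma> k \<le> \<sigma> (Suc k)" using Suc.prems(1) by (auto simp: mono_on_def)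
  have v: "\<sigma> k \<in> {s, t}" "\<sigma> (Suc k) \<in> {s, t}" using Suc.prems(2) by (auto simp: image_subset_iff)
  show ?case
  proof (cases "\<sigma> k = s")
    case True
    then show ?thesis using IH by simp
  next
    case False
    then have "\<sigma> k = t" "\<sigma> (Suc k) = t" using v le Suc.prems(3) by auto
    then show ?thesis using IH by simp
  qed
qed simp

lemma gdist_cont_at:
  assumes "continuous (at s within S) \<gamma>" "e > 0"
  shows "eventually (\<lambda>t. gdist M (\<gamma> s) (\<gamma> t) < e) (at s within S)"
proof -
  have "((\<lambda>t. \<gamma> t) \<longlongrightarrow> \<gamma> s) (at s within S)" using assms(1) by (simp add: continuous_within)
  moreover have "open {q. gdist M q (\<gamma> s) < e}" "\<gamma> s \<in> {q. gdist M q (\<gamma> s) < e}"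
    using gdist_open assms(2) by auto
  ultimately have "eventually (\<lambda>t. \<gamma> t \<in> {q. gdist M q (\<gamma> s) < e}) (at s within S)" by (rule topological_tendstoD)
  then show ?thesis by eventually_elim (simp add: gdist_sym)
qed

text \<open>A partition that nearly exhausts the length of the curve on \<open>{s..b}\<close> is
  compared with one that has the additional point \<open>t\<close>. For \<open>t\<close> close to
  \<open>s\<close>, its part before \<open>t\<close> contributes at most the distance from
  \<open>\<gamma> s\<close> to \<open>\<gamma> t\<close>, which is small by continuity; so nearly
  all of the length lies on \<open>{t..b}\<close>.\<close>

lemma curve_length_right_small:
  assumes fin: "curve_length M {s..b} \<gamma> < \<infinity>" and sb: "s < b" and cont: "continuous_on {s..b} \<gamma>" and e: "e > 0"
  shows "\<exists>\<delta>>0. \<forall>t. s \<le> t \<and> t \<le> b \<and> t < s + \<delta> \<longrightarrow> curve_length M {s..t} \<gamma> < ennreal e"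
proof -
  let ?C = "curve_length M {s..b} \<gamma>"
  have "\<exists>k \<tau>. mono_on {..k} (\<tau> :: nat \<Rightarrow> real) \<and> \<tau> ` {..k} \<subseteq> {s..b} \<and>
    ?C < (\<Sum>i<k. gdist M (\<gamma> (\<tau> i)) (\<gamma> (\<tau> (Suc i)))) + ennreal (e / 2)"
  proof (rule ccontr)
    assume neg: "\<not> ?thesis"
    have *: "(\<Sum>i<k. gdist M (\<gamma> (\<tau> i)) (\<gamma> (\<tau> (Suc i)))) + ennreal (e / 2) \<le> ?C"
      if "mono_on {..k} \<tau>" "\<tau> ` {..k} \<subseteq> {s..b}" for k and \<tau> :: "nat \<Rightarrow> real"
      using neg that by (meson not_less)
    have e2: "ennreal (e / 2) \<le> ?C" using *[of 0 "\<lambda>_. s"] sb by (auto simp: mono_on_def)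
    \<comment> \<open>Without such a partition every sum is smaller than the supremum by at least
      \<open>e / 2\<close>. This contradicts finiteness of the supremum, which is at least
      \<open>e / 2\<close> by the trivial partition, so that the subtraction is not
      truncated.\<close>
    have "?C \<le> ?C - ennreal (e / 2)"
    proof (rule curve_length_least)
      fix k and \<tau> :: "nat \<Rightarrow> real" assume "mono_on {..k} \<tau>" "\<tau> ` {..k} \<subseteq> {s..b}"
      from *[OF this] show "(\<Sum>i<k. gdist M (\<gamma> (\<tau> i)) (\<gamma> (\<tau> (Suc i)))) \<le> ?C - ennreal (e / 2)"
        by (simp add: ennreal_le_minus_iff add.commute)
    qed
    moreover obtain c where c: "?C = ennreal c" "0 \<le> c" using fin by (cases ?C) auto
    ultimately have "ennreal c \<le> ennreal (c - e / 2)" using e by (simp add: ennreal_minus)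
    then show False using e2 e c by (auto simp: ennreal_le_iff2)
  qed
  then obtain k and \<tau> :: "nat \<Rightarrow> real" where \<tau>: "mono_on {..k} \<tau>" "\<tau> ` {..k} \<subseteq> {s..b}"
    "?C < (\<Sum>i<k. gdist M (\<gamma> (\<tau> i)) (\<gamma> (\<tau> (Suc i)))) + ennreal (e / 2)" by blast
  have "eventually (\<lambda>t. gdist M (\<gamma> s) (\<gamma> t) < ennreal (e / 2)) (at s within {s..b})"
    using cont sb e by (intro gdist_cont_at) (auto simp: continuous_on_eq_continuous_within)
  then obtain \<delta>1 where \<delta>1: "\<delta>1 > 0" "\<And>t. t \<in> {s..b} \<Longrightarrow> t \<noteq> s \<Longrightarrow> dist t s < \<delta>1 \<Longrightarrow> gdist M (\<gamma> s) (\<gamma> t) < ennreal (e / 2)"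
    unfolding eventually_at by blast
  define T where "T = {\<tau> i | i. i \<le> k \<and> s < \<tau> i}"
  have "T \<subseteq> \<tau> ` {..k}" by (auto simp: T_def)
  then have fT: "finite T" by (rule finite_subset) simp
  \<comment> \<open>Below \<open>m\<close> there is no partition point strictly between
    \<open>s\<close> and \<open>t\<close>, so clamping the partition at \<open>t\<close> leaves only
    the values \<open>s\<close> and \<open>t\<close>; moreover \<open>t\<close> is within
    \<open>\<delta>1\<close> of \<open>s\<close>.\<close>
  define m where "m = Min (insert (s + \<delta>1) T)"
  have m: "s < m" "m \<le> s + \<delta>1" "\<And>i. i \<le> k \<Longrightarrow> s < \<tau> i \<Longrightarrow> m \<le> \<tau> i"
  proof -
    show "s < m" unfolding m_def using fT \<delta>1 by (subst Min_gr_iff) (auto simp: T_def)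
    show "m \<le> s + \<delta>1" unfolding m_def using fT by (intro Min_le) auto
    show "m \<le> \<tau> i" if "i \<le> k" "s < \<tau> i" for i
      unfolding m_def using fT that by (intro Min_le) (auto simp: T_def)
  qed
  have main: "curve_length M {s..t} \<gamma> < ennreal e" if t: "s \<le> t" "t \<le> b" "t < m" for t
  proof (cases "t = s")
    case False
    then have st: "s < t" using t by simp
    have g: "gdist M (\<gamma> s) (\<gamma> t) < ennreal (e / 2)" using \<delta>1(2)[of t] t st m(2) by (auto simp: dist_real_def)
    have two: "min (\<tau> i) t \<in> {s, t}" if "i \<le> k" for i
    proof (cases "s < \<tau> i")
      case True then show ?thesis using m(3)[OF that True] t by (auto simp: min_def)
    next
      case False
      moreover have "s \<le> \<tau> i" using \<tau>(2) that by auto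
      ultimately show ?thesis using st by (auto simp: min_def)
    qed
    have mono: "mono_on {..k} (\<lambda>i. min (\<tau> i) t)" using \<tau>(1) by (auto simp: mono_on_def min_le_iff_disj)
    have "(\<Sum>i<k. gdist M (\<gamma> (min (\<tau> i) t)) (\<gamma> (min (\<tau> (Suc i)) t))) \<le> gdist M (\<gamma> s) (\<gamma> (min (\<tau> k) t))"
      by (rule two_valued_sum[OF mono _ st]) (use two in auto)
    also have "\<dots> \<le> gdist M (\<gamma> s) (\<gamma> t)" using two[of k] by auto
    finally have 1: "(\<Sum>i<k. gdist M (\<gamma> (min (\<tau> i) t)) (\<gamma> (min (\<tau> (Suc i)) t))) \<le> gdist M (\<gamma> s) (\<gamma> t)" .
    have 2: "(\<Sum>i<k. gdist M (\<gamma> (max (\<tau> i) t)) (\<gamma> (max (\<tau> (Suc i)) t))) \<le> curve_length M {t..b} \<gamma>"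
      by (rule curve_length_upper[of k "\<lambda>i. max (\<tau> i) t"]) (use \<tau> t in \<open>force simp: mono_on_def le_max_iff_disj\<close>)+
    have add: "?C = curve_length M {s..t} \<gamma> + curve_length M {t..b} \<gamma>" by (rule curve_length_add) (use t in auto)
    have "(\<Sum>i<k. gdist M (\<gamma> (\<tau> i)) (\<gamma> (\<tau> (Suc i)))) \<le> gdist M (\<gamma> s) (\<gamma> t) + curve_length M {t..b} \<gamma>"
      using curve_length_split[OF \<tau>(1), of \<gamma> t] 1 2 by (meson add_mono order.trans)
    then have "?C < (gdist M (\<gamma> s) (\<gamma> t) + curve_length M {t..b} \<gamma>) + ennreal (e / 2)"
      using \<tau>(3) by (meson add_right_mono less_le_trans)
    also have "\<dots> \<le> (ennreal (e / 2) + curve_length M {t..b} \<gamma>) + ennreal (e / 2)"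
      using g by (intro add_mono) auto
    also have "\<dots> = curve_length M {t..b} \<gamma> + (ennreal (e / 2) + ennreal (e / 2))" by (simp add: ac_simps)
    also have "ennreal (e / 2) + ennreal (e / 2) = ennreal e" using e by (subst ennreal_plus[symmetric]) auto
    finally have "curve_length M {t..b} \<gamma> + curve_length M {s..t} \<gamma> < curve_length M {t..b} \<gamma> + ennreal e"
      unfolding add by (simp add: add.commute)
    then show ?thesis by (simp add: ennreal_add_left_cancel_less)
  qed (use e in simp)
  show ?thesis using main m(1) by (intro exI[of _ "m - s"]) auto
qed

lemma curve_length_left_small:
  assumes fin: "curve_length M {a..s} \<gamma> < \<infinity>" and as: "a < s" and cont: "continuous_on {a..s} \<gamma>" and e: "e > 0"
  shows "\<exists>\<delta>>0. \<forall>t. a \<le> t \<and> t \<le> s \<and> s - \<delta> < t \<longrightarrow> curve_length M {t..s} \<gamma> < ennreal e"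
proof -
  have c: "continuous_on {- s.. - a} (\<lambda>t. \<gamma> (0 - t))"
    by (rule continuous_on_compose2[OF cont]) (auto intro!: continuous_intros)
  have f: "curve_length M {- s.. - a} (\<lambda>t. \<gamma> (0 - t)) < \<infinity>"
    using fin by (simp only: curve_length_reflect) simp
  obtain \<delta> where \<delta>: "\<delta> > 0" "\<And>t. - s \<le> t \<and> t \<le> - a \<and> t < - s + \<delta> \<Longrightarrow> curve_length M {- s..t} (\<lambda>t. \<gamma> (0 - t)) < ennreal e"
    using curve_length_right_small[OF f _ c e] as by auto
  have "curve_length M {t..s} \<gamma> < ennreal e" if "a \<le> t" "t \<le> s" "s - \<delta> < t" for t
    using \<delta>(2)[of "- t"] that by (simp only: curve_length_reflect) simp
  then show ?thesis using \<delta>(1) by blast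
qed

text \<open>The length of initial pieces is continuous because short pieces on either side are short
  in length, so it takes all intermediate values. Hence the choice in \<open>arc_integral_on\<close>
  is always from a nonempty set.\<close>

lemma curve_length_attains:
  assumes fin: "curve_length M {a..b} \<gamma> < \<infinity>" and ab: "a \<le> b" and cont: "continuous_on {a..b} \<gamma>"
    and s: "0 \<le> s" "ennreal s \<le> curve_length M {a..b} \<gamma>"
  shows "\<exists>t\<in>{a..b}. curve_length M {a..t} \<gamma> = ennreal s"
proof -
  have f: "curve_length M {x..y} \<gamma> < \<infinity>" if "a \<le> x" "y \<le> b" for x y
    using curve_length_mono[of "{x..y}" "{a..b}" \<gamma>] that fin by (auto intro: le_less_trans)
  define r where "r = (\<lambda>t. enn2real (curve_length M {a..t} \<gamma>))"
  have er: "ennreal (r t) = curve_length M {a..t} \<gamma>" if "t \<in> {a..b}" for t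
    using f[of a t] that by (simp add: r_def)
  have diff: "r v - r u = enn2real (curve_length M {u..v} \<gamma>)" if "a \<le> u" "u \<le> v" "v \<le> b" for u v
    using curve_length_add[of a u v \<gamma>] that f[of a u] f[of u v] by (simp add: r_def enn2real_plus)
  have "continuous_on {a..b} r"
    unfolding continuous_on_iff
  proof (intro ballI allI impI)
    fix u e :: real assume u: "u \<in> {a..b}" and e: "e > 0"
    obtain \<delta>1 where d1: "\<delta>1 > 0" "\<And>t. u \<le> t \<Longrightarrow> t \<le> b \<Longrightarrow> t < u + \<delta>1 \<Longrightarrow> curve_length M {u..t} \<gamma> < ennreal e"
    proof (cases "u = b")
      case True
      then show ?thesis using that[of 1] e by (auto simp: antisym)
    next
      case False
      have cu: "continuous_on {u..b} \<gamma>" using cont by (rule continuous_on_subset) (use u in auto)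
      have "\<exists>\<delta>>0. \<forall>t. u \<le> t \<and> t \<le> b \<and> t < u + \<delta> \<longrightarrow> curve_length M {u..t} \<gamma> < ennreal e"
        by (rule curve_length_right_small[OF _ _ cu e]) (use f[of u b] u False in auto)
      then show ?thesis using that by blast
    qed
    obtain \<delta>2 where d2: "\<delta>2 > 0" "\<And>t. a \<le> t \<Longrightarrow> t \<le> u \<Longrightarrow> u - \<delta>2 < t \<Longrightarrow> curve_length M {t..u} \<gamma> < ennreal e"
    proof (cases "u = a")
      case True
      then show ?thesis using that[of 1] e by (auto simp: antisym)
    next
      case False
      have cu: "continuous_on {a..u} \<gamma>" using cont by (rule continuous_on_subset) (use u in auto)
      have "\<exists>\<delta>>0. \<forall>t. a \<le> t \<and> t \<le> u \<and> u - \<delta> < t \<longrightarrow> curve_length M {t..u} \<gamma> < ennreal e"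
        by (rule curve_length_left_small[OF _ _ cu e]) (use f[of a u] u False in auto)
      then show ?thesis using that by blast
    qed
    show "\<exists>d>0. \<forall>t\<in>{a..b}. dist t u < d \<longrightarrow> dist (r t) (r u) < e"
    proof (intro exI[of _ "min \<delta>1 \<delta>2"] conjI ballI impI)
      fix t assume t: "t \<in> {a..b}" "dist t u < min \<delta>1 \<delta>2"
      show "dist (r t) (r u) < e"
      proof (cases "u \<le> t")
        case True
        have "curve_length M {u..t} \<gamma> < ennreal e" using d1(2)[of t] True t by (auto simp: dist_real_def)
        then have "enn2real (curve_length M {u..t} \<gamma>) < e" by (rule enn2real_less)
        moreover have "r t - r u = enn2real (curve_length M {u..t} \<gamma>)" by (rule diff) (use t u True in auto)
        moreover have "0 \<le> enn2real (curve_length M {u..t} \<gamma>)" by simp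
        ultimately show ?thesis unfolding dist_real_def by linarith
      next
        case False
        have "curve_length M {t..u} \<gamma> < ennreal e" using d2(2)[of t] False t by (auto simp: dist_real_def)
        then have "enn2real (curve_length M {t..u} \<gamma>) < e" by (rule enn2real_less)
        moreover have "r u - r t = enn2real (curve_length M {t..u} \<gamma>)" by (rule diff) (use t u False in auto)
        moreover have "0 \<le> enn2real (curve_length M {t..u} \<gamma>)" by simp
        ultimately show ?thesis unfolding dist_real_def by linarith
      qed
    qed (simp_all add: d1(1) d2(1))
  qed
  moreover have "r a \<le> s" using s by (simp add: r_def)
  moreover have "s \<le> r b"
  proof -
    have "ennreal s \<le> ennreal (r b)" using s(2) er[of b] ab by simp
    moreover have "0 \<le> r b" by (simp add: r_def)
    ultimately show ?thesis by (simp add: ennreal_le_iff)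
  qed
  ultimately obtain t where "a \<le> t" "t \<le> b" "r t = s" using IVT'[of r a s b] ab by blast
  then show ?thesis using er[of t] by (intro bexI[of _ t]) auto
qed

text \<open>Between two parameters with the same length of the initial piece the curve has length
  zero and therefore does not move. Thus the choice in \<open>arc_integral_on\<close> does not
  affect the integrand.\<close>

lemma same_length_same_point:
  assumes fin: "curve_length M {a..b} \<gamma> < \<infinity>" and t: "t \<in> {a..b}" "u \<in> {a..b}"
    and e: "curve_length M {a..t} \<gamma> = curve_length M {a..u} \<gamma>"
  shows "\<gamma> t = \<gamma> u"
proof -
  have *: "\<gamma> t = \<gamma> u" if "t \<le> u" "t \<in> {a..b}" "u \<in> {a..b}" "curve_length M {a..t} \<gamma> = curve_length M {a..u} \<gamma>" for t u
  proof -
    have "curve_length M {a..t} \<gamma> + curve_length M {t..u} \<gamma> = curve_length M {a..t} \<gamma> + 0"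
      using curve_length_add[of a t u \<gamma>] that by simp
    moreover have "curve_length M {a..t} \<gamma> < top"
      using curve_length_mono[of "{a..t}" "{a..b}" \<gamma>] that fin by (auto intro: le_less_trans)
    ultimately have "curve_length M {t..u} \<gamma> = 0" by (auto simp: ennreal_add_left_cancel)
    then have "gdist M (\<gamma> t) (\<gamma> u) = 0" using gdist_le_curve_length[of t u "{t..u}" \<gamma>] that by simp
    then show ?thesis by (rule gdist_zero)
  qed
  show ?thesis
  proof (cases "t \<le> u")
    case True
    show ?thesis by (rule *[OF True t e])
  next
    case False
    then have "u \<le> t" by simp
    from *[OF this t(2,1) e[symmetric]] show ?thesis by simp
  qed
qed

text \<open>The point at arc length \<open>s\<close> on the reversed curve is the point at arc
  length \<open>L - s\<close> on the original one, so the two integrands are reflections of each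
  other. The curves are compared only on the parameter interval because a lifted path is controlled
  only there.\<close>

lemma arc_integral_on_reverse:
  assumes fin: "curve_length M {a..b} \<gamma> < \<infinity>" and ab: "a \<le> b" and cont: "continuous_on {a..b} \<gamma>"
    and rev: "\<And>u. u \<in> {d - b..d - a} \<Longrightarrow> \<gamma>' u = \<gamma> (d - u)"
  shows "arc_integral_on M (d - b) (d - a) \<gamma>' \<rho> = arc_integral_on M a b \<gamma> \<rho>"
proof -
  have cl': "curve_length M {d - b..t} \<gamma>' = curve_length M {d - t..b} \<gamma>" if "t \<le> d - a" for t
  proof -
    have "curve_length M {d - b..t} \<gamma>' = curve_length M {d - b..t} (\<lambda>t. \<gamma> (d - t))"
      by (rule curve_length_cong) (use rev that in auto)
    then show ?thesis by (simp only: curve_length_reflect) simp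
  qed
  define L where "L = enn2real (curve_length M {a..b} \<gamma>)"
  have L: "ennreal L = curve_length M {a..b} \<gamma>" "0 \<le> L" using fin by (simp_all add: L_def)
  have L': "enn2real (curve_length M {d - b..d - a} \<gamma>') = L" using cl'[of "d - a"] by (simp add: L_def)
  let ?P = "\<lambda>s. SOME t. t \<in> {a..b} \<and> curve_length M {a..t} \<gamma> = ennreal s"
  let ?P' = "\<lambda>s. SOME t. t \<in> {d - b..d - a} \<and> curve_length M {d - b..t} \<gamma>' = ennreal s"
  have eq: "\<gamma>' (?P' s) = \<gamma> (?P (L - s))" if s: "0 \<le> s" "s \<le> L" for s
  proof -
    have ex: "\<exists>t\<in>{a..b}. curve_length M {a..t} \<gamma> = ennreal (L - s)"
      by (rule curve_length_attains[OF fin ab cont]) (use s L in \<open>auto simp: L(1)[symmetric] intro: ennreal_leI\<close>)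
    then obtain t where t: "t \<in> {a..b}" "curve_length M {a..t} \<gamma> = ennreal (L - s)" by blast
    have fs: "curve_length M {x..y} \<gamma> < top" if "a \<le> x" "y \<le> b" for x y
      using curve_length_mono[of "{x..y}" "{a..b}" \<gamma>] that fin by (auto intro: le_less_trans)
    have "ennreal (L - s) + curve_length M {t..b} \<gamma> = ennreal (L - s) + ennreal s"
      using curve_length_add[of a t b \<gamma>] t s L by (simp add: ennreal_plus[symmetric] del: ennreal_plus)
    then have "curve_length M {t..b} \<gamma> = ennreal s" by (simp add: ennreal_add_left_cancel)
    then have "curve_length M {d - b..d - t} \<gamma>' = ennreal s" using cl'[of "d - t"] t by simp
    then have ex': "\<exists>t. t \<in> {d - b..d - a} \<and> curve_length M {d - b..t} \<gamma>' = ennreal s"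
      using t by (intro exI[of _ "d - t"]) auto
    define t' where "t' = ?P' s"
    have t': "t' \<in> {d - b..d - a}" "curve_length M {d - b..t'} \<gamma>' = ennreal s"
      using someI_ex[OF ex'] unfolding t'_def by auto
    define p where "p = ?P (L - s)"
    have p: "p \<in> {a..b}" "curve_length M {a..p} \<gamma> = ennreal (L - s)"
      using someI_ex[of "\<lambda>t. t \<in> {a..b} \<and> curve_length M {a..t} \<gamma> = ennreal (L - s)"] ex unfolding p_def by blast+
    let ?u = "d - t'"
    have u: "?u \<in> {a..b}" using t' by auto
    have "curve_length M {?u..b} \<gamma> = ennreal s" using cl'[of t'] t' by simp
    then have "curve_length M {a..?u} \<gamma> + ennreal s = ennreal (L - s) + ennreal s"
      using curve_length_add[of a ?u b \<gamma>] u s L by (simp add: ennreal_plus[symmetric] del: ennreal_plus)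
    then have "ennreal s + curve_length M {a..?u} \<gamma> = ennreal s + ennreal (L - s)" by (simp only: add.commute)
    then have "curve_length M {a..?u} \<gamma> = ennreal (L - s)" by (simp only: ennreal_add_left_cancel) simp
    then have "\<gamma> ?u = \<gamma> p" using same_length_same_point[OF fin u p(1)] p(2) by simp
    then show ?thesis using rev[OF t'(1)] unfolding t'_def p_def by simp
  qed
  have "arc_integral_on M (d - b) (d - a) \<gamma>' \<rho>
    = (\<integral>\<^sup>+s. (\<lambda>s. \<rho> (\<gamma> (?P s)) * indicator {0..L} s) (L - s) \<partial>lborel)"
    unfolding arc_integral_on_def L'
  proof (rule nn_integral_cong)
    fix s
    show "\<rho> (\<gamma>' (?P' s)) * indicator {0..L} s = \<rho> (\<gamma> (?P (L - s))) * indicator {0..L} (L - s)"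
    proof (cases "0 \<le> s \<and> s \<le> L")
      case True
      then have "indicator {0..L} s = (1::ennreal)" "indicator {0..L} (L - s) = (1::ennreal)" by auto
      then show ?thesis using eq[of s] True by (simp only:)
    next
      case False
      then have "indicator {0..L} s = (0::ennreal)" "indicator {0..L} (L - s) = (0::ennreal)" by auto
      then show ?thesis by (simp only: mult_zero_right)
    qed
  qed
  also have "\<dots> = arc_integral_on M a b \<gamma> \<rho>"
    unfolding arc_integral_on_def L_def[symmetric] by (rule nn_integral_reflect)
  finally show ?thesis .
qed

lemma reverse_curve:
  assumes rect: "locally_rectifiable M ({s..t}, \<gamma>)" and cont: "continuous_on {s..t} \<gamma>"
    and rev: "\<And>u. u \<in> {s..t} \<Longrightarrow> \<gamma>' u = \<gamma> (s + t - u)"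
  shows "locally_rectifiable M ({s..t}, \<gamma>')" "arc_integral M ({s..t}, \<gamma>') \<rho> \<le> arc_integral M ({s..t}, \<gamma>) \<rho>"
proof -
  let ?d = "s + t"
  have sub: "{?d - b..?d - a} \<subseteq> {s..t}" "?d - b \<le> ?d - a" if "a \<le> b" "{a..b} \<subseteq> {s..t}" for a b
    using that by auto
  have f: "curve_length M {a..b} \<gamma> < \<infinity>" if "a \<le> b" "{a..b} \<subseteq> {s..t}" for a b
    using rect that by (simp add: locally_rectifiable_def)
  show "locally_rectifiable M ({s..t}, \<gamma>')"
    unfolding locally_rectifiable_def
  proof (intro allI impI)
    fix a b assume "a \<le> b \<and> {a..b} \<subseteq> fst ({s..t}, \<gamma>')"
    then have ab: "a \<le> b" "{a..b} \<subseteq> {s..t}" by auto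
    have "curve_length M {a..b} \<gamma>' = curve_length M {a..b} (\<lambda>u. \<gamma> (?d - u))"
      by (rule curve_length_cong) (use rev ab in auto)
    then show "curve_length M {a..b} (snd ({s..t}, \<gamma>')) < \<infinity>"
      using f[OF sub(2,1)[OF ab]] by (simp only: curve_length_reflect snd_conv)
  qed
  show "arc_integral M ({s..t}, \<gamma>') \<rho> \<le> arc_integral M ({s..t}, \<gamma>) \<rho>"
    unfolding arc_integral_def
  proof (rule SUP_mono)
    fix p assume "p \<in> {(a, b). a \<le> b \<and> {a..b} \<subseteq> fst ({s..t}, \<gamma>')}"
    then obtain a b where p: "p = (a, b)" and ab: "a \<le> b" "{a..b} \<subseteq> {s..t}" by auto
    note s = sub(2,1)[OF ab]
    have "arc_integral_on M (?d - (?d - a)) (?d - (?d - b)) \<gamma>' \<rho> = arc_integral_on M (?d - b) (?d - a) \<gamma> \<rho>"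
      by (rule arc_integral_on_reverse[OF f[OF s] s(1) continuous_on_subset[OF cont s(2)]]) (use rev ab in auto)
    then show "\<exists>q\<in>{(a, b). a \<le> b \<and> {a..b} \<subseteq> fst ({s..t}, \<gamma>)}.
       (case p of (a, b) \<Rightarrow> arc_integral_on M a b (snd ({s..t}, \<gamma>')) \<rho>)
         \<le> (case q of (a, b) \<Rightarrow> arc_integral_on M a b (snd ({s..t}, \<gamma>)) \<rho>)"
      using s p by (intro bexI[of _ "(?d - b, ?d - a)"]) auto
  qed
qed

end

section \<open>Lifting of paths\<close>

text \<open>By Tychonoff's theorem the sequence has a cluster point in the product of copies of
  \<open>K\<close>. The index set will be an interval of parameters, too large for pointwise
  convergent subsequences; clustering at two indices at a time is enough for the later use.\<close>

lemma cluster_function: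
  fixes A :: "nat \<Rightarrow> 'i \<Rightarrow> 'a::topological_space"
  assumes K: "compact K" and A: "\<And>n i. A n i \<in> K"
  obtains \<alpha> where "\<And>i. \<alpha> i \<in> K"
    "\<And>i j U V N. open U \<Longrightarrow> open V \<Longrightarrow> \<alpha> i \<in> U \<Longrightarrow> \<alpha> j \<in> V \<Longrightarrow> \<exists>n\<ge>N. A n i \<in> U \<and> A n j \<in> V"
proof -
  have "compactin (product_topology (\<lambda>i::'i. euclidean :: 'a topology) UNIV) (PiE UNIV (\<lambda>_. K))"
    using K by (subst compactin_PiE) simp
  then have "compact (PiE UNIV (\<lambda>_::'i. K))" by (simp add: euclidean_product_topology)
  moreover have "eventually (\<lambda>x. x \<in> PiE UNIV (\<lambda>_::'i. K)) (filtermap A sequentially)"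
    unfolding eventually_filtermap using A by (intro always_eventually) auto
  moreover have "filtermap A sequentially \<noteq> bot" by (simp add: filtermap_bot_iff)
  ultimately obtain \<alpha> where \<alpha>: "\<alpha> \<in> PiE UNIV (\<lambda>_. K)" "inf (nhds \<alpha>) (filtermap A sequentially) \<noteq> bot"
    unfolding compact_filter by blast
  have ex: "\<exists>n\<ge>N. A n i \<in> U \<and> A n j \<in> V" if "open U" "open V" "\<alpha> i \<in> U" "\<alpha> j \<in> V" for i j U V N
  proof (rule ccontr)
    assume neg: "\<not> ?thesis"
    let ?W = "((\<lambda>h. h i) -` U) \<inter> ((\<lambda>h. h j) -` V)"
    have "open ?W" using that continuous_on_product_coordinates[of UNIV] by (intro open_Int open_vimage) auto
    then have "eventually (\<lambda>h. h \<in> ?W) (nhds \<alpha>)" using that by (intro eventually_nhds_in_open) auto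
    moreover have "eventually (\<lambda>h. h \<notin> ?W) (filtermap A sequentially)"
      unfolding eventually_filtermap eventually_sequentially using neg by auto
    ultimately have "eventually (\<lambda>_. False) (inf (nhds \<alpha>) (filtermap A sequentially))"
      unfolding eventually_inf by blast
    then show False using \<alpha>(2) by (simp add: trivial_limit_def)
  qed
  have "\<alpha> i \<in> K" for i using PiE_mem[OF \<alpha>(1), of i] by simp
  then show ?thesis by (rule that) (rule ex)
qed

context riem_mfd
begin

lemma gdist_closed: "open {x. gdist M x x0 > e}"
proof (subst open_subopen, intro ballI)
  fix x assume "x \<in> {x. gdist M x x0 > e}"
  then have "e < gdist M x x0" by simp
  then obtain e' where e': "e < e'" "e' < gdist M x x0" using dense by blast
  then have "0 < e' - e" by (simp add: diff_gr0_ennreal)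
  from gdist_near[OF this, of x] obtain W where W: "open W" "x \<in> W" "\<forall>q\<in>W. gdist M q x < e' - e"
    unfolding eventually_nhds by blast
  have "e < gdist M q x0" if "q \<in> W" for q
  proof (rule ccontr)
    assume neg: "\<not> ?thesis"
    have "gdist M x x0 \<le> gdist M x q + gdist M q x0" by (rule gdist_triangle)
    also have "\<dots> \<le> (e' - e) + e" using W(3) that neg by (intro add_mono) (auto simp: gdist_sym less_imp_le)
    also have "\<dots> = e'" using e' by (simp add: diff_add_cancel_ennreal less_imp_le)
    finally show False using e' by simp
  qed
  then show "\<exists>T. open T \<and> x \<in> T \<and> T \<subseteq> {x. gdist M x x0 > e}" using W by blast
qed

end

text \<open>Compactness is demanded only for the preimage of the trace of \<open>\<beta>\<close>. It
  prevents a lift from escaping to the boundary of \<open>D\<close> before the end of the parameter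
  interval.\<close>

locale lifting = riem_mfd M for M :: "('a::{t2_space, second_countable_topology}, 'n::finite) riem" +
  fixes D :: "'a set" and f :: "'a \<Rightarrow> 'b::t2_space" and \<beta> :: "real \<Rightarrow> 'b" and s t :: real
  assumes oD: "open D" and cf: "continuous_on D f" and om: "open_mapping_on D f" and dm: "discrete_mapping_on D f"
    and st: "s < t" and cb: "continuous_on {s..t} \<beta>"
    and proper: "compact {x \<in> D. f x \<in> \<beta> ` {s..t}}" and onto: "\<beta> ` {s..t} \<subseteq> f ` D"
begin

definition K where "K = {x \<in> D. f x \<in> \<beta> ` {s..t}}"

lemma K_facts: "compact K" "K \<subseteq> D" "closed K"
  using proper compact_imp_closed by (auto simp: K_def)

text \<open>Openness at a single point already provides nearby preimages for nearby parameters.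
  Uniformity comes from compactness: counterexamples with step sizes tending to 0 would accumulate
  at some \<open>x\<close> over \<open>\<beta> v\<close>, whereas the image of a small ball about
  \<open>x\<close> is a neighbourhood of \<open>\<beta> v\<close>.\<close>

lemma uniformly_open:
  assumes e: "(e::ennreal) > 0"
  shows "\<exists>\<delta>>0. \<forall>p\<in>K. \<forall>u\<in>{s..t}. \<forall>u'\<in>{s..t}. f p = \<beta> u \<and> \<bar>u - u'\<bar> < \<delta> \<longrightarrow>
     (\<exists>p'\<in>K. f p' = \<beta> u' \<and> gdist M p p' < e)"
proof (rule ccontr)
  assume neg: "\<not> ?thesis"
  define bad where "bad = (\<lambda>(n::nat) p u u'. p \<in> K \<and> u \<in> {s..t} \<and> u' \<in> {s..t} \<and> f p = \<beta> u \<and> \<bar>u - u'\<bar> < inverse (real (Suc n)) \<and>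
     \<not> (\<exists>p'\<in>K. f p' = \<beta> u' \<and> gdist M p p' < e))"
  have "\<exists>p u u'. bad n p u u'" for n
  proof -
    have "0 < inverse (real (Suc n))" by simp
    then show ?thesis using neg unfolding bad_def by blast
  qed
  then obtain p u u' where b: "\<And>n. bad n (p n) (u n) (u' n)" by metis
  obtain x r where r: "x \<in> K" "strict_mono r" "(p \<circ> r) \<longlonglongrightarrow> x"
    using compact_imp_seq_compact[OF K_facts(1)] b unfolding seq_compact_def bad_def by (metis (mono_tags, lifting))
  have "\<forall>n. (u \<circ> r) n \<in> {s..t}" using b by (auto simp: bad_def)
  then obtain v q where q: "v \<in> {s..t}" "strict_mono q" "(u \<circ> r \<circ> q) \<longlonglongrightarrow> v"
    using compact_imp_seq_compact[OF compact_Icc[of s t]] unfolding seq_compact_def by metis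
  define h where "h = r \<circ> q"
  have h: "strict_mono h" using r q by (simp add: h_def strict_mono_o)
  have ph: "(\<lambda>n. p (h n)) \<longlonglongrightarrow> x" using LIMSEQ_subseq_LIMSEQ[OF r(3) q(2)] by (simp add: h_def o_def)
  have uh: "(\<lambda>n. u (h n)) \<longlonglongrightarrow> v" using q(3) by (simp add: h_def o_def)
  have "(\<lambda>n. u (h n) - u' (h n)) \<longlonglongrightarrow> 0"
  proof (rule Lim_null_comparison)
    have "(\<lambda>n. inverse (real (Suc n))) \<longlonglongrightarrow> 0" by (rule LIMSEQ_inverse_real_of_nat)
    from LIMSEQ_subseq_LIMSEQ[OF this h] show "(\<lambda>n. inverse (real (Suc (h n)))) \<longlonglongrightarrow> 0" by (simp add: o_def)
    show "eventually (\<lambda>n. norm (u (h n) - u' (h n)) \<le> inverse (real (Suc (h n)))) sequentially"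
      using b by (intro always_eventually) (auto simp: bad_def less_imp_le)
  qed
  from tendsto_diff[OF uh this] have u'h: "(\<lambda>n. u' (h n)) \<longlonglongrightarrow> v" by simp
  have pD: "p n \<in> D" for n using b[of n] K_facts(2) by (auto simp: bad_def)
  have lim_b: "(\<lambda>n. \<beta> (w n)) \<longlonglongrightarrow> \<beta> v" if "w \<longlonglongrightarrow> v" "\<And>n. w n \<in> {s..t}" for w
    using continuous_on_tendsto_compose[OF cb that(1) q(1)] that(2) by auto
  have "(\<lambda>n. f (p (h n))) \<longlonglongrightarrow> f x"
    using continuous_on_tendsto_compose[OF cf ph] r(1) K_facts(2) pD by auto
  moreover have "(\<lambda>n. f (p (h n))) \<longlonglongrightarrow> \<beta> v" using lim_b[OF uh] b by (simp add: bad_def)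
  ultimately have fx: "f x = \<beta> v" by (rule LIMSEQ_unique)
  \<comment> \<open>Both the offending point and the new preimage will lie within \<open>e2\<close>
    of \<open>x\<close>, hence within \<open>e\<close> of each other.\<close>
  obtain e2 where e2: "0 < e2" "e2 + e2 \<le> e"
  proof (cases e)
    case (real c)
    then show ?thesis using that[of "ennreal (c / 2)"] e by (simp add: ennreal_plus[symmetric] del: ennreal_plus)
  qed (use that[of 1] in auto)
  let ?B = "{y. gdist M y x < e2} \<inter> D"
  have "open (f ` ?B)" using om gdist_open oD by (auto simp: open_mapping_on_def open_Int)
  moreover have "\<beta> v \<in> f ` ?B" using fx[symmetric] r(1) K_facts(2) e2 by auto
  ultimately have "eventually (\<lambda>n. \<beta> (u' (h n)) \<in> f ` ?B) sequentially"
    using lim_b[OF u'h] b by (intro topological_tendstoD) (auto simp: bad_def)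
  moreover have "eventually (\<lambda>n. p (h n) \<in> {y. gdist M y x < e2}) sequentially"
    using ph gdist_open e2 by (intro topological_tendstoD) auto
  ultimately have "eventually (\<lambda>n. False) sequentially"
  proof eventually_elim
    case (elim n)
    then obtain y where y: "y \<in> D" "f y = \<beta> (u' (h n))" "gdist M y x < e2" by auto
    have "gdist M (p (h n)) y \<le> gdist M (p (h n)) x + gdist M x y" by (rule gdist_triangle)
    also have "\<dots> < e2 + e2" using elim y by (intro add_strict_mono) (auto simp: gdist_sym)
    also have "\<dots> \<le> e" by (rule e2)
    finally have "gdist M (p (h n)) y < e" .
    moreover have "y \<in> K" using y b[of "h n"] by (auto simp: K_def bad_def)
    ultimately show ?case using b[of "h n"] y by (auto simp: bad_def)
  qed
  then show False by simp
qed

text \<open>The function need not be continuous. Its witnesses \<open>a\<close> and \<open>g\<close>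
  form a chain over increasing parameters with jumps below \<open>e\<close>, and each value on the
  interval is close to a chain point whose parameter precedes it by less than \<open>d\<close>.
  Membership in \<open>K\<close> is required at all reals, so that a sequence of such functions
  lives in a product of copies of \<open>K\<close>.\<close>

definition approx_lift :: "'a \<Rightarrow> ennreal \<Rightarrow> real \<Rightarrow> (real \<Rightarrow> 'a) \<Rightarrow> bool" where
  "approx_lift x0 e d \<alpha> \<longleftrightarrow> \<alpha> s = x0 \<and> (\<forall>u. \<alpha> u \<in> K) \<and> (\<forall>u\<in>{s..t}. f (\<alpha> u) = \<beta> u) \<and>
     (\<exists>a g. (\<forall>j::nat. a j \<in> K \<and> g j \<in> {s..t} \<and> f (a j) = \<beta> (g j) \<and> g j \<le> g (Suc j) \<and> gdist M (a j) (a (Suc j)) < e) \<and>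
        (\<forall>u\<in>{s..t}. \<exists>j. g j \<le> u \<and> u < g j + d \<and> gdist M (a j) (\<alpha> u) < e))"

lemma approx_lift_mono:
  assumes A: "approx_lift x0 e d \<alpha>" and d: "d \<le> d'"
  shows "approx_lift x0 e d' \<alpha>"
proof -
  obtain a g where a: "\<forall>j::nat. a j \<in> K \<and> g j \<in> {s..t} \<and> f (a j) = \<beta> (g j) \<and> g j \<le> g (Suc j) \<and> gdist M (a j) (a (Suc j)) < e"
    and c: "\<forall>u\<in>{s..t}. \<exists>j. g j \<le> u \<and> u < g j + d \<and> gdist M (a j) (\<alpha> u) < e"
    using A unfolding approx_lift_def by blast
  have "\<forall>u\<in>{s..t}. \<exists>j. g j \<le> u \<and> u < g j + d' \<and> gdist M (a j) (\<alpha> u) < e"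
    using c d by (meson add_left_mono less_le_trans)
  then show ?thesis using A a unfolding approx_lift_def by blast
qed

lemma approx_lift_exists:
  assumes x0: "x0 \<in> D" "f x0 = \<beta> s" and e: "e > 0" and d: "d > 0"
  shows "\<exists>\<alpha>. approx_lift x0 e d \<alpha>"
proof -
  have x0K: "x0 \<in> K" using x0 st by (auto simp: K_def)
  obtain \<delta> where \<delta>: "\<delta> > 0" "\<And>p u u'. p \<in> K \<Longrightarrow> u \<in> {s..t} \<Longrightarrow> u' \<in> {s..t} \<Longrightarrow> f p = \<beta> u \<Longrightarrow> \<bar>u - u'\<bar> < \<delta> \<Longrightarrow>
     \<exists>p'\<in>K. f p' = \<beta> u' \<and> gdist M p p' < e"
    using uniformly_open[OF e] by blast
  \<comment> \<open>Half of \<open>\<delta>\<close> keeps consecutive grid points strictly within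
    the modulus of uniform openness, and the bound by \<open>d\<close> makes the grid fine
    enough.\<close>
  define \<eta> where "\<eta> = min (\<delta> / 2) d"
  have \<eta>: "\<eta> > 0" "\<eta> < \<delta>" "\<eta> \<le> d" using \<delta> d by (auto simp: \<eta>_def)
  \<comment> \<open>Capped at \<open>t\<close>, the grid becomes stationary, so that the chain may
    be an infinite sequence obtained by dependent choice.\<close>
  define g where "g = (\<lambda>j::nat. min t (s + real j * \<eta>))"
  have g: "g j \<in> {s..t}" "g j \<le> g (Suc j)" "\<bar>g j - g (Suc j)\<bar> < \<delta>" for j
    using st \<eta> by (auto simp: g_def algebra_simps min_def)
  have "\<exists>a. \<forall>n. (a n \<in> K \<and> f (a n) = \<beta> (g n) \<and> (n = 0 \<longrightarrow> a n = x0)) \<and> gdist M (a n) (a (Suc n)) < e"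
  proof (rule dependent_nat_choice)
    show "\<exists>x. x \<in> K \<and> f x = \<beta> (g 0) \<and> (0 = 0 \<longrightarrow> x = x0)" using x0 x0K st by (auto simp: g_def)
    fix x n assume "x \<in> K \<and> f x = \<beta> (g n) \<and> (n = 0 \<longrightarrow> x = x0)"
    then show "\<exists>y. (y \<in> K \<and> f y = \<beta> (g (Suc n)) \<and> (Suc n = 0 \<longrightarrow> y = x0)) \<and> gdist M x y < e"
      using \<delta>(2)[OF _ g(1) g(1) _ g(3), of x n] by auto
  qed
  then obtain a where a: "\<And>n. a n \<in> K" "\<And>n. f (a n) = \<beta> (g n)" "a 0 = x0" "\<And>n. gdist M (a n) (a (Suc n)) < e" by blast
  \<comment> \<open>The parameter \<open>s\<close> is treated apart: the starting value has to be
    \<open>x0\<close> itself and not merely some nearby preimage.\<close>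
  have "\<exists>p. p \<in> K \<and> (u = s \<longrightarrow> p = x0) \<and> (u \<in> {s..t} \<longrightarrow> f p = \<beta> u \<and>
      (\<exists>j. g j \<le> u \<and> u < g j + d \<and> gdist M (a j) p < e))" for u
  proof (cases "u \<in> {s..t}")
    case False
    then show ?thesis using x0K st by (intro exI[of _ x0]) auto
  next
    case u: True
    show ?thesis
    proof (cases "u = s")
      case True
      have "g 0 = s" using st by (simp add: g_def)
      then show ?thesis using True x0 x0K a(3) d e by (intro exI[of _ x0] conjI impI exI[of _ 0]) auto
    next
      case False
      define j where "j = nat \<lfloor>(u - s) / \<eta>\<rfloor>"
      have "0 \<le> (u - s) / \<eta>" using u \<eta> by simp
      then have "real j \<le> (u - s) / \<eta>" "(u - s) / \<eta> < real j + 1" unfolding j_def by linarith+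
      then have "s + real j * \<eta> \<le> u" "u < s + real j * \<eta> + \<eta>" using \<eta> by (auto simp: field_simps)
      then have gj: "g j \<le> u" "u < g j + \<eta>" using u by (auto simp: g_def min_def)
      then have "\<bar>g j - u\<bar> < \<delta>" using \<eta> by simp
      from \<delta>(2)[OF a(1) g(1) u a(2) this] obtain p' where "p'\<in>K" "f p' = \<beta> u" "gdist M (a j) p' < e" by blast
      then show ?thesis using False gj \<eta> by (intro exI[of _ p'] conjI impI exI[of _ j]) auto
    qed
  qed
  then obtain \<alpha> where \<alpha>: "\<And>u. \<alpha> u \<in> K" "\<alpha> s = x0" "\<And>u. u \<in> {s..t} \<Longrightarrow> f (\<alpha> u) = \<beta> u"
    "\<And>u. u \<in> {s..t} \<Longrightarrow> \<exists>j. g j \<le> u \<and> u < g j + d \<and> gdist M (a j) (\<alpha> u) < e" by metis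
  show ?thesis
    unfolding approx_lift_def using \<alpha> a g by (intro exI[of _ \<alpha>] conjI exI[of _ a] exI[of _ g]) auto
qed

text \<open>For small \<open>r\<close>, discreteness keeps the closed annulus between
  \<open>r\<close> and \<open>r + r\<close> free of points of the fibre over
  \<open>\<beta> u0\<close>. The part of the annulus in \<open>K\<close> is compact, so its image is
  closed and misses \<open>\<beta> u\<close> for all \<open>u\<close> near
  \<open>u0\<close>.\<close>

lemma trap:
  assumes p0: "p0 \<in> D" "f p0 = \<beta> u0" and u0: "u0 \<in> {s..t}" and W: "open W" "p0 \<in> W"
  shows "\<exists>r>0. \<exists>\<delta>>0. {x. gdist M x p0 < r + r} \<subseteq> W \<and>
    (\<forall>x\<in>K. \<forall>u\<in>{s..t}. f x = \<beta> u \<and> \<bar>u - u0\<bar> < \<delta> \<longrightarrow> \<not> (r \<le> gdist M x p0 \<and> gdist M x p0 \<le> r + r))"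
proof -
  have "discrete {x \<in> D. f x = \<beta> u0}" using dm by (simp add: discrete_mapping_on_def)
  then have "p0 isolated_in {x \<in> D. f x = \<beta> u0}" using p0 by (intro discreteD) auto
  then obtain T where T: "open T" "T \<inter> {x \<in> D. f x = \<beta> u0} = {p0}" unfolding isolated_in_def by blast
  then have "open (T \<inter> W)" "p0 \<in> T \<inter> W" using W by auto
  then obtain R where R: "R > 0" "gball M p0 R \<subseteq> T \<inter> W" using gball_subset by metis
  \<comment> \<open>A third of \<open>R\<close>, so that even the outer radius \<open>r + r\<close>
    stays below \<open>R\<close>.\<close>
  define r where "r = ennreal (R / 3)"
  have r: "r > 0" "r + r < ennreal R" using R(1) unfolding r_def
    by (simp, subst ennreal_plus[symmetric]) (auto intro: ennreal_lessI simp del: ennreal_plus)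
  define G where "G = K \<inter> {x. r \<le> gdist M x p0 \<and> gdist M x p0 \<le> r + r}"
  have "{x. r \<le> gdist M x p0 \<and> gdist M x p0 \<le> r + r} = - {x. gdist M x p0 < r} \<inter> - {x. gdist M x p0 > r + r}" by auto
  then have "closed {x. r \<le> gdist M x p0 \<and> gdist M x p0 \<le> r + r}"
    using gdist_open gdist_closed by (simp add: closed_Int closed_Compl)
  then have cG: "compact G" unfolding G_def using K_facts(1) by (rule compact_Int_closed[rotated])
  have "continuous_on G f" using cf by (rule continuous_on_subset) (use K_facts in \<open>auto simp: G_def\<close>)
  then have "closed (f ` G)" using cG by (intro compact_imp_closed compact_continuous_image)
  then have o1: "open (- (f ` G))" by (simp add: open_Compl)
  have o2: "\<beta> u0 \<in> - (f ` G)"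
  proof
    assume "\<beta> u0 \<in> f ` G"
    then obtain x where x: "x \<in> G" "f x = \<beta> u0" by auto
    then have "gdist M x p0 < ennreal R" using r by (auto simp: G_def intro: le_less_trans)
    then have "x \<in> T" using R by (auto simp: gball_def)
    then have "x = p0" using T(2) x K_facts by (auto simp: G_def)
    then show False using x r by (simp add: G_def)
  qed
  have "(\<beta> \<longlongrightarrow> \<beta> u0) (at u0 within {s..t})" using cb u0 by (simp add: continuous_on_def)
  from topological_tendstoD[OF this o1 o2]
  have "eventually (\<lambda>u. \<beta> u \<in> - (f ` G)) (at u0 within {s..t})" .
  then obtain \<delta> where \<delta>: "\<delta> > 0" "\<And>u. u \<in> {s..t} \<Longrightarrow> u \<noteq> u0 \<Longrightarrow> dist u u0 < \<delta> \<Longrightarrow> \<beta> u \<in> - (f ` G)"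
    unfolding eventually_at by blast
  then have *: "\<beta> u \<notin> f ` G" if "u \<in> {s..t}" "\<bar>u - u0\<bar> < \<delta>" for u
    using that \<open>\<beta> u0 \<in> - (f ` G)\<close> by (cases "u = u0") (auto simp: dist_real_def)
  have "{x. gdist M x p0 < r + r} \<subseteq> gball M p0 R" using r by (auto simp: gball_def)
  then have "{x. gdist M x p0 < r + r} \<subseteq> W" using R(2) by blast
  moreover have "\<not> (r \<le> gdist M x p0 \<and> gdist M x p0 \<le> r + r)"
    if "x \<in> K" "u \<in> {s..t}" "f x = \<beta> u" "\<bar>u - u0\<bar> < \<delta>" for x u
  proof
    assume "r \<le> gdist M x p0 \<and> gdist M x p0 \<le> r + r"
    then have "x \<in> G" using that(1) by (simp add: G_def)
    then show False using *[OF that(2,4)] that(3) by (metis imageI)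
  qed
  ultimately show ?thesis using r(1) \<delta>(1) by blast
qed

text \<open>The jumps of the chain are no longer than the thickness \<open>r\<close> of the annulus,
  so a chain that begins inside cannot get across. It is followed from the node of \<open>v\<close>
  to that of \<open>w\<close>, forwards or backwards according to their order.\<close>

lemma approx_lift_trapped:
  assumes A: "approx_lift x0 e d \<alpha>" and e: "e \<le> r" and d: "d + d \<le> \<delta>"
    and tr: "\<And>x u. x \<in> K \<Longrightarrow> u \<in> {s..t} \<Longrightarrow> f x = \<beta> u \<Longrightarrow> \<bar>u - u0\<bar> < \<delta> \<Longrightarrow> \<not> (r \<le> gdist M x p0 \<and> gdist M x p0 \<le> r + r)"
    and v: "v \<in> {s..t}" "\<bar>v - u0\<bar> < d" and w: "w \<in> {s..t}" "\<bar>w - u0\<bar> < d"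
    and near: "gdist M (\<alpha> v) p0 < r"
  shows "gdist M (\<alpha> w) p0 < r"
proof -
  obtain a g where a: "\<And>j::nat. a j \<in> K" "\<And>j. g j \<in> {s..t}" "\<And>j. f (a j) = \<beta> (g j)" "\<And>j. g j \<le> g (Suc j)"
    "\<And>j. gdist M (a j) (a (Suc j)) < e"
    and cov: "\<And>u. u \<in> {s..t} \<Longrightarrow> \<exists>j. g j \<le> u \<and> u < g j + d \<and> gdist M (a j) (\<alpha> u) < e"
    and \<alpha>: "\<And>u. \<alpha> u \<in> K" "\<And>u. u \<in> {s..t} \<Longrightarrow> f (\<alpha> u) = \<beta> u"
    using A unfolding approx_lift_def by blast
  have mono: "i \<le> j \<Longrightarrow> g i \<le> g j" for i j using a(4) by (rule lift_Suc_mono_le)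
  have jump: "gdist M y p0 < r" if "gdist M x p0 < r" "gdist M x y < e" "y \<in> K" "u \<in> {s..t}" "f y = \<beta> u" "\<bar>u - u0\<bar> < \<delta>" for x y u
  proof -
    have "gdist M y p0 \<le> gdist M y x + gdist M x p0" by (rule gdist_triangle)
    also have "\<dots> \<le> r + r" using that(1,2) e by (intro add_mono) (auto simp: gdist_sym)
    finally show ?thesis using tr[OF that(3-6)] by auto
  qed
  obtain i where i: "g i \<le> v" "v < g i + d" "gdist M (a i) (\<alpha> v) < e" using cov[OF v(1)] by blast
  obtain j where j: "g j \<le> w" "w < g j + d" "gdist M (a j) (\<alpha> w) < e" using cov[OF w(1)] by blast
  have dpos: "d > 0" using i by linarith
  have ai: "gdist M (a i) p0 < r"
    by (rule jump[OF near _ a(1) a(2) a(3)]) (use i v d in \<open>auto simp: gdist_sym\<close>)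
  \<comment> \<open>Every node between the two end nodes has its parameter within \<open>d\<close>
    of the range spanned by \<open>v\<close> and \<open>w\<close>, which are themselves within
    \<open>d\<close> of \<open>u0\<close>; this is why \<open>d + d\<close> must not exceed
    \<open>\<delta>\<close>.\<close>
  have win: "\<bar>g k - u0\<bar> < \<delta>" if "min i j \<le> k" "k \<le> max i j" for k
  proof -
    have "min (g i) (g j) \<le> g k" "g k \<le> max (g i) (g j)"
      using mono[of i k] mono[of j k] mono[of k i] mono[of k j] that by (auto simp: min_def max_def split: if_splits)
    then show ?thesis using i j v w d by linarith
  qed
  have "gdist M (a j) p0 < r"
  proof (cases "i \<le> j")
    case True
    have "k \<le> j \<Longrightarrow> gdist M (a k) p0 < r" if "i \<le> k" for k
      using that
    proof (induction k rule: dec_induct)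
      case (step k)
      then show ?case using jump[OF _ a(5) a(1) a(2) a(3), of k] win[of "Suc k"] True by auto
    qed (use ai in simp)
    then show ?thesis using True by simp
  next
    case False
    have "j \<le> k \<Longrightarrow> gdist M (a k) p0 < r" if "k \<le> i" for k
      using that
    proof (induction k rule: inc_induct)
      case (step k)
      have "gdist M (a (Suc k)) p0 < r" using step by auto
      moreover have "gdist M (a (Suc k)) (a k) < e" using a(5)[of k] by (simp add: gdist_sym)
      ultimately show ?case using jump[OF _ _ a(1) a(2) a(3)] win[of k] step False by auto
    qed (use ai in simp)
    then show ?thesis using False by simp
  qed
  then show ?thesis
    by (rule jump[OF _ j(3) \<alpha>(1) w(1) \<alpha>(2)[OF w(1)]]) (use w d dpos in auto)
qed

text \<open>Approximate lifts with small jumps are equicontinuous in the limit, since a neighbourhood of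
  an isolated point of a fibre is surrounded by an annulus that nearby fibres do not meet; hence
  every pointwise cluster point of approximate lifts is a lift.\<close>

lemma path_lifting:
  assumes x0: "x0 \<in> D" "f x0 = \<beta> s"
  shows "\<exists>\<alpha>. continuous_on {s..t} \<alpha> \<and> \<alpha> ` {s..t} \<subseteq> D \<and> \<alpha> s = x0 \<and> (\<forall>u\<in>{s..t}. f (\<alpha> u) = \<beta> u)"
proof -
  define \<epsilon> where "\<epsilon> = (\<lambda>n::nat. inverse (real (Suc n)))"
  have \<epsilon>0: "0 < \<epsilon> n" for n by (simp add: \<epsilon>_def)
  then have "\<exists>\<alpha>. approx_lift x0 (ennreal (\<epsilon> n)) (\<epsilon> n) \<alpha>" for n by (intro approx_lift_exists[OF x0]) auto
  then obtain A where A: "\<And>n. approx_lift x0 (ennreal (\<epsilon> n)) (\<epsilon> n) (A n)" by metis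
  then have AK: "\<And>n u. A n u \<in> K" and As: "\<And>n. A n s = x0" and Af: "\<And>n u. u \<in> {s..t} \<Longrightarrow> f (A n u) = \<beta> u"
    unfolding approx_lift_def by blast+
  obtain \<alpha> where \<alpha>: "\<And>u. \<alpha> u \<in> K"
    "\<And>u u' U V N. open U \<Longrightarrow> open V \<Longrightarrow> \<alpha> u \<in> U \<Longrightarrow> \<alpha> u' \<in> V \<Longrightarrow> \<exists>n\<ge>N. A n u \<in> U \<and> A n u' \<in> V"
    using cluster_function[of K A, OF K_facts(1) AK] by blast
  have fa: "f (\<alpha> u) = \<beta> u" if u: "u \<in> {s..t}" for u
  proof (rule ccontr)
    assume "f (\<alpha> u) \<noteq> \<beta> u"
    then obtain U V where UV: "open U" "open V" "f (\<alpha> u) \<in> U" "\<beta> u \<in> V" "U \<inter> V = {}" using hausdorff by metis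
    have "open (D \<inter> f -` U)" using continuous_open_preimage[OF cf oD UV(1)] .
    moreover have "\<alpha> u \<in> D \<inter> f -` U" using \<alpha>(1) K_facts UV by auto
    ultimately obtain n where "A n u \<in> D \<inter> f -` U" using \<alpha>(2)[of "D \<inter> f -` U" "D \<inter> f -` U" u u] by blast
    then show False using Af[OF u, of n] UV by auto
  qed
  have as: "\<alpha> s = x0"
  proof (rule ccontr)
    assume "\<alpha> s \<noteq> x0"
    then obtain U V where UV: "open U" "open V" "\<alpha> s \<in> U" "x0 \<in> V" "U \<inter> V = {}" using hausdorff by metis
    then obtain n where "A n s \<in> U" using \<alpha>(2)[of U U s s] by blast
    then show False using As UV by auto
  qed
  have cont: "continuous_on {s..t} \<alpha>"
    unfolding continuous_on_def
  proof (intro ballI topological_tendstoI)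
    fix u0 W assume u0: "u0 \<in> {s..t}" and W: "open W" "\<alpha> u0 \<in> W"
    have p0: "\<alpha> u0 \<in> D" using \<alpha>(1) K_facts by auto
    obtain r \<delta> where r: "r > 0" "\<delta> > 0" "{x. gdist M x (\<alpha> u0) < r + r} \<subseteq> W"
      and tr: "\<And>x u. x \<in> K \<Longrightarrow> u \<in> {s..t} \<Longrightarrow> f x = \<beta> u \<Longrightarrow> \<bar>u - u0\<bar> < \<delta> \<Longrightarrow>
         \<not> (r \<le> gdist M x (\<alpha> u0) \<and> gdist M x (\<alpha> u0) \<le> r + r)"
      using trap[OF p0 fa[OF u0] u0 W] by blast
    have "eventually (\<lambda>n. ennreal (\<epsilon> n) < r) sequentially"
    proof -
      have "(\<lambda>n. ennreal (\<epsilon> n)) \<longlonglongrightarrow> ennreal 0"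
        unfolding \<epsilon>_def by (intro tendsto_ennrealI LIMSEQ_inverse_real_of_nat)
      then show ?thesis using r(1) by (intro order_tendstoD) auto
    qed
    moreover have "eventually (\<lambda>n. \<epsilon> n < \<delta> / 2) sequentially"
      unfolding \<epsilon>_def using r(2) by (intro order_tendstoD(2)[OF LIMSEQ_inverse_real_of_nat]) auto
    ultimately have "eventually (\<lambda>n. ennreal (\<epsilon> n) < r \<and> \<epsilon> n < \<delta> / 2) sequentially" by (rule eventually_conj)
    then obtain N where N: "\<And>n. n \<ge> N \<Longrightarrow> ennreal (\<epsilon> n) < r \<and> \<epsilon> n < \<delta> / 2" unfolding eventually_sequentially by blast
    have "\<alpha> u \<in> W" if u: "u \<in> {s..t}" "\<bar>u - u0\<bar> < \<delta> / 2" for u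
    proof (rule ccontr)
      assume nW: "\<alpha> u \<notin> W"
      then have "r + r \<le> gdist M (\<alpha> u) (\<alpha> u0)" using r(3) by (meson mem_Collect_eq not_less subsetD)
      have "r \<le> r + r" by simp
      \<comment> \<open>The annulus is closed, so equality is excluded as well. Strictness matters:
        only an open condition passes from the cluster function to approximate lifts.\<close>
      have "r + r < gdist M (\<alpha> u) (\<alpha> u0)"
      proof -
        have "\<bar>u - u0\<bar> < \<delta>" using u(2) r(2) by linarith
        from tr[OF \<alpha>(1) u(1) fa[OF u(1)] this] order.trans[OF \<open>r \<le> r + r\<close> \<open>r + r \<le> gdist M (\<alpha> u) (\<alpha> u0)\<close>]
        show ?thesis by auto
      qed
      then have far: "\<alpha> u \<in> {x. gdist M x (\<alpha> u0) > r + r}" by simp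
      have "\<alpha> u0 \<in> {x. gdist M x (\<alpha> u0) < r}" using r(1) by simp
      \<comment> \<open>A single approximate lift is needed that is inside the annulus at
        \<open>u0\<close> and outside at \<open>u\<close>; hence clustering at both parameters
        simultaneously.\<close>
      from \<alpha>(2)[OF gdist_open gdist_closed this far, of N]
      obtain n where n: "n \<ge> N" "gdist M (A n u0) (\<alpha> u0) < r" "r + r < gdist M (A n u) (\<alpha> u0)" by auto
      have B: "approx_lift x0 (ennreal (\<epsilon> n)) (\<delta> / 2) (A n)"
        by (rule approx_lift_mono[OF A]) (use N[OF n(1)] in simp)
      have "gdist M (A n u) (\<alpha> u0) < r"
        by (rule approx_lift_trapped[OF B _ _ tr u0 _ u n(2)]) (use N[OF n(1)] r(2) in auto)
      then show False using n(3) \<open>r \<le> r + r\<close> by order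
    qed
    then show "eventually (\<lambda>u. \<alpha> u \<in> W) (at u0 within {s..t})"
      unfolding eventually_at using r(2) by (intro exI[of _ "\<delta> / 2"]) (auto simp: dist_real_def)
  qed
  show ?thesis using cont as fa \<alpha>(1) K_facts by (intro exI[of _ \<alpha>]) auto
qed

end

section \<open>Finite mean oscillation\<close>

lemma ennreal_divide_le_iff:
  fixes V :: ennreal
  assumes "V \<noteq> 0" "V \<noteq> top"
  shows "I / V \<le> c \<longleftrightarrow> I \<le> c * V"
proof
  have VI: "(I / V) * V = I" using assms by (metis ennreal_mult_divide_eq ennreal_times_divide mult.commute)
  assume "I / V \<le> c"
  then have "(I / V) * V \<le> c * V" by (rule mult_right_mono) simp
  then show "I \<le> c * V" by (simp only: VI)
next
  assume "I \<le> c * V"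
  then have "I / V \<le> (c * V) / V" by (rule divide_right_mono_ennreal)
  then show "I / V \<le> c" using assms by (simp add: ennreal_mult_divide_eq)
qed

lemma harmonic_unbounded:
  assumes m: "m \<ge> (1::nat)"
  obtains K where "K > m" "(\<Sum>k=m..<K. inverse (real k)) \<ge> B"
proof -
  have "\<not> summable (\<lambda>n. inverse (real n))" using not_summable_harmonic[where 'a = real] by simp
  then have "\<not> summable (\<lambda>n. inverse (real (n + m)))" using summable_iff_shift[of "\<lambda>n. inverse (real n)" m] by simp
  then have "\<not> (\<forall>N. (\<Sum>n<N. inverse (real (n + m))) \<le> max B 1)"
    using summableI_nonneg_bounded[of "\<lambda>n. inverse (real (n + m))" "max B 1"] by fastforce
  then obtain N where N: "(\<Sum>n<N. inverse (real (n + m))) > max B 1" by (auto simp: not_le)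
  then have "N > 0" by (cases N) auto
  moreover have "(\<Sum>k=m..<N + m. inverse (real k)) = (\<Sum>n<N. inverse (real (n + m)))"
    using sum.shift_bounds_nat_ivl[of "\<lambda>k. inverse (real k)" 0 m N] by (simp add: atLeast0LessThan)
  ultimately show ?thesis using that[of "N + m"] N by simp
qed

lemma ennreal_le_add_abs_diff:
  fixes q x :: ennreal
  assumes "q < top"
  shows "x \<le> q + e2ennreal \<bar>enn2ereal x - enn2ereal q\<bar>"
proof -
  obtain c where c: "q = ennreal c" "0 \<le> c" using assms by (cases q) auto
  show ?thesis
  proof (cases x)
    case (real r)
    then have "enn2ereal x - enn2ereal q = ereal (r - c)" using c by (simp add: enn2ereal_ennreal)
    then have d: "e2ennreal \<bar>enn2ereal x - enn2ereal q\<bar> = ennreal \<bar>r - c\<bar>" by (simp add: e2ennreal_ereal)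
    have "ennreal r \<le> ennreal (c + \<bar>r - c\<bar>)" by (rule ennreal_leI) linarith
    also have "\<dots> = ennreal c + ennreal \<bar>r - c\<bar>" by (rule ennreal_plus) (use c in auto)
    finally show ?thesis unfolding d using real c by (simp only:)
  next
    case top
    then have "enn2ereal x - enn2ereal q = \<infinity>" using c by (simp add: enn2ereal_ennreal)
    then show ?thesis by (simp add: e2ennreal_infty)
  qed
qed

context riem_mfd
begin

lemma gball_sets: "gball M p r \<in> sets (riem_volume M)"
  by (rule riem_volume_sets) (simp add: gball_open)

lemma gball_mono: "r \<le> r' \<Longrightarrow> gball M p r \<subseteq> gball M p r'"
  by (auto simp: gball_def intro: less_le_trans ennreal_leI)

text \<open>On the ball of half the radius, \<open>Q\<close> is at most the old mean plus its
  deviation from that mean. The integral of the deviation over the larger ball is at most a constant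
  times its volume, and the volumes of consecutive balls are comparable, so each halving raises the
  mean by a bounded amount.\<close>

lemma fmo_growth:
  assumes Q: "Q \<in> borel_measurable (riem_volume M)" and fmo: "finite_mean_oscillation_at M Q b"
  obtains k0 C where "k0 \<ge> (1::nat)" "C > 0"
    "\<forall>k\<ge>k0. (\<integral>\<^sup>+x\<in>gball M b ((1/2)^k). Q x \<partial>riem_volume M) \<le> ennreal (C * real k * ((1/2)^k) ^ CARD('n))"
proof -
  let ?\<mu> = "riem_volume M" and ?n = "CARD('n)"
  let ?osc = "\<lambda>\<epsilon>. mean_over M (gball M b \<epsilon>) (\<lambda>x. e2ennreal \<bar>enn2ereal (Q x) - enn2ereal (mean_over M (gball M b \<epsilon>) Q)\<bar>)"
  obtain r where r: "r > 0" "(\<integral>\<^sup>+ x\<in>gball M b r. Q x \<partial>?\<mu>) < \<infinity>"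
    using fmo unfolding finite_mean_oscillation_at_def by blast
  have "Limsup (at_right 0) ?osc < \<infinity>" using fmo unfolding finite_mean_oscillation_at_def by blast
  then obtain C0' where C0': "Limsup (at_right 0) ?osc < C0'" "C0' < \<infinity>" using dense by blast
  then obtain C0 where C0: "C0' = ennreal C0" "0 \<le> C0" by (cases C0') auto
  have "eventually (\<lambda>\<epsilon>. ?osc \<epsilon> < ennreal C0) (at_right 0)" using Limsup_lessD[OF C0'(1)] by (simp add: C0)
  then obtain \<epsilon>1 where \<epsilon>1: "\<epsilon>1 > 0" "\<And>\<epsilon>. 0 < \<epsilon> \<Longrightarrow> \<epsilon> < \<epsilon>1 \<Longrightarrow> ?osc \<epsilon> < ennreal C0"
    unfolding eventually_at_right_field by blast
  obtain r0 a A where v: "r0 > 0" "a > 0" "A > 0"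
    and vl: "\<And>r. 0 < r \<Longrightarrow> r \<le> r0 \<Longrightarrow> ennreal (a * r ^ ?n) \<le> emeasure ?\<mu> (gball M b r)"
    and vu: "\<And>r. 0 < r \<Longrightarrow> r \<le> r0 \<Longrightarrow> emeasure ?\<mu> (gball M b r) \<le> ennreal (A * r ^ ?n)"
    using gball_volume[of b] by metis
  obtain k1 where k1: "(1/2::real) ^ k1 < min r (min \<epsilon>1 r0)"
    using real_arch_pow_inv[of "min r (min \<epsilon>1 r0)" "1/2"] r \<epsilon>1 v by auto
  \<comment> \<open>At least 1, so that constants can be absorbed into multiples of \<open>k\<close>
    and reciprocals of \<open>k\<close> make sense.\<close>
  define k0 where "k0 = max k1 1"
  have small: "(1/2::real) ^ k < min r (min \<epsilon>1 r0)" if "k \<ge> k0" for k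
  proof -
    have "(1/2::real) ^ k \<le> (1/2) ^ k1" using that by (intro power_decreasing) (auto simp: k0_def)
    then show ?thesis using k1 by (rule le_less_trans)
  qed
  define B where "B = (\<lambda>k. gball M b ((1/2::real) ^ k))"
  define V where "V = (\<lambda>k. emeasure ?\<mu> (B k))"
  define q where "q = (\<lambda>k. mean_over M (B k) Q)"
  define I where "I = (\<lambda>k. (\<integral>\<^sup>+x\<in>B k. Q x \<partial>?\<mu>))"
  have Bs[measurable]: "B k \<in> sets ?\<mu>" for k unfolding B_def by (rule gball_sets)
  have qI: "q k = I k / V k" for k by (simp add: q_def I_def V_def mean_over_def)
  have V: "V k \<noteq> 0" "V k \<noteq> top" if "k \<ge> k0" for k
  proof -
    have "0 < ennreal (a * ((1/2)^k) ^ ?n)" using v by simp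
    also have "\<dots> \<le> V k" unfolding V_def B_def using small[OF that] by (intro vl) auto
    finally show "V k \<noteq> 0" by simp
    have "V k \<le> ennreal (A * ((1/2)^k) ^ ?n)" unfolding V_def B_def using small[OF that] by (intro vu) auto
    then show "V k \<noteq> top" by (auto simp: top_unique)
  qed
  have Ifin: "I k < top" if "k \<ge> k0" for k
  proof -
    have "I k \<le> (\<integral>\<^sup>+ x\<in>gball M b r. Q x \<partial>?\<mu>)"
      unfolding I_def B_def using small[OF that] gball_mono[of "(1/2)^k" r b]
      by (intro nn_integral_mono) (auto simp: indicator_def)
    then show ?thesis using r(2) by (simp add: le_less_trans)
  qed
  have qfin: "q k < top" if "k \<ge> k0" for k
    unfolding qI using Ifin[OF that] V[OF that] by (simp add: ennreal_divide_eq_top_iff less_top[symmetric])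
  \<comment> \<open>\<open>C0\<close> bounds the mean oscillation, and the remaining factor bounds
    the ratio of the volumes of consecutive dyadic balls.\<close>
  define E where "E = C0 * (A / a) * 2 ^ ?n"
  have E: "E \<ge> 0" using C0 v by (simp add: E_def)
  have step: "q (Suc k) \<le> q k + ennreal E" if k: "k \<ge> k0" for k
  proof -
    let ?d = "\<lambda>x. e2ennreal \<bar>enn2ereal (Q x) - enn2ereal (q k)\<bar>"
    have dm[measurable]: "?d \<in> borel_measurable ?\<mu>" using Q by measurable
    have sub: "B (Suc k) \<subseteq> B k" unfolding B_def by (rule gball_mono) simp
    have "mean_over M (B k) ?d \<le> ennreal C0"
      using \<epsilon>1(2)[of "(1/2)^k"] small[OF k] unfolding B_def q_def by (auto intro: less_imp_le)
    then have "(\<integral>\<^sup>+x\<in>B k. ?d x \<partial>?\<mu>) / V k \<le> ennreal C0" by (simp only: mean_over_def V_def)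
    then have osc: "(\<integral>\<^sup>+x\<in>B k. ?d x \<partial>?\<mu>) \<le> ennreal C0 * V k"
      by (rule ennreal_divide_le_iff[OF V[OF k], THEN iffD1])
    have "V k \<le> ennreal (A * ((1/2)^k) ^ ?n)" unfolding V_def B_def using small[OF k] by (intro vu) auto
    also have "A * ((1/2)^k) ^ ?n = (A / a * 2 ^ ?n) * (a * ((1/2) ^ Suc k) ^ ?n)"
      using v by (simp add: power_mult_distrib power_divide)
    also have "ennreal \<dots> = ennreal (A / a * 2 ^ ?n) * ennreal (a * ((1/2) ^ Suc k) ^ ?n)"
      using v by (intro ennreal_mult) auto
    also have "\<dots> \<le> ennreal (A / a * 2 ^ ?n) * V (Suc k)"
      unfolding V_def B_def using small[of "Suc k"] k by (intro mult_left_mono vl) auto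
    finally have "ennreal C0 * V k \<le> ennreal C0 * (ennreal (A / a * 2 ^ ?n) * V (Suc k))" by (rule mult_left_mono) simp
    also have "\<dots> = ennreal E * V (Suc k)"
    proof -
      have "ennreal E = ennreal C0 * ennreal (A / a * 2 ^ ?n)"
        unfolding E_def mult.assoc by (rule ennreal_mult) (use C0 v in auto)
      then show ?thesis by (simp only: mult.assoc)
    qed
    finally have ev: "ennreal C0 * V k \<le> ennreal E * V (Suc k)" .
    have "I (Suc k) \<le> (\<integral>\<^sup>+x. (q k * indicator (B (Suc k)) x + ?d x * indicator (B k) x) \<partial>?\<mu>)"
      unfolding I_def using ennreal_le_add_abs_diff[OF qfin[OF k]] sub
      by (intro nn_integral_mono) (auto simp: indicator_def)
    also have "\<dots> = q k * V (Suc k) + (\<integral>\<^sup>+x\<in>B k. ?d x \<partial>?\<mu>)"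
      by (subst nn_integral_add) (auto simp: nn_integral_cmult_indicator V_def)
    also have "\<dots> \<le> q k * V (Suc k) + ennreal E * V (Suc k)"
      using order.trans[OF osc ev] by (rule add_left_mono)
    also have "\<dots> = (q k + ennreal E) * V (Suc k)" by (simp add: distrib_right)
    finally have le: "I (Suc k) \<le> (q k + ennreal E) * V (Suc k)" .
    have "k0 \<le> Suc k" using k by simp
    from ennreal_divide_le_iff[OF V[OF this], THEN iffD2, OF le] show ?thesis unfolding qI[of "Suc k"] .
  qed
  obtain c0 where c0: "q k0 = ennreal c0" "0 \<le> c0" using qfin[of k0] by (cases "q k0") auto
  have qb: "q (k0 + j) \<le> ennreal (c0 + real j * E)" for j
  proof (induction j)
    case (Suc j)
    have "q (k0 + Suc j) \<le> q (k0 + j) + ennreal E" using step[of "k0 + j"] by simp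
    also have "\<dots> \<le> ennreal (c0 + real j * E) + ennreal E" by (rule add_right_mono[OF Suc])
    also have "\<dots> = ennreal (c0 + real (Suc j) * E)" using c0 E by (subst ennreal_plus[symmetric]) (auto simp: algebra_simps)
    finally show ?case .
  qed (simp add: c0)
  \<comment> \<open>For \<open>k\<close> at least 1 the mean is at most
    \<open>(c0 + E + 1) * k\<close>, and the factor \<open>A\<close> comes from the upper volume
    bound. The summand 1 keeps \<open>C\<close> positive.\<close>
  define C where "C = (c0 + E + 1) * A"
  have "I k \<le> ennreal (C * real k * ((1/2)^k) ^ ?n)" if k: "k \<ge> k0" for k
  proof -
    have k1: "real k \<ge> 1" using k by (auto simp: k0_def)
    have "c0 + real (k - k0) * E \<le> (c0 + E + 1) * real k"
    proof -
      have "c0 * 1 \<le> c0 * real k" "real (k - k0) * E \<le> real k * E"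
        using mult_left_mono[OF k1 c0(2)] E by (auto intro!: mult_right_mono)
      then show ?thesis using k1 by (simp add: algebra_simps)
    qed
    then have "q k \<le> ennreal ((c0 + E + 1) * real k)"
      using qb[of "k - k0"] k by (simp add: ennreal_leI order.trans)
    then have "I k \<le> ennreal ((c0 + E + 1) * real k) * V k"
      unfolding qI by (rule ennreal_divide_le_iff[OF V[OF k], THEN iffD1])
    also have "\<dots> \<le> ennreal ((c0 + E + 1) * real k) * ennreal (A * ((1/2)^k) ^ ?n)"
      unfolding V_def B_def using small[OF k] by (intro mult_left_mono vu) auto
    also have "\<dots> = ennreal (C * real k * ((1/2)^k) ^ ?n)"
      using c0 E v by (subst ennreal_mult[symmetric]) (auto simp: C_def algebra_simps)
    finally show ?thesis .
  qed
  then show ?thesis using that[of k0 C] c0 E v by (auto simp: k0_def C_def I_def B_def)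
qed

text \<open>The test function is the step function with value \<open>2 ^ (k + 1) / (k * H)\<close> on
  \<open>(2 ^ -(k + 1), 2 ^ -k)\<close> for \<open>m \<le> k < K\<close>, where \<open>H\<close> is the sum of the \<open>1 / k\<close>; it is a discrete
  version of \<open>1 / (t * log (1 / t))\<close>, normalized.\<close>

lemma fmo_test_function:
  assumes n: "CARD('n) \<ge> 2" and Q: "Q \<in> borel_measurable (riem_volume M)" and fmo: "finite_mean_oscillation_at M Q b"
  obtains m0 where "\<forall>m\<ge>m0. \<forall>e>0. \<exists>K>m. \<exists>\<eta> :: real \<Rightarrow> ennreal.
     \<eta> \<in> borel_measurable (lebesgue_on {(1/2)^K<..<(1/2)^m}) \<and>
     (\<integral>\<^sup>+ r. \<eta> r \<partial>lebesgue_on {(1/2)^K<..<(1/2)^m}) \<ge> 1 \<and>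
     (\<integral>\<^sup>+ x\<in>gannulus M ((1/2)^K) ((1/2)^m) b. Q x * \<eta> (enn2real (gdist M x b)) ^ CARD('n) \<partial>riem_volume M) \<le> ennreal e"
proof -
  let ?\<mu> = "riem_volume M" and ?n = "CARD('n)"
  obtain k0 C where k0: "k0 \<ge> (1::nat)" "C > 0"
    "\<forall>k\<ge>k0. (\<integral>\<^sup>+x\<in>gball M b ((1/2)^k). Q x \<partial>?\<mu>) \<le> ennreal (C * real k * ((1/2)^k) ^ ?n)"
    using fmo_growth[OF Q fmo] .
  have "\<exists>K>m. \<exists>\<eta> :: real \<Rightarrow> ennreal.
     \<eta> \<in> borel_measurable (lebesgue_on {(1/2)^K<..<(1/2)^m}) \<and>
     (\<integral>\<^sup>+ r. \<eta> r \<partial>lebesgue_on {(1/2)^K<..<(1/2)^m}) \<ge> 1 \<and>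
     (\<integral>\<^sup>+ x\<in>gannulus M ((1/2)^K) ((1/2)^m) b. Q x * \<eta> (enn2real (gdist M x b)) ^ ?n \<partial>?\<mu>) \<le> ennreal e"
    if m: "m \<ge> k0" and e: "e > 0" for m e
  proof -
    \<comment> \<open>The quotient makes the final bound \<open>2 ^ n * C / H\<close> at most
      \<open>e\<close>; the 1 ensures that \<open>k * H\<close> is at least 1 when exponents are
      compared.\<close>
    obtain K where K: "K > m" "(\<Sum>k=m..<K. inverse (real k)) \<ge> max 1 (2 ^ ?n * C / e)"
      using harmonic_unbounded[of m "max 1 (2 ^ ?n * C / e)"] m k0 by auto
    define H where "H = (\<Sum>k=m..<K. inverse (real k))"
    have H: "H \<ge> 1" "2 ^ ?n * C / e \<le> H" using K(2) by (auto simp: H_def)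
    define J where "J = (\<lambda>k::nat. {(1/2::real) ^ Suc k<..<(1/2) ^ k})"
    define c where "c = (\<lambda>k::nat. 2 ^ Suc k / (real k * H))"
    define \<eta> where "\<eta> = (\<lambda>t. \<Sum>k=m..<K. ennreal (c k) * indicator (J k) t)"
    have kpos: "real k > 0" if "k \<in> {m..<K}" for k using that m k0 by auto
    have c0: "c k \<ge> 0" for k using H by (simp add: c_def)
    let ?S = "{(1/2::real)^K<..<(1/2)^m}"
    have \<eta>m: "\<eta> \<in> borel_measurable borel" unfolding \<eta>_def J_def by measurable
    then have \<eta>m': "\<eta> \<in> borel_measurable lebesgue" by (intro measurable_completion) simp
    have JS: "J k \<subseteq> ?S" if "k \<in> {m..<K}" for k
    proof -
      have le: "(1/2::real) ^ K \<le> (1/2) ^ Suc k" "(1/2::real) ^ k \<le> (1/2) ^ m"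
        using that by (auto intro!: power_decreasing simp del: power_Suc)
      show ?thesis
      proof
        fix x assume "x \<in> J k"
        then have x: "(1/2) ^ Suc k < x" "x < (1/2) ^ k" by (simp_all add: J_def del: power_Suc)
        show "x \<in> ?S" using le_less_trans[OF le(1) x(1)] less_le_trans[OF x(2) le(2)] by simp
      qed
    qed
    have Jdisj: "j = k" if "t \<in> J j" "t \<in> J k" for t j k
    proof (rule ccontr)
      assume "j \<noteq> k"
      then consider "Suc j \<le> k" | "Suc k \<le> j" by linarith
      then show False
      proof cases
        case 1
        from power_decreasing[OF this, of "1/2::real"] show False using that by (auto simp: J_def)
      next
        case 2
        from power_decreasing[OF this, of "1/2::real"] show False using that by (auto simp: J_def)
      qed
    qed
    have "(\<integral>\<^sup>+ r. \<eta> r \<partial>lebesgue_on ?S) = (\<integral>\<^sup>+ r. \<eta> r * indicator ?S r \<partial>lborel)"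
      by (subst nn_integral_restrict_space) (auto simp: nn_integral_completion)
    also have "\<dots> = (\<integral>\<^sup>+ r. (\<Sum>k=m..<K. ennreal (c k) * indicator (J k) r) \<partial>lborel)"
    proof (rule nn_integral_cong)
      fix r
      have "\<eta> r = 0" if "r \<notin> ?S" unfolding \<eta>_def
      proof (intro sum.neutral ballI)
        fix k assume "k \<in> {m..<K}"
        then have "r \<notin> J k" using JS that by blast
        then show "ennreal (c k) * indicator (J k) r = 0" by simp
      qed
      then have "\<eta> r * indicator ?S r = \<eta> r"
        by (cases "r \<in> ?S") (simp_all del: greaterThanLessThan_iff)
      then show "\<eta> r * indicator ?S r = (\<Sum>k=m..<K. ennreal (c k) * indicator (J k) r)"
        by (simp only: \<eta>_def)
    qed
    also have "\<dots> = (\<Sum>k=m..<K. ennreal (c k) * emeasure lborel (J k))"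
      by (subst nn_integral_sum) (auto simp: J_def nn_integral_cmult_indicator)
    also have "\<dots> = (\<Sum>k=m..<K. ennreal (inverse (real k) / H))"
    proof (rule sum.cong)
      fix k assume k: "k \<in> {m..<K}"
      have "emeasure lborel (J k) = ennreal ((1/2) ^ Suc k)" unfolding J_def by (subst emeasure_lborel_Ioo) auto
      moreover have "ennreal (c k * (1/2) ^ Suc k) = ennreal (c k) * ennreal ((1/2) ^ Suc k)"
        by (rule ennreal_mult) (use c0 in auto)
      ultimately have "ennreal (c k) * emeasure lborel (J k) = ennreal (c k * (1/2) ^ Suc k)" by (simp only:)
      also have "c k * (1/2) ^ Suc k = inverse (real k) / H"
        using kpos[OF k] H by (simp add: c_def power_divide field_simps)
      finally show "ennreal (c k) * emeasure lborel (J k) = ennreal (inverse (real k) / H)" .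
    qed simp
    also have "\<dots> = ennreal (\<Sum>k=m..<K. inverse (real k) / H)" using H by (intro sum_ennreal) auto
    also have "(\<Sum>k=m..<K. inverse (real k) / H) = 1"
      unfolding sum_divide_distrib[symmetric] H_def[symmetric] using H by simp
    finally have int1: "(\<integral>\<^sup>+ r. \<eta> r \<partial>lebesgue_on ?S) = 1" by simp
    let ?B = "\<lambda>k. gball M b ((1/2)^k)"
    \<comment> \<open>On each dyadic shell the test function is constant, and the shell is enlarged
      to the ball of its outer radius, for which a growth bound is known.\<close>
    have "(\<integral>\<^sup>+ x\<in>gannulus M ((1/2)^K) ((1/2)^m) b. Q x * \<eta> (enn2real (gdist M x b)) ^ ?n \<partial>?\<mu>)
       \<le> (\<integral>\<^sup>+ x. (\<Sum>k=m..<K. ennreal (c k ^ ?n) * (Q x * indicator (?B k) x)) \<partial>?\<mu>)"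
    proof (rule nn_integral_mono)
      fix x
      let ?t = "enn2real (gdist M x b)"
      show "Q x * \<eta> ?t ^ ?n * indicator (gannulus M ((1/2)^K) ((1/2)^m) b) x
        \<le> (\<Sum>k=m..<K. ennreal (c k ^ ?n) * (Q x * indicator (?B k) x))"
      proof (cases "x \<in> gannulus M ((1/2)^K) ((1/2)^m) b \<and> (\<exists>k\<in>{m..<K}. ?t \<in> J k)")
        case True
        then obtain k where k: "k \<in> {m..<K}" "?t \<in> J k" by blast
        have fin: "gdist M x b < top" using True by (auto simp: gannulus_def intro: less_trans)
        have "\<eta> ?t = (\<Sum>j\<in>{m..<K}. if j = k then ennreal (c k) else 0)"
          unfolding \<eta>_def using k Jdisj by (intro sum.cong) (auto simp: indicator_def)
        then have "\<eta> ?t = ennreal (c k)" using k(1) by simp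
        moreover have "gdist M x b < ennreal ((1/2)^k)"
        proof -
          have "gdist M x b = ennreal ?t" using fin by simp
          also have "\<dots> < ennreal ((1/2)^k)" using k(2) by (intro ennreal_lessI) (auto simp: J_def)
          finally show ?thesis .
        qed
        ultimately have "Q x * \<eta> ?t ^ ?n * indicator (gannulus M ((1/2)^K) ((1/2)^m) b) x
           \<le> ennreal (c k ^ ?n) * (Q x * indicator (?B k) x)"
          using c0 by (simp add: gball_def ennreal_power mult.commute indicator_def)
        also have "\<dots> \<le> (\<Sum>k=m..<K. ennreal (c k ^ ?n) * (Q x * indicator (?B k) x))"
          by (rule member_le_sum[OF k(1)]) auto
        finally show ?thesis .
      next
        \<comment> \<open>This covers points whose distance is exactly a power of one half: they
          belong to no \<open>J k\<close>, and the test function vanishes there.\<close>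
        case False
        then have "\<eta> ?t = 0 \<or> x \<notin> gannulus M ((1/2)^K) ((1/2)^m) b"
          unfolding \<eta>_def by (auto simp: indicator_def intro!: sum.neutral)
        then have "Q x * \<eta> ?t ^ ?n * indicator (gannulus M ((1/2)^K) ((1/2)^m) b) x = 0"
          by (auto simp: indicator_def)
        then show ?thesis by (simp only: zero_le)
      qed
    qed
    also have "\<dots> = (\<Sum>k=m..<K. ennreal (c k ^ ?n) * (\<integral>\<^sup>+ x\<in>?B k. Q x \<partial>?\<mu>))"
    proof -
      have mm: "(\<lambda>x. Q x * indicator (?B k) x) \<in> borel_measurable ?\<mu>" for k using Q gball_sets by auto
      show ?thesis using mm by (subst nn_integral_sum) (auto simp: nn_integral_cmult)
    qed
    also have "\<dots> \<le> (\<Sum>k=m..<K. ennreal (2 ^ ?n * C / H ^ 2 * inverse (real k)))"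
    proof (rule sum_mono)
      fix k assume k: "k \<in> {m..<K}"
      have "ennreal (c k ^ ?n) * (\<integral>\<^sup>+ x\<in>?B k. Q x \<partial>?\<mu>) \<le> ennreal (c k ^ ?n) * ennreal (C * real k * ((1/2)^k) ^ ?n)"
        using k0(3) k m by (intro mult_left_mono) auto
      also have "\<dots> = ennreal (c k ^ ?n * (C * real k * ((1/2)^k) ^ ?n))"
        using c0 k0 by (intro ennreal_mult[symmetric]) auto
      also have "\<dots> \<le> ennreal (2 ^ ?n * C / H ^ 2 * inverse (real k))"
      proof (rule ennreal_leI)
        have kp: "real k \<ge> 1" using kpos[OF k] by simp
        have "c k * (1/2) ^ k = 2 / (real k * H)" by (simp add: c_def power_divide)
        then have e1: "c k ^ ?n * ((1/2)^k) ^ ?n = (2 / (real k * H)) ^ ?n" by (simp add: power_mult_distrib[symmetric])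
        \<comment> \<open>Here the dimension enters. With exponent 2, the factor \<open>k\<close>
          from the growth of \<open>Q\<close> leaves \<open>1 / (k * H ^ 2)\<close>, whose sum is
          \<open>1 / H\<close>.\<close>
        have "(real k * H) ^ 2 \<le> (real k * H) ^ ?n"
          using n kp H(1) mult_mono[of 1 "real k" 1 H] by (intro power_increasing) auto
        moreover have "0 < (real k * H) ^ 2" using kp H(1) by simp
        ultimately have "1 / (real k * H) ^ ?n \<le> 1 / (real k * H) ^ 2" by (intro frac_le) simp_all
        then have "(C * real k * 2 ^ ?n) * (1 / (real k * H) ^ ?n) \<le> (C * real k * 2 ^ ?n) * (1 / (real k * H) ^ 2)"
          using k0 kp by (intro mult_left_mono) auto
        also have "\<dots> = 2 ^ ?n * C / H ^ 2 * inverse (real k)"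
          using kp H(1) by (simp add: field_simps power2_eq_square)
        finally have "(C * real k * 2 ^ ?n) * (1 / (real k * H) ^ ?n) \<le> 2 ^ ?n * C / H ^ 2 * inverse (real k)" .
        moreover have "c k ^ ?n * (C * real k * ((1/2)^k) ^ ?n) = (C * real k) * (c k ^ ?n * ((1/2)^k) ^ ?n)"
          by (simp only: ac_simps)
        moreover have "\<dots> = (C * real k * 2 ^ ?n) * (1 / (real k * H) ^ ?n)"
          unfolding e1 by (simp add: power_divide)
        ultimately show "c k ^ ?n * (C * real k * ((1/2)^k) ^ ?n) \<le> 2 ^ ?n * C / H ^ 2 * inverse (real k)"
          by (simp only:)
      qed
      finally show "ennreal (c k ^ ?n) * (\<integral>\<^sup>+ x\<in>?B k. Q x \<partial>?\<mu>) \<le> ennreal (2 ^ ?n * C / H ^ 2 * inverse (real k))" .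
    qed
    also have "\<dots> = ennreal (\<Sum>k=m..<K. 2 ^ ?n * C / H ^ 2 * inverse (real k))"
      using k0 by (intro sum_ennreal) auto
    also have "(\<Sum>k=m..<K. 2 ^ ?n * C / H ^ 2 * inverse (real k)) = 2 ^ ?n * C / H ^ 2 * H"
      unfolding sum_distrib_left[symmetric] H_def ..
    also have "\<dots> = 2 ^ ?n * C / H" using H(1) by (simp add: power2_eq_square)
    also have "ennreal (2 ^ ?n * C / H) \<le> ennreal e"
    proof (rule ennreal_leI)
      have "2 ^ ?n * C \<le> H * e" using H(2) e by (simp add: pos_divide_le_eq)
      then show "2 ^ ?n * C / H \<le> e" using H(1) by (simp add: pos_divide_le_eq mult.commute)
    qed
    finally have fin: "(\<integral>\<^sup>+ x\<in>gannulus M ((1/2)^K) ((1/2)^m) b. Q x * \<eta> (enn2real (gdist M x b)) ^ ?n \<partial>?\<mu>) \<le> ennreal e" .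
    have "\<eta> \<in> borel_measurable (lebesgue_on ?S)" using \<eta>m' by (rule measurable_restrict_space1)
    then show ?thesis using K(1) int1 fin by (intro exI[of _ K] conjI exI[of _ \<eta>]) auto
  qed
  then show ?thesis using that[of k0] by blast
qed

end

section \<open>Continua and the moduli of curve families\<close>

context riem_mfd
begin

lemma small_continuum:
  fixes x :: 'a
  assumes W: "open W" "x \<in> W"
  shows "\<exists>V C. open V \<and> x \<in> V \<and> V \<subseteq> C \<and> C \<subseteq> W \<and> compact C \<and> connected C"
proof -
  obtain c where c: "c \<in> atlas M" "x \<in> fst c" using atlas_cover .
  have "open (snd c ` (W \<inter> fst c))" using W chart_open[OF c(1)] by (intro chart_image_open_sub[OF c(1)]) auto
  moreover have "snd c x \<in> snd c ` (W \<inter> fst c)" using W c by blast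
  ultimately obtain R where R: "R > 0" "cball (snd c x) R \<subseteq> snd c ` (W \<inter> fst c)"
    unfolding open_contains_cball by blast
  let ?V = "{p \<in> fst c. snd c p \<in> ball (snd c x) R}" and ?C = "{p \<in> fst c. snd c p \<in> cball (snd c x) R}"
  have sub: "cball (snd c x) R \<subseteq> snd c ` fst c" using R(2) by blast
  have "?C = inv_into (fst c) (snd c) ` cball (snd c x) R"
  proof (intro set_eqI iffI)
    fix p assume "p \<in> ?C"
    then have "p = inv_into (fst c) (snd c) (snd c p)" "snd c p \<in> cball (snd c x) R"
      using chart_inv[OF c(1), of p] by simp_all
    then show "p \<in> inv_into (fst c) (snd c) ` cball (snd c x) R" by (rule image_eqI)
  next
    fix p assume "p \<in> inv_into (fst c) (snd c) ` cball (snd c x) R"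
    then obtain z where z: "z \<in> cball (snd c x) R" "p = inv_into (fst c) (snd c) z" by blast
    then have "z \<in> snd c ` fst c" using sub by blast
    then show "p \<in> ?C" using z chart_inv_into[of z c] chart_inv_right[of z c] by simp
  qed
  then have "connected ?C"
    using connected_continuous_image[OF continuous_on_subset[OF chart_inv_cont[OF c(1)] sub] connected_cball] by simp
  moreover have "compact ?C" by (rule chart_preimage_compact[OF c(1) compact_cball sub])
  moreover have "open ?V" by (rule chart_preimage_open[OF c(1) open_ball])
  moreover have "?V \<subseteq> ?C" by auto
  moreover have "?C \<subseteq> W"
  proof
    fix p assume p: "p \<in> ?C"
    then have "snd c p \<in> snd c ` (W \<inter> fst c)" using R(2) by blast
    then obtain q where "q \<in> W" "q \<in> fst c" "snd c p = snd c q" by blast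
    then show "p \<in> W" using p inj_onD[OF chart_inj[OF c(1)], of p q] by simp
  qed
  moreover have "x \<in> ?V" using c R by simp
  ultimately show ?thesis by blast
qed

text \<open>The set of points that share a continuum with \<open>x\<close> is both open and closed
  relative to \<open>D\<close>, since a small coordinate ball can be attached to a continuum that
  meets it. Openness is shown for a generic \<open>P\<close> so as to serve this set and its
  complement.\<close>

lemma joined_by_continuum:
  fixes D :: "'a set"
  assumes D: "open D" "connected D" and x: "x \<in> D" "z \<in> D"
  shows "\<exists>C. compact C \<and> connected C \<and> C \<subseteq> D \<and> x \<in> C \<and> z \<in> C"
proof -
  define J where "J = (\<lambda>z. \<exists>C. compact C \<and> connected C \<and> C \<subseteq> D \<and> x \<in> C \<and> z \<in> C)"
  have loc: "\<exists>V. open V \<and> p \<in> V \<and> V \<subseteq> D \<and> (\<forall>q\<in>V. J q \<longleftrightarrow> J p)" if "p \<in> D" for p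
  proof -
    obtain V C where V: "open V" "p \<in> V" "V \<subseteq> C" "C \<subseteq> D" "compact C" "connected C"
      using small_continuum[OF D(1) \<open>p \<in> D\<close>] by blast
    have tr: "J q'" if q: "J q" "q \<in> C" "q' \<in> C" for q q'
    proof -
      obtain C' where C': "compact C'" "connected C'" "C' \<subseteq> D" "x \<in> C'" "q \<in> C'" using q(1) unfolding J_def by blast
      have "connected (C' \<union> C)" using C' V q(2) by (intro connected_Un) auto
      then show ?thesis unfolding J_def using C' V q by (intro exI[of _ "C' \<union> C"]) auto
    qed
    then show ?thesis using V by (intro exI[of _ V]) blast
  qed
  have op: "open {p \<in> D. P (J p)}" for P :: "bool \<Rightarrow> bool"
  proof (subst open_subopen, intro ballI)
    fix p assume "p \<in> {p \<in> D. P (J p)}"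
    then have p: "p \<in> D" "P (J p)" by auto
    obtain V where V: "open V" "p \<in> V" "V \<subseteq> D" "\<forall>q\<in>V. J q \<longleftrightarrow> J p" using loc[OF p(1)] by blast
    have "V \<subseteq> {p \<in> D. P (J p)}"
    proof
      fix q assume q: "q \<in> V"
      have "J q = J p" using V(4) q by (rule bspec)
      moreover have "q \<in> D" using V(3) q by (rule subsetD)
      ultimately show "q \<in> {p \<in> D. P (J p)}" using p(2) by simp
    qed
    then show "\<exists>T. open T \<and> p \<in> T \<and> T \<subseteq> {p \<in> D. P (J p)}" using V(1,2) by blast
  qed
  have "J x" unfolding J_def using x(1) by (intro exI[of _ "{x}"]) auto
  then have "{p \<in> D. \<not> J p} \<inter> D = {}"
    using connectedD[OF D(2) op[of "\<lambda>j. j"] op[of "\<lambda>j. \<not> j"]] x(1) by blast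
  then show ?thesis using x(2) unfolding J_def by blast
qed

text \<open>Finitely many small continua cover \<open>K\<close>; each is enlarged until it contains
  one fixed point \<open>x\<close>, so their union is connected. The ring inequality accepts only
  continua, whereas the preimage of a compact set need not be connected.\<close>

lemma compact_in_continuum:
  fixes D :: "'a set"
  assumes D: "open D" "connected D" and K: "compact K" "K \<subseteq> D"
  shows "\<exists>C. compact C \<and> connected C \<and> C \<subseteq> D \<and> K \<subseteq> C"
proof (cases "K = {}")
  case False
  then obtain x where x: "x \<in> K" by blast
  have "\<exists>V C. open V \<and> p \<in> V \<and> V \<subseteq> C \<and> C \<subseteq> D \<and> compact C \<and> connected C \<and> x \<in> C" if "p \<in> K" for p
  proof -
    have pD: "p \<in> D" "x \<in> D" using \<open>p \<in> K\<close> x K by auto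
    obtain V C where V: "open V" "p \<in> V" "V \<subseteq> C" "C \<subseteq> D" "compact C" "connected C"
      using small_continuum[OF D(1) pD(1)] by blast
    obtain C' where C': "compact C'" "connected C'" "C' \<subseteq> D" "x \<in> C'" "p \<in> C'"
      using joined_by_continuum[OF D pD(2,1)] by blast
    have "connected (C' \<union> C)" using C' V by (intro connected_Un) auto
    then show ?thesis using V C' by (intro exI[of _ V] exI[of _ "C' \<union> C"] conjI compact_Un) auto
  qed
  then have "\<forall>p\<in>K. \<exists>V C. open V \<and> p \<in> V \<and> V \<subseteq> C \<and> C \<subseteq> D \<and> compact C \<and> connected C \<and> x \<in> C" by blast
  from bchoice[OF this] obtain V where "\<forall>p\<in>K. \<exists>C. open (V p) \<and> p \<in> V p \<and> V p \<subseteq> C \<and> C \<subseteq> D \<and> compact C \<and> connected C \<and> x \<in> C" ..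
  from bchoice[OF this] obtain C where "\<forall>p\<in>K. open (V p) \<and> p \<in> V p \<and> V p \<subseteq> C p \<and> C p \<subseteq> D \<and> compact (C p) \<and> connected (C p) \<and> x \<in> C p" ..
  then have VC: "\<And>p. p \<in> K \<Longrightarrow> open (V p)" "\<And>p. p \<in> K \<Longrightarrow> p \<in> V p" "\<And>p. p \<in> K \<Longrightarrow> V p \<subseteq> C p"
    "\<And>p. p \<in> K \<Longrightarrow> C p \<subseteq> D" "\<And>p. p \<in> K \<Longrightarrow> compact (C p)" "\<And>p. p \<in> K \<Longrightarrow> connected (C p)" "\<And>p. p \<in> K \<Longrightarrow> x \<in> C p"
    by blast+
  have cov: "K \<subseteq> (\<Union>p\<in>K. V p)" using VC(2) by blast
  from compactE_image[of K K V, OF K(1) VC(1) cov]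
  obtain P where P: "P \<subseteq> K" "finite P" "K \<subseteq> (\<Union>p\<in>P. V p)" .
  have "\<And>p. p \<in> P \<Longrightarrow> p \<in> K" by (rule subsetD[OF P(1)])
  note VC' = VC[OF this]
  have "compact (\<Union>p\<in>P. C p)" by (intro compact_UN P(2) VC'(5))
  moreover have "connected (\<Union>p\<in>P. C p)"
  proof (rule connected_Union)
    show "connected S" if "S \<in> C ` P" for S using that VC'(6) by blast
    show "\<Inter> (C ` P) \<noteq> {}" using VC'(7) by blast
  qed
  moreover have "(\<Union>p\<in>P. C p) \<subseteq> D" using VC'(4) by blast
  moreover have "K \<subseteq> (\<Union>p\<in>P. C p)" using P(3) VC'(3) by blast
  ultimately show ?thesis by blast
qed (auto intro: exI[of _ "{}"])

end

section \<open>Transfer of moduli by lifting, and properness\<close>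

text \<open>Each curve from \<open>E\<close> to f(C) in f(D), traversed backwards, has a lift that
  starts in \<open>C\<close> and ends over \<open>E\<close>, thus in \<open>E2\<close>. A density
  admissible for the images of such lifts is admissible for the original curves, as reversal does
  not change arc length integrals.\<close>

lemma joining_modulus_le:
  fixes M :: "('a::{t2_space, second_countable_topology}, 'n::finite) riem"
    and N :: "('b::{t2_space, second_countable_topology}, 'n) riem"
    and D :: "'a set" and f :: "'a \<Rightarrow> 'b"
  assumes M: "riemannian_manifold M" and N: "riemannian_manifold N"
    and D: "open D" and f: "continuous_on D f" "open_mapping_on D f" "discrete_mapping_on D f"
    and proper: "\<And>K. compact K \<Longrightarrow> K \<subseteq> f ` D \<Longrightarrow> compact {x \<in> D. f x \<in> K}"
    and E: "E \<subseteq> f ` D" "\<And>x. x \<in> D \<Longrightarrow> f x \<in> E \<Longrightarrow> x \<in> E2" and C: "C \<subseteq> D"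
  shows "modulus N (joining_curves E (f ` C) (f ` D)) \<le> modulus N (image_curves f (joining_curves C E2 D))"
  unfolding modulus_def
proof (rule INF_superset_mono)
  interpret M: riem_mfd M by standard (rule M)
  interpret N: riem_mfd N by standard (rule N)
  show "admissible N (image_curves f (joining_curves C E2 D)) \<subseteq> admissible N (joining_curves E (f ` C) (f ` D))"
  proof
    fix \<rho> assume \<rho>: "\<rho> \<in> admissible N (image_curves f (joining_curves C E2 D))"
    have "arc_integral N \<Gamma> \<rho> \<ge> 1" if \<Gamma>: "\<Gamma> \<in> joining_curves E (f ` C) (f ` D)" "locally_rectifiable N \<Gamma>" for \<Gamma>
    proof -
      obtain s t \<gamma> where g: "\<Gamma> = ({s..t}, \<gamma>)" "s < t" "continuous_on {s..t} \<gamma>" "\<gamma> s \<in> E" "\<gamma> t \<in> f ` C"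
        "\<forall>\<tau>. s < \<tau> \<and> \<tau> < t \<longrightarrow> \<gamma> \<tau> \<in> f ` D"
        using \<Gamma>(1) unfolding joining_curves_def by blast
      have gin: "\<gamma> u \<in> f ` D" if "u \<in> {s..t}" for u
      proof -
        consider "u = s" | "u = t" | "s < u \<and> u < t" using \<open>u \<in> {s..t}\<close> by fastforce
        then show ?thesis using g E(1) C by cases auto
      qed
      \<comment> \<open>Reversed, the curve begins in f(C), where a preimage inside \<open>C\<close>
        is available as the starting point of the lift.\<close>
      define \<beta> where "\<beta> = (\<lambda>u. \<gamma> (s + t - u))"
      have cb: "continuous_on {s..t} \<beta>" unfolding \<beta>_def
        by (rule continuous_on_compose2[OF g(3)]) (auto intro!: continuous_intros)
      have bim: "\<beta> ` {s..t} \<subseteq> f ` D" unfolding \<beta>_def using gin by auto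
      have "compact (\<beta> ` {s..t})" using cb by (intro compact_continuous_image) auto
      from proper[OF this bim] have pc: "compact {x \<in> D. f x \<in> \<beta> ` {s..t}}" .
      interpret L: lifting M D f \<beta> s t
        by unfold_locales (use D f g(2) cb pc bim in auto)
      obtain x0 where x0: "x0 \<in> C" "f x0 = \<beta> s" using g(5) by (auto simp: \<beta>_def)
      have "x0 \<in> D" using x0(1) C by (rule subsetD[rotated])
      from L.path_lifting[OF this x0(2)]
      obtain \<alpha> where "continuous_on {s..t} \<alpha> \<and> \<alpha> ` {s..t} \<subseteq> D \<and> \<alpha> s = x0 \<and> (\<forall>u\<in>{s..t}. f (\<alpha> u) = \<beta> u)" ..
      then have \<alpha>: "continuous_on {s..t} \<alpha>" "\<alpha> ` {s..t} \<subseteq> D" "\<alpha> s = x0" "\<forall>u\<in>{s..t}. f (\<alpha> u) = \<beta> u"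
        by simp_all
      have \<alpha>D: "\<alpha> u \<in> D" if "s \<le> u" "u \<le> t" for u using \<alpha>(2) that by (simp add: image_subset_iff)
      have "f (\<alpha> t) \<in> E" using \<alpha>(4) g(2,4) by (simp add: \<beta>_def)
      then have aE: "\<alpha> t \<in> E2" using E(2)[OF \<alpha>D] g(2) by simp
      have aC: "\<alpha> s \<in> C" using \<alpha>(3) x0(1) by simp
      have "({s..t}, \<alpha>) \<in> joining_curves C E2 D"
        unfolding joining_curves_def using \<alpha>D
        by (intro CollectI exI[of _ s] exI[of _ t] exI[of _ \<alpha>] conjI refl allI impI g(2) \<alpha>(1) aC aE) auto
      then have im: "({s..t}, f \<circ> \<alpha>) \<in> image_curves f (joining_curves C E2 D)"
        unfolding image_curves_def by force
      have rect: "locally_rectifiable N ({s..t}, \<gamma>)" using \<Gamma>(2) g(1) by simp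
      have rev: "(f \<circ> \<alpha>) u = \<gamma> (s + t - u)" if "u \<in> {s..t}" for u using \<alpha>(4) that by (simp add: \<beta>_def)
      note R = N.reverse_curve[OF rect g(3) rev]
      have "1 \<le> arc_integral N ({s..t}, f \<circ> \<alpha>) \<rho>"
        using \<rho> im R(1) unfolding admissible_def by blast
      also have "\<dots> \<le> arc_integral N ({s..t}, \<gamma>) \<rho>" by (rule R(2))
      finally show ?thesis using g(1) by simp
    qed
    then show "\<rho> \<in> admissible N (joining_curves E (f ` C) (f ` D))"
      using \<rho> unfolding admissible_def by blast
  qed
qed simp

text \<open>A sequence in the preimage subconverges in the compact manifold while its values
  subconverge in \<open>K\<close>. A limit outside \<open>D\<close> would be a boundary point and
  would place the limit of the values in the frontier of the open set f(D), although
  \<open>K\<close> lies inside f(D).\<close>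

lemma proper_of_boundary_clusters:
  fixes f :: "'a::{t2_space, second_countable_topology} \<Rightarrow> 'b::{t2_space, second_countable_topology}"
  assumes cM: "compact (UNIV :: 'a set)" and D: "open D" and f: "continuous_on D f" "open_mapping_on D f"
    and cl: "(\<Union>x\<in>frontier D. cluster_set f D x) \<subseteq> frontier (f ` D)"
    and K: "compact K" "K \<subseteq> f ` D"
  shows "compact {x \<in> D. f x \<in> K}"
proof -
  let ?P = "{x \<in> D. f x \<in> K}"
  have oD': "open (f ` D)" using f(2) D by (auto simp: open_mapping_on_def)
  have "seq_compact ?P"
    unfolding seq_compact_def
  proof (intro allI impI)
    fix \<xi> :: "nat \<Rightarrow> 'a" assume \<xi>: "\<forall>n. \<xi> n \<in> ?P"
    obtain x r where r: "strict_mono r" "(\<xi> \<circ> r) \<longlonglongrightarrow> x"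
      using compact_imp_seq_compact[OF cM] unfolding seq_compact_def by blast
    have "\<forall>n. (f \<circ> \<xi> \<circ> r) n \<in> K" using \<xi> by auto
    then obtain z q where q: "z \<in> K" "strict_mono q" "(f \<circ> \<xi> \<circ> r \<circ> q) \<longlonglongrightarrow> z"
      using compact_imp_seq_compact[OF K(1)] unfolding seq_compact_def by blast
    have lx: "(\<lambda>n. \<xi> (r (q n))) \<longlonglongrightarrow> x" using LIMSEQ_subseq_LIMSEQ[OF r(2) q(2)] by (simp add: o_def)
    have lz: "(\<lambda>n. f (\<xi> (r (q n)))) \<longlonglongrightarrow> z" using q(3) by (simp add: o_def)
    have xD: "x \<in> D"
    proof (rule ccontr)
      assume nD: "x \<notin> D"
      have "x \<in> closure D"
        using Lim_in_closed_set[OF closed_closure _ _ lx, of D] \<xi> closure_subset[of D] by (auto intro!: always_eventually)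
      then have "x \<in> frontier D" using nD D by (simp add: frontier_def interior_open)
      moreover have "z \<in> cluster_set f D x" unfolding cluster_set_def
        using \<xi> lx lz by (intro CollectI exI[of _ "\<lambda>n. \<xi> (r (q n))"]) auto
      ultimately have "z \<in> frontier (f ` D)" using cl by blast
      then show False using q(1) K(2) oD' by (auto simp: frontier_def interior_open)
    qed
    have "(\<lambda>n. f (\<xi> (r (q n)))) \<longlonglongrightarrow> f x"
      using continuous_on_tendsto_compose[OF f(1) lx xD] \<xi> by auto
    then have "f x = z" using lz LIMSEQ_unique by blast
    then show "\<exists>l\<in>?P. \<exists>r. strict_mono r \<and> (\<xi> \<circ> r) \<longlonglongrightarrow> l"
      using q(1) xD lx strict_mono_o[OF r(1) q(2)] by (intro bexI[of _ x] exI[of _ "r \<circ> q"]) (auto simp: o_def)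
  qed
  then show ?thesis by (simp add: seq_compact_eq_compact)
qed

theorem mainTheorem1:
  fixes M :: "('a::{t2_space, second_countable_topology}, 'n::finite) riem"
    and N :: "('b::{t2_space, second_countable_topology}, 'n) riem"
    and D :: "'a set" and f :: "'a \<Rightarrow> 'b" and Q :: "'a \<Rightarrow> ennreal"
    and b :: 'a and y :: 'b
  assumes "CARD('n) \<ge> 2"
    and "riemannian_manifold M" and "riemannian_manifold N"
    and "compact (UNIV :: 'a set)"
    and "is_domain D" and "b \<in> frontier D"
    and "Q \<in> borel_measurable (riem_volume M)" and "\<And>x. x \<notin> D \<Longrightarrow> Q x = 0"
    and "continuous_on D f" and "open_mapping_on D f" and "discrete_mapping_on D f"
    and "ring_Q_mapping_at M N D f Q b"
    and "domain_locally_connected_at D b"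
    and "(\<Union>x\<in>frontier D. cluster_set f D x) \<subseteq> frontier (f ` D)"
    and "y \<in> cluster_set f D b" and "strongly_accessible_at N (f ` D) y"
    and "finite_mean_oscillation_at M Q b"
  shows "cluster_set f D b = {y}"
proof (rule ccontr)
  interpret M: riem_mfd M by standard (rule assms(2))
  assume "cluster_set f D b \<noteq> {y}"
  then obtain y' where y': "y' \<in> cluster_set f D b" "y' \<noteq> y" using assms(15) by blast
  have D: "open D" "connected D" using assms(5) by (auto simp: is_domain_def)
  have bD: "b \<notin> D" using assms(6) D by (auto simp: frontier_def interior_open)
  obtain \<xi> where \<xi>: "\<forall>k. \<xi> k \<in> D" "\<xi> \<longlonglongrightarrow> b" "(\<lambda>k. f (\<xi> k)) \<longlonglongrightarrow> y"
    using assms(15) unfolding cluster_set_def by blast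
  obtain \<xi>' where \<xi>': "\<forall>k. \<xi>' k \<in> D" "\<xi>' \<longlonglongrightarrow> b" "(\<lambda>k. f (\<xi>' k)) \<longlonglongrightarrow> y'"
    using y'(1) unfolding cluster_set_def by blast
  obtain U U' where U: "open U" "open U'" "y \<in> U" "y' \<in> U'" "U \<inter> U' = {}" using hausdorff y'(2) by metis
  from assms(16)[unfolded strongly_accessible_at_def, THEN conjunct2, THEN spec[of _ U], THEN mp, OF conjI[OF U(1,3)]]
  obtain E V \<delta> where E: "\<delta> > 0" "compact E" "E \<subseteq> f ` D" "open V" "y \<in> V" "V \<subseteq> U"
    and acc: "\<forall>F. is_continuum F \<and> F \<subseteq> f ` D \<and> F \<inter> frontier U \<noteq> {} \<and> F \<inter> frontier V \<noteq> {} \<longrightarrow>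
              modulus N (joining_curves E F (f ` D)) \<ge> ennreal \<delta>"
    by (elim exE conjE)
  note proper = proper_of_boundary_clusters[OF assms(4) D(1) assms(9,10,14)]
  have "compact {x \<in> D. f x \<in> E}" by (rule proper[OF E(2,3)])
  then obtain E2 where E2: "compact E2" "connected E2" "E2 \<subseteq> D" "{x \<in> D. f x \<in> E} \<subseteq> E2"
    using M.compact_in_continuum[OF D, of "{x \<in> D. f x \<in> E}"] by blast
  \<comment> \<open>The continuum \<open>E2\<close> is fixed before any radius is chosen: a ball
    about \<open>b\<close> that avoids it limits the outer radius of the annulus.\<close>
  have "open (- E2)" "b \<in> - E2" using E2 bD by (auto simp: compact_imp_closed open_Compl)
  then obtain rE where rE: "rE > 0" "gball M b rE \<subseteq> - E2" using M.gball_subset by metis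
  from assms(12)[unfolded ring_Q_mapping_at_def]
  obtain r0 where r0: "r0 > 0" and ring: "\<forall>r1 r2 E1 E2. 0 < r1 \<and> r1 < r2 \<and> r2 < r0 \<and>
           is_continuum E1 \<and> E1 \<subseteq> closure (gball M b r1) \<inter> D \<and>
           is_continuum E2 \<and> E2 \<subseteq> (- gball M b r2) \<inter> D \<longrightarrow>
           (\<forall>\<eta> :: real \<Rightarrow> ennreal.
              \<eta> \<in> borel_measurable (lebesgue_on {r1<..<r2}) \<and>
              (\<integral>\<^sup>+ r. \<eta> r \<partial>lebesgue_on {r1<..<r2}) \<ge> 1 \<longrightarrow>
              modulus N (image_curves f (joining_curves E1 E2 D)) \<le>
                (\<integral>\<^sup>+ x\<in>gannulus M r1 r2 b. Q x * \<eta> (enn2real (gdist M x b)) ^ CARD('n) \<partial>riem_volume M))"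
    by (elim exE conjE)
  obtain m0 where m0: "\<forall>m\<ge>m0. \<forall>e>0. \<exists>K>m. \<exists>\<eta> :: real \<Rightarrow> ennreal.
     \<eta> \<in> borel_measurable (lebesgue_on {(1/2)^K<..<(1/2)^m}) \<and>
     (\<integral>\<^sup>+ r. \<eta> r \<partial>lebesgue_on {(1/2)^K<..<(1/2)^m}) \<ge> 1 \<and>
     (\<integral>\<^sup>+ x\<in>gannulus M ((1/2)^K) ((1/2)^m) b. Q x * \<eta> (enn2real (gdist M x b)) ^ CARD('n) \<partial>riem_volume M) \<le> ennreal e"
    using M.fmo_test_function[OF assms(1,7,17)] .
  obtain m1 where m1: "(1/2::real) ^ m1 < min r0 rE" using real_arch_pow_inv[of "min r0 rE" "1/2"] r0 rE by auto
  \<comment> \<open>The bound \<open>m0\<close> makes the test function available, while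
    \<open>m1\<close> puts the outer radius below that of the ring condition and keeps
    \<open>E2\<close> outside the outer ball.\<close>
  define m where "m = max m0 m1"
  have m: "m \<ge> m0" "(1/2::real) ^ m < r0" "(1/2::real) ^ m \<le> rE"
  proof -
    have "(1/2::real) ^ m \<le> (1/2) ^ m1" by (intro power_decreasing) (auto simp: m_def)
    then have "(1/2::real) ^ m < min r0 rE" using m1 by (rule le_less_trans)
    then show "(1/2::real) ^ m < r0" "(1/2::real) ^ m \<le> rE" by (simp_all only: min_less_iff_conj less_imp_le)
    show "m \<ge> m0" by (simp add: m_def)
  qed
  \<comment> \<open>The outer radius stays fixed, and only the inner one shrinks until the integral
    is at most half of the lower bound supplied by accessibility.\<close>
  obtain K and \<eta> :: "real \<Rightarrow> ennreal" where K: "K > m" "\<eta> \<in> borel_measurable (lebesgue_on {(1/2)^K<..<(1/2)^m})"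
     "(\<integral>\<^sup>+ r. \<eta> r \<partial>lebesgue_on {(1/2)^K<..<(1/2)^m}) \<ge> 1"
     "(\<integral>\<^sup>+ x\<in>gannulus M ((1/2)^K) ((1/2)^m) b. Q x * \<eta> (enn2real (gdist M x b)) ^ CARD('n) \<partial>riem_volume M) \<le> ennreal (\<delta> / 2)"
    using m0 m(1) E(1) half_gt_zero by blast
  let ?B = "gball M b ((1/2) ^ K)"
  have "open ?B" "b \<in> ?B" by (auto intro: M.gball_open)
  then obtain W where W: "open W" "b \<in> W" "W \<subseteq> ?B" "connected (W \<inter> D)"
    using assms(13) unfolding domain_locally_connected_at_def by blast
  have "eventually (\<lambda>k. \<xi> k \<in> W) sequentially" "eventually (\<lambda>k. f (\<xi> k) \<in> V) sequentially"
    "eventually (\<lambda>k. \<xi>' k \<in> W) sequentially" "eventually (\<lambda>k. f (\<xi>' k) \<in> U') sequentially"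
    using topological_tendstoD[OF \<xi>(2) W(1,2)] topological_tendstoD[OF \<xi>(3) E(4,5)]
      topological_tendstoD[OF \<xi>'(2) W(1,2)] topological_tendstoD[OF \<xi>'(3) U(2,4)] .
  then have "eventually (\<lambda>k. \<xi> k \<in> W \<and> f (\<xi> k) \<in> V \<and> \<xi>' k \<in> W \<and> f (\<xi>' k) \<in> U') sequentially"
    by eventually_elim auto
  then obtain k where k: "\<xi> k \<in> W" "f (\<xi> k) \<in> V" "\<xi>' k \<in> W" "f (\<xi>' k) \<in> U'"
    unfolding eventually_sequentially by blast
  have "open (W \<inter> D)" "\<xi> k \<in> W \<inter> D" "\<xi>' k \<in> W \<inter> D" using W D k \<xi>(1) \<xi>'(1) by auto
  then obtain C where C: "compact C" "connected C" "C \<subseteq> W \<inter> D" "\<xi> k \<in> C" "\<xi>' k \<in> C"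
    using M.joined_by_continuum[OF _ W(4)] by blast
  let ?F = "f ` C"
  have CD: "C \<subseteq> D" using C by blast
  have cfC: "continuous_on C f" using assms(9) CD by (rule continuous_on_subset)
  have F: "is_continuum ?F"
    unfolding is_continuum_def using C cfC by (auto intro: compact_continuous_image connected_continuous_image)
  have conF: "connected ?F" using F by (simp add: is_continuum_def)
  have kF: "f (\<xi> k) \<in> ?F" "f (\<xi>' k) \<in> ?F" by (intro imageI C)+
  \<comment> \<open>The second point is mapped into \<open>U'\<close>, which is disjoint from
    \<open>U\<close> and hence from \<open>V\<close>. So f(C) has a point inside and a point outside
    each of \<open>U\<close> and \<open>V\<close>, and by connectedness it meets both
    frontiers.\<close>
  have kU: "f (\<xi> k) \<in> U" "f (\<xi>' k) \<notin> U" "f (\<xi>' k) \<notin> V" using k(2,4) U(5) E(6) by blast+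
  have meets: "?F \<inter> frontier X \<noteq> {}" if "f (\<xi> k) \<in> X" "f (\<xi>' k) \<notin> X" for X
  proof (rule connected_Int_frontier[OF conF])
    show "?F \<inter> X \<noteq> {}" using IntI[OF kF(1) that(1)] by (metis empty_iff)
    show "?F - X \<noteq> {}" using DiffI[OF kF(2) that(2)] by (metis empty_iff)
  qed
  note fr = meets[OF kU(1,2)] meets[OF k(2) kU(3)]
  have "ennreal \<delta> \<le> modulus N (joining_curves E ?F (f ` D))"
    by (rule acc[THEN spec, THEN mp]) (intro conjI F image_mono CD fr)
  also have "\<dots> \<le> modulus N (image_curves f (joining_curves C E2 D))"
    using E2(4) by (intro joining_modulus_le[OF assms(2,3) D(1) assms(9-11) proper E(3) _ CD]) blast+
  also have "\<dots> \<le> (\<integral>\<^sup>+ x\<in>gannulus M ((1/2)^K) ((1/2)^m) b. Q x * \<eta> (enn2real (gdist M x b)) ^ CARD('n) \<partial>riem_volume M)"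
  proof (rule ring[rule_format])
    show "0 < (1/2::real)^K \<and> (1/2::real)^K < (1/2)^m \<and> (1/2::real)^m < r0 \<and>
           is_continuum C \<and> C \<subseteq> closure ?B \<inter> D \<and> is_continuum E2 \<and> E2 \<subseteq> - gball M b ((1/2)^m) \<inter> D"
    proof (intro conjI Int_greatest)
    show "(0::real) < (1/2)^K" by simp
    show "(1/2::real)^K < (1/2)^m" using K(1) by (intro power_strict_decreasing) auto
    show "(1/2::real)^m < r0" by (rule m(2))
    show "is_continuum C" "is_continuum E2" using C(1,2) E2(1,2) by (simp_all add: is_continuum_def)
    show "C \<subseteq> closure ?B" using C(3) W(3) closure_subset[of ?B] by blast
    show "C \<subseteq> D" by (rule CD)
    show "E2 \<subseteq> - gball M b ((1/2)^m)" using rE(2) M.gball_mono[OF m(3), of b] by blast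
    show "E2 \<subseteq> D" by (rule E2(3))
    qed
  qed (rule conjI[OF K(2,3)])
  also have "\<dots> \<le> ennreal (\<delta> / 2)" by (rule K(4))
  finally have "ennreal \<delta> \<le> ennreal (\<delta> / 2)" .
  then show False using E(1) by (simp add: ennreal_le_iff2)
qed

end
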